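(* Let $(M,g,J)$ be a Hermitian manifold with fundamental form $\omega$, and let $t\in\mathbb R$. The curvature tensor $\mathfrak R(\omega,t)$ of the Gauduchon connection $\rho(\nabla^t)$ on $T^{1,0}M$ is $$\mathfrak R_{i\bar jk\bar\ell}(\omega,t)=\Theta_{i\bar jk\bar\ell}+t(\Theta_{i\bar\ell k\bar j}+\Theta_{k\bar ji\bar\ell}-2\Theta_{i\bar jk\bar\ell})+t^2\left(T_{ik}^p\overline{T_{j\ell}^q}h_{p\bar q}-h^{p\bar q}h_{m\bar\ell}h_{k\bar n}T_{ip}^m\overline{T_{jq}^n}\right).$$ The Ricci curvatures are given by $$\mathfrak{Ric}^{(1)}(\omega,t)=\Theta^{(1)}-t(\partial\partial^*\omega+\bar\partial\bar\partial^*\omega),$$ $$\mathfrak{Ric}^{(2)}(\omega,t)=\Theta^{(1)}-(1-2t)\sqrt{-1}\Lambda\partial\bar\partial\omega-(1-t)(\partial\partial^*\omega+\bar\partial\bar\partial^*\omega)+(1-t)^2\sqrt{-1}\,T\boxdot\bar T-t^2\sqrt{-1}\,T\circ\bar T,$$ $$\mathfrak{Ric}^{(3)}(\omega,t)=\Theta^{(1)}-t\sqrt{-1}\Lambda\partial\bar\partial\omega-(1-t)\partial\partial^*\omega-t\bar\partial\bar\partial^*\omega+(t-t^2)\sqrt{-1}\,T\boxdot\bar T+t^2\,T((\partial^*\omega)^{\#}),$$ $$\mathfrak{Ric}^{(4)}(\omega,t)=\Theta^{(1)}-t\sqrt{-1}\Lambda\partial\bar\partial\omega-(1-t)\bar\partial\bar\partial^*\omega-t\partial\partial^*\omega+(t-t^2)\sqrt{-1}\,T\boxdot\bar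 T+t^2\,\overline{T((\partial^*\omega)^{\#})}.$$ The scalar curvatures are related by $$s^{(1)}(\omega,t)=s_{\mathrm C}-2t\langle\partial\partial^*\omega,\omega\rangle,\qquad s^{(2)}(\omega,t)=s_{\mathrm C}-(1-2t)\langle\partial\partial^*\omega,\omega\rangle-t^2\left(2|\partial\omega|^2+|\partial^*\omega|^2\right).$$
   Context: $(M,g,J)$: Riemannian manifold with integrable complex structure $J$, $g(JX,JY)=g(X,Y)$; tensors and connections are extended $\mathbb C$-linearly to $T_{\mathbb C}M=T^{1,0}M\oplus T^{0,1}M$. In local holomorphic coordinates, $h_{i\bar j}=g(\frac{\partial}{\partial z^i},\frac{\partial}{\partial\bar z^j})$, $h^{i\bar\ell}h_{j\bar\ell}=\delta^i_j$; repeated indices are summed. $\omega(X,Y)=g(JX,Y)$, i.e. $\omega=\sqrt{-1}h_{i\bar j}dz^i\wedge d\bar z^j$. Chern connection on $(T^{1,0}M,h)$: $\Gamma_{ij}^k=h^{k\bar\ell}\frac{\partial h_{j\bar\ell}}{\partial z^i}$, torsion $T_{ij}^k=\Gamma_{ij}^k-\Gamma_{ji}^k$, curvature $\Theta_{i\bar jk\bar\ell}=-\frac{\partial^2h_{k\bar\ell}}{\partial z^i\partial\bar z^j}+h^{p\bar q}\frac{\partial h_{p\bar\ell}}{\partial\bar z^j}\frac{\partial h_{k\bar q}}{\partial z^i}$, $\Theta^{(1)}=\sqrt{-1}h^{k\bar\ell}\Theta_{i\bar jk\bar\ell}dz^i\wedge d\bar z^j$, $s_{\mathrm C}=h^{i\bar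 j}h^{k\bar\ell}\Theta_{i\bar jk\bar\ell}$. Gauduchon connections: $\nabla^t$ is the real connection on $T_{\mathbb R}M$ (preserving $g$ and $J$) with $g(\nabla^t_XY,Z)=g(\nabla^{\mathrm{LC}}_XY,Z)+\frac t2d\omega(JX,JY,JZ)+\frac{t-1}2d\omega(JX,Y,Z)$, where $\nabla^{\mathrm{LC}}$ is the Levi-Civita connection. $\rho(\nabla^t)$ is the restriction of its complexification to $T^{1,0}M$; in coordinates $\rho(\nabla^t)_{\frac{\partial}{\partial z^i}}\frac{\partial}{\partial z^j}=(\Gamma_{ij}^k-tT_{ij}^k)\frac{\partial}{\partial z^k}$ and $\rho(\nabla^t)_{\frac{\partial}{\partial\bar z^i}}\frac{\partial}{\partial z^j}=t\,h^{k\bar m}h_{j\bar n}\overline{T_{im}^n}\frac{\partial}{\partial z^k}$. With $\nabla=\rho(\nabla^t)$, $\mathfrak R(X,Y,Z,W)=h(\nabla_X\nabla_YZ-\nabla_Y\nabla_XZ-\nabla_{[X,Y]}Z,W)$, and $\mathfrak R_{i\bar jk\bar\ell}(\omega,t)$ is its value on $(\frac{\partial}{\partial z^i},\frac{\partial}{\partial\bar z^j},\frac{\partial}{\partial z^k},\frac{\partial}{\partial\bar z^\ell})$. The forms $\mathfrak{Ric}^{(a)}(\omega,t)=\sqrt{-1}\,\mathfrak{Ric}^{(a)}_{i\bar j}dz^i\wedge d\bar z^j$ have components $\mathfrak{Ric}^{(1)}_{i\bar j}=h^{k\bar\ell}\mathfrak R_{i\bar jk\bar\ell}$, $\mathfrak{Ric}^{(2)}_{i\bar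 j}=h^{k\bar\ell}\mathfrak R_{k\bar\ell i\bar j}$, $\mathfrak{Ric}^{(3)}_{i\bar j}=h^{k\bar\ell}\mathfrak R_{i\bar\ell k\bar j}$, $\mathfrak{Ric}^{(4)}_{i\bar j}=h^{k\bar\ell}\mathfrak R_{k\bar ji\bar\ell}$. Scalar curvatures: $s^{(1)}(\omega,t)=h^{i\bar j}h^{k\bar\ell}\mathfrak R_{i\bar jk\bar\ell}$, $s^{(2)}(\omega,t)=h^{i\bar\ell}h^{k\bar j}\mathfrak R_{i\bar jk\bar\ell}$. Pointwise inner products $\langle\cdot,\cdot\rangle$ of forms are those induced by $h$, normalized so that where $h_{i\bar j}=\delta_{ij}$ the monomials $dz^{i_1}\wedge\cdots\wedge d\bar z^{j_1}\wedge\cdots$ (increasing indices) are orthonormal. $\partial^*,\bar\partial^*$ are the formal $L^2$-adjoints of $\partial,\bar\partial$, and $\Lambda$ is the adjoint of $\alpha\mapsto\omega\wedge\alpha$. In coordinates $\partial^*\omega=-\sqrt{-1}\,\overline{T_{jk}^k}\,d\bar z^j$. Further notation: $T\boxdot\bar T=h^{p\bar q}h_{k\bar\ell}T_{ip}^k\overline{T_{jq}^\ell}\,dz^i\wedge d\bar z^j$; $T\circ\bar T=h^{p\bar q}h^{s\bar r}h_{k\bar j}h_{i\bar\ell}T_{sp}^k\overline{T_{rq}^\ell}\,dz^i\wedge d\bar z^j$. Writing $\partial^*\omega=\beta_{\bar q}d\bar z^q$ and $(\partial^*\omega)^{\#}=h^{p\bar q}\beta_{\bar q}\frac{\partial}{\partial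 z^p}$, one sets $T((\partial^*\omega)^{\#})=h_{m\bar j}h^{p\bar q}\beta_{\bar q}T_{pi}^m\,dz^i\wedge d\bar z^j=\sqrt{-1}\,h^{p\bar q}h_{m\bar j}T_{ip}^m\overline{T_{qn}^n}\,dz^i\wedge d\bar z^j$. *)

theory Defs
  imports "HOL-Analysis.Analysis"
begin

section \<open>Hermitian manifolds\<close>

primrec Ck_on :: "nat \<Rightarrow> 'a::real_normed_vector set \<Rightarrow> ('a \<Rightarrow> 'b::real_normed_vector) \<Rightarrow> bool" where
  "Ck_on 0 S f \<longleftrightarrow> continuous_on S f"
| "Ck_on (Suc k) S f \<longleftrightarrow>
     (\<forall>x\<in>S. f differentiable (at x)) \<and> (\<forall>v. Ck_on k S (\<lambda>x. frechet_derivative f (at x) v))"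

definition smooth_on :: "'a::real_normed_vector set \<Rightarrow> ('a \<Rightarrow> 'b::real_normed_vector) \<Rightarrow> bool" where
  "smooth_on S f \<longleftrightarrow> (\<forall>k. Ck_on k S f)"

text \<open>In a holomorphic chart a real tangent vector is an element of the real vector space
  \<^typ>\<open>complex^'n\<close>: the basis vectors \<open>\<partial>/\<partial>x\<^sup>i\<close>, \<open>\<partial>/\<partial>y\<^sup>i\<close> are \<^term>\<open>axis i 1\<close> and \<^term>\<open>axis i \<i>\<close>.\<close>

definition cstruct :: "complex^'n \<Rightarrow> complex^'n::finite" where
  "cstruct v = \<i> *s v"

definition cdifferentiable_on ::
    "(complex^'n \<Rightarrow> complex^'m) \<Rightarrow> (complex^'n::finite) set \<Rightarrow> bool" where
  "cdifferentiable_on f S \<longleftrightarrow>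
     (\<forall>x\<in>S. f differentiable (at x) \<and>
        (\<forall>v. frechet_derivative f (at x) (cstruct v) = cstruct (frechet_derivative f (at x) v)))"

type_synonym ('m, 'n) chart = "'m set \<times> ('m \<Rightarrow> complex^'n)"

definition chart_image :: "('m, 'n::finite) chart \<Rightarrow> (complex^'n) set" where
  "chart_image c = snd c ` fst c"

definition chart_transition ::
    "('m, 'n::finite) chart \<Rightarrow> ('m, 'n) chart \<Rightarrow> complex^'n \<Rightarrow> complex^'n" where
  "chart_transition c d = snd d \<circ> inv_into (fst c) (snd c)"

definition holomorphic_atlas :: "('m::topological_space, 'n::finite) chart set \<Rightarrow> bool" where
  "holomorphic_atlas A \<longleftrightarrow>
     (\<Union>c\<in>A. fst c) = UNIV \<and>
     (\<forall>c\<in>A. open (fst c) \<and> open (chart_image c) \<and>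
        homeomorphism (fst c) (chart_image c) (snd c) (inv_into (fst c) (snd c))) \<and>
     (\<forall>c\<in>A. \<forall>d\<in>A. cdifferentiable_on (chart_transition c d) (snd c ` (fst c \<inter> fst d)))"

type_synonym 'n metric = "complex^'n \<Rightarrow> complex^'n \<Rightarrow> complex^'n \<Rightarrow> real"

definition hermitian_metric_on :: "(complex^'n::finite) set \<Rightarrow> 'n metric \<Rightarrow> bool" where
  "hermitian_metric_on V g \<longleftrightarrow>
     (\<forall>z\<in>V. bilinear (g z) \<and>
        (\<forall>X Y. g z X Y = g z Y X) \<and>
        (\<forall>X. X \<noteq> 0 \<longrightarrow> 0 < g z X X) \<and>
        (\<forall>X Y. g z (cstruct X) (cstruct Y) = g z X Y)) \<and>
     (\<forall>X Y. smooth_on V (\<lambda>z. g z X Y))"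

text \<open>The metric tensor is given by its expressions \<open>G c\<close> in the charts \<open>c\<close> of the atlas, which are
  related by pull-back along the transition maps. The manifold is the whole type \<open>'m\<close>.\<close>

definition hermitian_manifold ::
    "('m::{t2_space, second_countable_topology}, 'n::finite) chart set \<Rightarrow>
     (('m, 'n) chart \<Rightarrow> 'n metric) \<Rightarrow> bool" where
  "hermitian_manifold A G \<longleftrightarrow>
     holomorphic_atlas A \<and>
     (\<forall>c\<in>A. hermitian_metric_on (chart_image c) (G c)) \<and>
     (\<forall>c\<in>A. \<forall>d\<in>A. \<forall>z\<in>snd c ` (fst c \<inter> fst d). \<forall>X Y.
        let D = frechet_derivative (chart_transition c d) (at z)
        in G c z X Y = G d (chart_transition c d z) (D X) (D Y))"


section \<open>The complexified tangent bundle\<close>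

text \<open>The pair \<open>(X, Y)\<close> stands for \<open>X + \<i> Y\<close>.\<close>

type_synonym 'n ctan = "(complex^'n) \<times> (complex^'n)"

definition ddz :: "'n \<Rightarrow> 'n::finite ctan" where
  "ddz i = ((1/2) *\<^sub>R axis i 1, - (1/2) *\<^sub>R axis i \<i>)"

definition ddzbar :: "'n \<Rightarrow> 'n::finite ctan" where
  "ddzbar i = ((1/2) *\<^sub>R axis i 1, (1/2) *\<^sub>R axis i \<i>)"

definition cdir :: "'n::finite ctan \<Rightarrow> (complex^'n \<Rightarrow> complex) \<Rightarrow> complex^'n \<Rightarrow> complex" where
  "cdir X f z = frechet_derivative f (at z) (fst X) + \<i> * frechet_derivative f (at z) (snd X)"

definition cbilin :: "('v \<Rightarrow> 'v \<Rightarrow> real) \<Rightarrow> 'v \<times> 'v \<Rightarrow> 'v \<times> 'v \<Rightarrow> complex" where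
  "cbilin B X Y = Complex (B (fst X) (fst Y) - B (snd X) (snd Y))
                          (B (fst X) (snd Y) + B (snd X) (fst Y))"

type_synonym 'n vfield = "complex^'n \<Rightarrow> complex^'n"
type_synonym 'n cvfield = "complex^'n \<Rightarrow> 'n ctan"

text \<open>The \<open>\<complex>\<close>-bilinear extension of an operation on real vector fields.\<close>

definition cextend :: "('n::finite vfield \<Rightarrow> 'n vfield \<Rightarrow> 'n vfield) \<Rightarrow>
    'n cvfield \<Rightarrow> 'n cvfield \<Rightarrow> 'n cvfield" where
  "cextend B X Y = (\<lambda>z.
     (B (fst \<circ> X) (fst \<circ> Y) z - B (snd \<circ> X) (snd \<circ> Y) z,
      B (fst \<circ> X) (snd \<circ> Y) z + B (snd \<circ> X) (fst \<circ> Y) z))"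

definition lie_bracket :: "'n::finite vfield \<Rightarrow> 'n vfield \<Rightarrow> 'n vfield" where
  "lie_bracket X Y z = frechet_derivative Y (at z) (X z) - frechet_derivative X (at z) (Y z)"


section \<open>Levi-Civita and Gauduchon connections\<close>

text \<open>Koszul's formula on constant, hence commuting, vector fields.\<close>

definition christoffel_LC :: "'n::finite metric \<Rightarrow> complex^'n \<Rightarrow> complex^'n \<Rightarrow> complex^'n \<Rightarrow> complex^'n" where
  "christoffel_LC g z X Y = (THE v. \<forall>W. g z v W =
     (frechet_derivative (\<lambda>y. g y Y W) (at z) X
      + frechet_derivative (\<lambda>y. g y X W) (at z) Y
      - frechet_derivative (\<lambda>y. g y X Y) (at z) W) / 2)"

definition levi_civita :: "'n::finite metric \<Rightarrow> 'n vfield \<Rightarrow> 'n vfield \<Rightarrow> 'n vfield" where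
  "levi_civita g X Y z = frechet_derivative Y (at z) (X z) + christoffel_LC g z (X z) (Y z)"

definition fund_form :: "'n::finite metric \<Rightarrow> complex^'n \<Rightarrow> complex^'n \<Rightarrow> complex^'n \<Rightarrow> real" where
  "fund_form g z X Y = g z (cstruct X) Y"

text \<open>The exterior derivative, evaluated on constant vector fields; it is normalized so that
  \<open>(\<alpha> \<and> \<beta>)(X, Y) = \<alpha>(X) \<beta>(Y) - \<alpha>(Y) \<beta>(X)\<close> for 1-forms, with no factorials.\<close>

definition d_fund_form ::
    "'n::finite metric \<Rightarrow> complex^'n \<Rightarrow> complex^'n \<Rightarrow> complex^'n \<Rightarrow> complex^'n \<Rightarrow> real" where
  "d_fund_form g z X Y W =
     frechet_derivative (\<lambda>y. fund_form g y Y W) (at z) X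
     - frechet_derivative (\<lambda>y. fund_form g y X W) (at z) Y
     + frechet_derivative (\<lambda>y. fund_form g y X Y) (at z) W"

definition gauduchon :: "'n::finite metric \<Rightarrow> real \<Rightarrow> 'n vfield \<Rightarrow> 'n vfield \<Rightarrow> 'n vfield" where
  "gauduchon g t X Y z = (THE v. \<forall>W. g z v W =
     g z (levi_civita g X Y z) W
     + t / 2 * d_fund_form g z (cstruct (X z)) (cstruct (Y z)) (cstruct W)
     + (t - 1) / 2 * d_fund_form g z (cstruct (X z)) (Y z) W)"

text \<open>The curvature of the complexified connection. The restriction to \<open>T\<^sup>1\<^sup>,\<^sup>0M\<close> consists in
  taking sections \<open>Z\<close> of \<open>T\<^sup>1\<^sup>,\<^sup>0M\<close>.\<close>

definition gauduchon_curv :: "'n::finite metric \<Rightarrow> real \<Rightarrow>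
    'n cvfield \<Rightarrow> 'n cvfield \<Rightarrow> 'n cvfield \<Rightarrow> 'n cvfield \<Rightarrow> complex^'n \<Rightarrow> complex" where
  "gauduchon_curv g t X Y Z W z =
     (let N = cextend (gauduchon g t)
      in cbilin (g z) (N X (N Y Z) z - N Y (N X Z) z - N (cextend lie_bracket X Y) Z z) (W z))"

text \<open>In \<open>R_G g t z i j k l\<close> the second and fourth indices are the conjugate ones; the same
  convention applies to all other components below.\<close>

definition R_G :: "'n::finite metric \<Rightarrow> real \<Rightarrow> complex^'n \<Rightarrow> 'n \<Rightarrow> 'n \<Rightarrow> 'n \<Rightarrow> 'n \<Rightarrow> complex" where
  "R_G g t z i j k l =
     gauduchon_curv g t (\<lambda>_. ddz i) (\<lambda>_. ddzbar j) (\<lambda>_. ddz k) (\<lambda>_. ddzbar l) z"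


section \<open>The Chern connection\<close>

definition h_lo :: "'n::finite metric \<Rightarrow> complex^'n \<Rightarrow> 'n \<Rightarrow> 'n \<Rightarrow> complex" where
  "h_lo g z i j = cbilin (g z) (ddz i) (ddzbar j)"

text \<open>The transpose reflects \<open>h\<^sup>i\<^sup>l h\<^sub>j\<^sub>l = \<delta>\<^sup>i\<^sub>j\<close> (sum over the second indices).\<close>

definition h_up :: "'n::finite metric \<Rightarrow> complex^'n \<Rightarrow> 'n \<Rightarrow> 'n \<Rightarrow> complex" where
  "h_up g z i l = transpose (matrix_inv (\<chi> a b. h_lo g z a b)) $ i $ l"

definition Chern_Gamma :: "'n::finite metric \<Rightarrow> complex^'n \<Rightarrow> 'n \<Rightarrow> 'n \<Rightarrow> 'n \<Rightarrow> complex" where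
  "Chern_Gamma g z i j k = (\<Sum>l\<in>UNIV. h_up g z k l * cdir (ddz i) (\<lambda>y. h_lo g y j l) z)"

text \<open>\<open>torsion g z i j k\<close> is \<open>T\<^sub>i\<^sub>j\<^sup>k\<close>.\<close>

definition torsion :: "'n::finite metric \<Rightarrow> complex^'n \<Rightarrow> 'n \<Rightarrow> 'n \<Rightarrow> 'n \<Rightarrow> complex" where
  "torsion g z i j k = Chern_Gamma g z i j k - Chern_Gamma g z j i k"

definition Chern_curv :: "'n::finite metric \<Rightarrow> complex^'n \<Rightarrow> 'n \<Rightarrow> 'n \<Rightarrow> 'n \<Rightarrow> 'n \<Rightarrow> complex" where
  "Chern_curv g z i j k l =
     - cdir (ddz i) (cdir (ddzbar j) (\<lambda>y. h_lo g y k l)) z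
     + (\<Sum>p\<in>UNIV. \<Sum>q\<in>UNIV. h_up g z p q
          * cdir (ddzbar j) (\<lambda>y. h_lo g y p l) z * cdir (ddz i) (\<lambda>y. h_lo g y k q) z)"


section \<open>Forms of type (p,q)\<close>

text \<open>A (p,q)-form at a point is given by its values \<open>a I J\<close> on
  \<open>(\<partial>/\<partial>z\<^sup>i, i \<in> I; \<partial>/\<partial>zbar\<^sup>j, j \<in> J)\<close> for lists \<open>I\<close>, \<open>J\<close> of lengths \<open>p\<close>, \<open>q\<close>, and is extended
  by 0 to lists of other lengths. Thus it equals
  \<open>1/(p! q!) \<Sum> a I J dz\<^sup>I \<and> dzbar\<^sup>J\<close>, the sum running over all such lists.\<close>

type_synonym 'n cform = "'n list \<Rightarrow> 'n list \<Rightarrow> complex"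

definition swap_nth :: "nat \<Rightarrow> nat \<Rightarrow> 'a list \<Rightarrow> 'a list" where
  "swap_nth a b I = I[a := I ! b, b := I ! a]"

definition del_nth :: "nat \<Rightarrow> 'a list \<Rightarrow> 'a list" where
  "del_nth a I = take a I @ drop (Suc a) I"

definition pq_form :: "nat \<Rightarrow> nat \<Rightarrow> 'n cform \<Rightarrow> bool" where
  "pq_form p q \<alpha> \<longleftrightarrow>
     (\<forall>I J. length I \<noteq> p \<or> length J \<noteq> q \<longrightarrow> \<alpha> I J = 0) \<and>
     (\<forall>I J a b. a < b \<and> b < length I \<longrightarrow> \<alpha> (swap_nth a b I) J = - \<alpha> I J) \<and>
     (\<forall>I J a b. a < b \<and> b < length J \<longrightarrow> \<alpha> I (swap_nth a b J) = - \<alpha> I J)"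

definition smooth_form :: "(complex^'n::finite) set \<Rightarrow> nat \<Rightarrow> nat \<Rightarrow> (complex^'n \<Rightarrow> 'n cform) \<Rightarrow> bool" where
  "smooth_form V p q \<alpha> \<longleftrightarrow>
     (\<forall>z\<in>V. pq_form p q (\<alpha> z)) \<and> (\<forall>I J. smooth_on V (\<lambda>z. \<alpha> z I J))"

definition del :: "(complex^'n::finite \<Rightarrow> 'n cform) \<Rightarrow> complex^'n \<Rightarrow> 'n cform" where
  "del \<alpha> z I J = (\<Sum>a<length I. (-1)^a * cdir (ddz (I ! a)) (\<lambda>y. \<alpha> y (del_nth a I) J) z)"

text \<open>The sign \<open>(-1)\<^sup>p\<close> comes from moving \<open>dzbar\<^sup>j\<close> past \<open>dz\<^sup>I\<close>.\<close>

definition delbar :: "(complex^'n::finite \<Rightarrow> 'n cform) \<Rightarrow> complex^'n \<Rightarrow> 'n cform" where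
  "delbar \<alpha> z I J = (-1)^(length I) *
     (\<Sum>b<length J. (-1)^b * cdir (ddzbar (J ! b)) (\<lambda>y. \<alpha> y I (del_nth b J)) z)"

text \<open>Summing over all, not only increasing, lists is compensated by \<open>1/(p! q!)\<close>.\<close>

definition form_inner :: "'n::finite metric \<Rightarrow> complex^'n \<Rightarrow> nat \<Rightarrow> nat \<Rightarrow> 'n cform \<Rightarrow> 'n cform \<Rightarrow> complex" where
  "form_inner g z p q \<alpha> \<beta> = 1 / (fact p * fact q) *
     (\<Sum>I\<in>{I. length I = p}. \<Sum>K\<in>{K. length K = p}. \<Sum>J\<in>{J. length J = q}. \<Sum>L\<in>{L. length L = q}.
        (\<Prod>a<p. h_up g z (I ! a) (K ! a)) * (\<Prod>b<q. h_up g z (L ! b) (J ! b)) *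
        \<alpha> I J * cnj (\<beta> K L))"

text \<open>\<open>\<omega> = \<i> h\<^sub>i\<^sub>j dz\<^sup>i \<and> dzbar\<^sup>j\<close>.\<close>

definition omega :: "'n::finite metric \<Rightarrow> complex^'n \<Rightarrow> 'n cform" where
  "omega g z I J = (if length I = 1 \<and> length J = 1 then \<i> * h_lo g z (hd I) (hd J) else 0)"

text \<open>\<open>\<omega> \<and> \<alpha>\<close>; with \<open>p = length I - 1\<close>, the sign of the shuffle that brings \<open>i\<^sub>a\<close> and \<open>j\<^sub>b\<close> to the
  front of \<open>(I, J)\<close> is \<open>(-1)\<^sup>(\<^sup>p\<^sup>+\<^sup>a\<^sup>+\<^sup>b\<^sup>)\<close>.\<close>

definition omega_wedge :: "'n::finite metric \<Rightarrow> complex^'n \<Rightarrow> 'n cform \<Rightarrow> 'n cform" where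
  "omega_wedge g z \<alpha> I J =
     (\<Sum>a<length I. \<Sum>b<length J. (-1)^(length I - 1 + a + b) *
        omega g z [I ! a] [J ! b] * \<alpha> (del_nth a I) (del_nth b J))"

text \<open>In \<open>Lambda\<close>, \<open>del_star\<close> and \<open>delbar_star\<close>, \<open>(p, q)\<close> is the type of the resulting form.\<close>

definition Lambda :: "'n::finite metric \<Rightarrow> nat \<Rightarrow> nat \<Rightarrow> complex^'n \<Rightarrow> 'n cform \<Rightarrow> 'n cform" where
  "Lambda g p q z \<eta> = (THE \<beta>. pq_form p q \<beta> \<and>
     (\<forall>\<alpha>. pq_form p q \<alpha> \<longrightarrow>
        form_inner g z (Suc p) (Suc q) (omega_wedge g z \<alpha>) \<eta> = form_inner g z p q \<alpha> \<beta>))"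

text \<open>The density of \<open>\<omega>\<^sup>n / n!\<close>, the Riemannian volume form, with respect to Lebesgue measure:
  \<open>\<i> dz \<and> dzbar = 2 dx \<and> dy\<close>.\<close>

definition vol_density :: "'n::finite metric \<Rightarrow> complex^'n \<Rightarrow> complex" where
  "vol_density g z = 2 ^ CARD('n) * det (\<chi> i j. h_lo g z i j)"

definition L2_inner :: "(complex^'n::finite) set \<Rightarrow> 'n metric \<Rightarrow> nat \<Rightarrow> nat \<Rightarrow>
    (complex^'n \<Rightarrow> 'n cform) \<Rightarrow> (complex^'n \<Rightarrow> 'n cform) \<Rightarrow> complex" where
  "L2_inner V g p q \<alpha> \<beta> = (LINT z:V|lborel. form_inner g z p q (\<alpha> z) (\<beta> z) * vol_density g z)"

definition test_form :: "(complex^'n::finite) set \<Rightarrow> nat \<Rightarrow> nat \<Rightarrow> (complex^'n \<Rightarrow> 'n cform) \<Rightarrow> bool" where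
  "test_form V p q \<alpha> \<longleftrightarrow> smooth_form V p q \<alpha> \<and>
     (\<exists>K. compact K \<and> K \<subseteq> V \<and> (\<forall>z. z \<notin> K \<longrightarrow> \<alpha> z = (\<lambda>I J. 0)))"

text \<open>Formal adjoints are local operators, so on the domain of a chart they are determined by test
  forms with compact support in it. Requiring the result to vanish outside \<open>V\<close> only makes it unique
  as a function on all of \<^typ>\<open>complex^'n\<close>.\<close>

definition del_star :: "(complex^'n::finite) set \<Rightarrow> 'n metric \<Rightarrow> nat \<Rightarrow> nat \<Rightarrow>
    (complex^'n \<Rightarrow> 'n cform) \<Rightarrow> complex^'n \<Rightarrow> 'n cform" where
  "del_star V g p q \<eta> = (THE \<beta>. smooth_form V p q \<beta> \<and> (\<forall>z. z \<notin> V \<longrightarrow> \<beta> z = (\<lambda>I J. 0)) \<and>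
     (\<forall>\<alpha>. test_form V p q \<alpha> \<longrightarrow>
        L2_inner V g (Suc p) q (del \<alpha>) \<eta> = L2_inner V g p q \<alpha> \<beta>))"

definition delbar_star :: "(complex^'n::finite) set \<Rightarrow> 'n metric \<Rightarrow> nat \<Rightarrow> nat \<Rightarrow>
    (complex^'n \<Rightarrow> 'n cform) \<Rightarrow> complex^'n \<Rightarrow> 'n cform" where
  "delbar_star V g p q \<eta> = (THE \<beta>. smooth_form V p q \<beta> \<and> (\<forall>z. z \<notin> V \<longrightarrow> \<beta> z = (\<lambda>I J. 0)) \<and>
     (\<forall>\<alpha>. test_form V p q \<alpha> \<longrightarrow>
        L2_inner V g p (Suc q) (delbar \<alpha>) \<eta> = L2_inner V g p q \<alpha> \<beta>))"


section \<open>Ricci forms, scalar curvatures and torsion forms\<close>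

text \<open>Below, (1,1)-forms \<open>a\<^sub>i\<^sub>j dz\<^sup>i \<and> dzbar\<^sup>j\<close> are given by their coefficients \<open>a\<^sub>i\<^sub>j\<close>; the Ricci forms
  include the factor \<open>\<i>\<close>.\<close>

definition Chern_Ricci1 :: "'n::finite metric \<Rightarrow> complex^'n \<Rightarrow> 'n \<Rightarrow> 'n \<Rightarrow> complex" where
  "Chern_Ricci1 g z i j = \<i> * (\<Sum>k\<in>UNIV. \<Sum>l\<in>UNIV. h_up g z k l * Chern_curv g z i j k l)"

definition Ric1 :: "'n::finite metric \<Rightarrow> real \<Rightarrow> complex^'n \<Rightarrow> 'n \<Rightarrow> 'n \<Rightarrow> complex" where
  "Ric1 g t z i j = \<i> * (\<Sum>k\<in>UNIV. \<Sum>l\<in>UNIV. h_up g z k l * R_G g t z i j k l)"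

definition Ric2 :: "'n::finite metric \<Rightarrow> real \<Rightarrow> complex^'n \<Rightarrow> 'n \<Rightarrow> 'n \<Rightarrow> complex" where
  "Ric2 g t z i j = \<i> * (\<Sum>k\<in>UNIV. \<Sum>l\<in>UNIV. h_up g z k l * R_G g t z k l i j)"

definition Ric3 :: "'n::finite metric \<Rightarrow> real \<Rightarrow> complex^'n \<Rightarrow> 'n \<Rightarrow> 'n \<Rightarrow> complex" where
  "Ric3 g t z i j = \<i> * (\<Sum>k\<in>UNIV. \<Sum>l\<in>UNIV. h_up g z k l * R_G g t z i l k j)"

definition Ric4 :: "'n::finite metric \<Rightarrow> real \<Rightarrow> complex^'n \<Rightarrow> 'n \<Rightarrow> 'n \<Rightarrow> complex" where
  "Ric4 g t z i j = \<i> * (\<Sum>k\<in>UNIV. \<Sum>l\<in>UNIV. h_up g z k l * R_G g t z k j i l)"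

definition s_Chern :: "'n::finite metric \<Rightarrow> complex^'n \<Rightarrow> complex" where
  "s_Chern g z = (\<Sum>i\<in>UNIV. \<Sum>j\<in>UNIV. \<Sum>k\<in>UNIV. \<Sum>l\<in>UNIV.
     h_up g z i j * h_up g z k l * Chern_curv g z i j k l)"

definition scal1 :: "'n::finite metric \<Rightarrow> real \<Rightarrow> complex^'n \<Rightarrow> complex" where
  "scal1 g t z = (\<Sum>i\<in>UNIV. \<Sum>j\<in>UNIV. \<Sum>k\<in>UNIV. \<Sum>l\<in>UNIV.
     h_up g z i j * h_up g z k l * R_G g t z i j k l)"

definition scal2 :: "'n::finite metric \<Rightarrow> real \<Rightarrow> complex^'n \<Rightarrow> complex" where
  "scal2 g t z = (\<Sum>i\<in>UNIV. \<Sum>j\<in>UNIV. \<Sum>k\<in>UNIV. \<Sum>l\<in>UNIV.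
     h_up g z i l * h_up g z k j * R_G g t z i j k l)"

definition T_box :: "'n::finite metric \<Rightarrow> complex^'n \<Rightarrow> 'n \<Rightarrow> 'n \<Rightarrow> complex" where
  "T_box g z i j = (\<Sum>p\<in>UNIV. \<Sum>q\<in>UNIV. \<Sum>k\<in>UNIV. \<Sum>l\<in>UNIV.
     h_up g z p q * h_lo g z k l * torsion g z i p k * cnj (torsion g z j q l))"

definition T_circ :: "'n::finite metric \<Rightarrow> complex^'n \<Rightarrow> 'n \<Rightarrow> 'n \<Rightarrow> complex" where
  "T_circ g z i j = (\<Sum>p\<in>UNIV. \<Sum>q\<in>UNIV. \<Sum>s\<in>UNIV. \<Sum>r\<in>UNIV. \<Sum>k\<in>UNIV. \<Sum>l\<in>UNIV.
     h_up g z p q * h_up g z s r * h_lo g z k j * h_lo g z i l *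
     torsion g z s p k * cnj (torsion g z r q l))"

text \<open>\<open>T(\<beta>\<^sup>#)\<close> for a (0,1)-form \<open>\<beta>\<close>.\<close>

definition T_sharp :: "'n::finite metric \<Rightarrow> (complex^'n \<Rightarrow> 'n cform) \<Rightarrow> complex^'n \<Rightarrow> 'n \<Rightarrow> 'n \<Rightarrow> complex" where
  "T_sharp g \<beta> z i j = (\<Sum>m\<in>UNIV. \<Sum>p\<in>UNIV. \<Sum>q\<in>UNIV.
     h_lo g z m j * h_up g z p q * \<beta> z [] [q] * torsion g z p i m)"

text \<open>The sign comes from \<open>dzbar\<^sup>i \<and> dz\<^sup>j = - dz\<^sup>j \<and> dzbar\<^sup>i\<close>.\<close>

definition conj11 :: "('n \<Rightarrow> 'n \<Rightarrow> complex) \<Rightarrow> 'n \<Rightarrow> 'n \<Rightarrow> complex" where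
  "conj11 a i j = - cnj (a j i)"

end

theory Submission
  imports Defs "HOL-Computational_Algebra.Polynomial"
begin

text \<open>
  Everything is a computation in one chart. Since \<open>\<nabla>\<^sup>t\<close> preserves \<open>J\<close>, it acts on a (1,0)-field
  through \<open>\<complex>\<close>-linear operators whose lowered coefficients are
  \<open>\<partial>\<^sub>i h\<^sub>k\<^sub>l - t T\<^sub>i\<^sub>k\<^sub>l\<close> in the direction \<open>\<partial>/\<partial>z\<^sup>i\<close> and \<open>t cnj T\<^sub>i\<^sub>l\<^sub>k\<close> in the direction
  \<open>\<partial>/\<partial>zbar\<^sup>i\<close>. In the curvature, written in lowered coefficients, only second derivatives of \<open>h\<close> and
  products of its first derivatives occur, and the terms of each degree in \<open>t\<close> are matched.

  The formal adjoints are computed by integration by parts: \<open>\<partial>\<^sup>*\<omega>\<close> is the (0,1)-form with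
  coefficients \<open>- \<i> cnj T\<^sub>j\<^sub>k\<^sup>k\<close>, by Jacobi's formula for the derivative of \<open>det h\<close>; it is the only
  adjoint because test forms can be localized by bump functions. Hence \<open>\<partial>\<partial>\<^sup>*\<omega>\<close> and its conjugate are
  differences of two traces of the Chern curvature, and the contraction of \<open>del (delbar \<omega>)\<close> with \<open>\<omega>\<close>
  is a combination of all four such traces plus a term quadratic in the torsion. The Ricci and scalar
  formulas follow by taking traces of the curvature formula.
\<close>

subsection \<open>Smooth functions\<close>

text \<open>The connections, \<open>Lambda\<close> and the formal adjoints are definite
  descriptions, so each must be shown to exist and to be unique before it can be computed. Moreover
  \<open>frechet_derivative\<close> is unspecified where a function is not differentiable, and the
  identities for h hold only on the chart domain. An equation can therefore be differentiated only
  on an open set and for functions known to be smooth; hence the long preparation on smooth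
  functions.

  Lowering indices keeps the derivative of the inverse metric out of the curvature. Number the four
  traces of the Chern curvature c1, ..., c4 like the Ricci forms. The two adjoint terms turn out to
  be i(c1 - c3) and i(c1 - c4), and \<open>Lambda\<close> of del delbar omega is c3 + c4 - c1 - c2
  plus T-box, so c2, c3, c4 can be solved for. In each trace of the curvature formula the term
  linear in t brings in the opposite pair, {c3, c4} against {c1, c2}; this fixes the coefficients in
  the Ricci formulas.\<close>

lemma Ck_on_cong:
  assumes "open S" "Ck_on k S f" "\<And>x. x \<in> S \<Longrightarrow> f x = g x"
  shows "Ck_on k S g"
  using assms(2,3)
proof (induction k arbitrary: f g)
  case 0
  then show ?case by (simp cong: continuous_on_cong)
next
  case (Suc k)
  have fd: "frechet_derivative f (at x) = frechet_derivative g (at x)" if "x \<in> S" for x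
    using frechet_derivative_transform_within_open[OF _ \<open>open S\<close> that] Suc.prems that by auto
  have "g differentiable at x" if "x \<in> S" for x
    using Suc.prems that \<open>open S\<close> has_derivative_transform_within_open
    unfolding differentiable_def by (metis Ck_on.simps(2) differentiable_def)
  moreover have "Ck_on k S (\<lambda>x. frechet_derivative g (at x) v)" for v
    using Suc.IH[of "\<lambda>x. frechet_derivative f (at x) v"] fd Suc.prems by auto
  ultimately show ?case by simp
qed

lemma Ck_on_SucD: "Ck_on (Suc k) S f \<Longrightarrow> Ck_on k S f"
proof (induction k arbitrary: f)
  case 0
  then show ?case
    by (auto intro: continuous_at_imp_continuous_on differentiable_imp_continuous_within)
next
  case (Suc k)
  then show ?case by (metis Ck_on.simps(2))
qed

text \<open>\<open>Ck_on\<close> is phrased with \<open>frechet_derivative\<close>; this rule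
  accepts any explicitly known derivative instead, and is the induction step of the closure
  properties below.\<close>

lemma Ck_on_SucI:
  assumes "open S" "\<And>x. x \<in> S \<Longrightarrow> (f has_derivative f' x) (at x)"
    and "\<And>v. Ck_on k S (\<lambda>x. f' x v)"
  shows "Ck_on (Suc k) S f"
proof -
  have "frechet_derivative f (at x) = f' x" if "x \<in> S" for x
    using frechet_derivative_at[OF assms(2)[OF that]] by simp
  then have "Ck_on k S (\<lambda>x. frechet_derivative f (at x) v)" for v
    by (intro Ck_on_cong[OF assms(1) assms(3)]) auto
  then show ?thesis
    using assms(2) by (auto simp: differentiable_def)
qed

lemma Ck_on_has_derivative:
  "Ck_on (Suc k) S f \<Longrightarrow> x \<in> S \<Longrightarrow> (f has_derivative frechet_derivative f (at x)) (at x)"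
  using frechet_derivative_works by auto

lemma Ck_on_const: "open S \<Longrightarrow> Ck_on k S (\<lambda>x. c)"
proof (induction k arbitrary: c)
  case (Suc k)
  show ?case by (rule Ck_on_SucI[OF Suc.prems has_derivative_const]) (use Suc in auto)
qed simp

lemma Ck_on_linear:
  assumes "open S" "bounded_linear L"
  shows "Ck_on k S f \<Longrightarrow> Ck_on k S (\<lambda>x. L (f x))"
proof (induction k arbitrary: f)
  case 0
  then show ?case using assms(2) by (simp add: bounded_linear.continuous_on)
next
  case (Suc k)
  show ?case
    by (rule Ck_on_SucI[OF assms(1) bounded_linear.has_derivative[OF assms(2)]])
       (use Suc Ck_on_has_derivative[OF Suc.prems] in auto)
qed

lemma Ck_on_add:
  assumes "open S"
  shows "Ck_on k S f \<Longrightarrow> Ck_on k S g \<Longrightarrow> Ck_on k S (\<lambda>x. f x + g x)"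
proof (induction k arbitrary: f g)
  case 0
  then show ?case by (simp add: continuous_on_add)
next
  case (Suc k)
  show ?case
    by (rule Ck_on_SucI[OF assms(1) has_derivative_add])
       (use Suc Ck_on_has_derivative[OF Suc.prems(1)] Ck_on_has_derivative[OF Suc.prems(2)] in auto)
qed

text \<open>By the Leibniz rule the derivative is a sum of two values of the same B. In each of them
  one factor is a derivative and the other is demoted by one order with \<open>Ck_on_SucD\<close>,
  so the induction closes.\<close>

lemma Ck_on_bilinear:
  assumes "open S" "bounded_bilinear B"
  shows "Ck_on k S f \<Longrightarrow> Ck_on k S g \<Longrightarrow> Ck_on k S (\<lambda>x. B (f x) (g x))"
proof (induction k arbitrary: f g)
  case 0
  then show ?case using assms(2) by (simp add: bounded_bilinear.continuous_on)
next
  case (Suc k)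
  show ?case
  proof (rule Ck_on_SucI[OF assms(1)])
    show "((\<lambda>x. B (f x) (g x)) has_derivative (\<lambda>v. B (f x) (frechet_derivative g (at x) v)
        + B (frechet_derivative f (at x) v) (g x))) (at x)" if "x \<in> S" for x
      by (rule bounded_bilinear.FDERIV[OF assms(2) Ck_on_has_derivative[OF Suc.prems(1) that]
          Ck_on_has_derivative[OF Suc.prems(2) that]])
    show "Ck_on k S (\<lambda>x. B (f x) (frechet_derivative g (at x) v)
        + B (frechet_derivative f (at x) v) (g x))" for v
      using Suc.prems Ck_on_SucD[OF Suc.prems(1)] Ck_on_SucD[OF Suc.prems(2)]
      by (intro Ck_on_add[OF assms(1)] Suc.IH) auto
  qed
qed

text \<open>The derivative contains f only through its inverse again, to which the induction
  hypothesis of lower order applies.\<close>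

lemma Ck_on_inverse:
  fixes f :: "'a::real_normed_vector \<Rightarrow> 'b::real_normed_field"
  assumes "open S" "\<And>x. x \<in> S \<Longrightarrow> f x \<noteq> 0"
  shows "Ck_on k S f \<Longrightarrow> Ck_on k S (\<lambda>x. inverse (f x))"
proof (induction k)
  case 0
  then show ?case using assms(2) by (simp add: continuous_on_inverse)
next
  case (Suc k)
  show ?case
  proof (rule Ck_on_SucI[OF assms(1)])
    show "((\<lambda>x. inverse (f x)) has_derivative
        (\<lambda>v. - (inverse (f x) * frechet_derivative f (at x) v * inverse (f x)))) (at x)"
      if "x \<in> S" for x
      by (rule Deriv.has_derivative_inverse[OF assms(2)[OF that] Ck_on_has_derivative[OF Suc.prems that]])
    have "Ck_on k S (\<lambda>x. inverse (f x) * frechet_derivative f (at x) v * inverse (f x))" for v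
      using Suc.prems Ck_on_SucD[OF Suc.prems]
      by (intro Ck_on_bilinear[OF assms(1) bounded_bilinear_mult] Suc.IH) auto
    from Ck_on_linear[OF assms(1) bounded_linear_minus[OF bounded_linear_ident] this]
    show "Ck_on k S (\<lambda>x. - (inverse (f x) * frechet_derivative f (at x) v * inverse (f x)))" for v .
  qed
qed

lemma smooth_onD: "smooth_on S f \<Longrightarrow> x \<in> S \<Longrightarrow> f differentiable (at x)"
  unfolding smooth_on_def by (metis Ck_on.simps(2))

lemma smooth_on_has_derivative:
  "smooth_on S f \<Longrightarrow> x \<in> S \<Longrightarrow> (f has_derivative frechet_derivative f (at x)) (at x)"
  using smooth_onD frechet_derivative_works by blast

lemma smooth_on_frechet: "smooth_on S f \<Longrightarrow> smooth_on S (\<lambda>x. frechet_derivative f (at x) v)"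
  unfolding smooth_on_def by (metis Ck_on.simps(2))

lemma smooth_on_continuous: "smooth_on S f \<Longrightarrow> continuous_on S f"
  unfolding smooth_on_def by (metis Ck_on.simps(1))

lemma smooth_on_cong:
  "open S \<Longrightarrow> smooth_on S f \<Longrightarrow> (\<And>x. x \<in> S \<Longrightarrow> f x = g x) \<Longrightarrow> smooth_on S g"
  unfolding smooth_on_def using Ck_on_cong by blast

lemma smooth_on_const: "open S \<Longrightarrow> smooth_on S (\<lambda>x. c)"
  by (simp add: smooth_on_def Ck_on_const)

lemma smooth_on_linear:
  "open S \<Longrightarrow> bounded_linear L \<Longrightarrow> smooth_on S f \<Longrightarrow> smooth_on S (\<lambda>x. L (f x))"
  by (simp add: smooth_on_def Ck_on_linear)

lemma smooth_on_add:
  "open S \<Longrightarrow> smooth_on S f \<Longrightarrow> smooth_on S g \<Longrightarrow> smooth_on S (\<lambda>x. f x + g x)"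
  by (simp add: smooth_on_def Ck_on_add)

lemma smooth_on_minus: "open S \<Longrightarrow> smooth_on S f \<Longrightarrow> smooth_on S (\<lambda>x. - f x)"
  using smooth_on_linear[OF _ bounded_linear_minus[OF bounded_linear_ident]] by auto

lemma smooth_on_diff:
  "open S \<Longrightarrow> smooth_on S f \<Longrightarrow> smooth_on S g \<Longrightarrow> smooth_on S (\<lambda>x. f x - g x)"
  using smooth_on_add[of S f "\<lambda>x. - g x"] smooth_on_minus by auto

lemma smooth_on_bilinear:
  "open S \<Longrightarrow> bounded_bilinear B \<Longrightarrow> smooth_on S f \<Longrightarrow> smooth_on S g \<Longrightarrow> smooth_on S (\<lambda>x. B (f x) (g x))"
  by (simp add: smooth_on_def Ck_on_bilinear)

lemma smooth_on_mult:
  fixes f :: "'a::real_normed_vector \<Rightarrow> 'b::real_normed_algebra"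
  shows "open S \<Longrightarrow> smooth_on S f \<Longrightarrow> smooth_on S g \<Longrightarrow> smooth_on S (\<lambda>x. f x * g x)"
  by (rule smooth_on_bilinear[OF _ bounded_bilinear_mult])

lemma smooth_on_inverse:
  fixes f :: "'a::real_normed_vector \<Rightarrow> 'b::real_normed_field"
  shows "open S \<Longrightarrow> (\<And>x. x \<in> S \<Longrightarrow> f x \<noteq> 0) \<Longrightarrow> smooth_on S f \<Longrightarrow> smooth_on S (\<lambda>x. inverse (f x))"
  by (simp add: smooth_on_def Ck_on_inverse)

lemma smooth_on_sum:
  assumes "open S" "\<And>i. i \<in> I \<Longrightarrow> smooth_on S (f i)"
  shows "smooth_on S (\<lambda>x. \<Sum>i\<in>I. f i x)"
  using assms(2)
  by (induction I rule: infinite_finite_induct)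
     (auto simp: smooth_on_const smooth_on_add assms(1))

lemma smooth_on_prod:
  fixes f :: "'i \<Rightarrow> 'a::real_normed_vector \<Rightarrow> 'b::real_normed_field"
  assumes "open S" "\<And>i. i \<in> I \<Longrightarrow> smooth_on S (f i)"
  shows "smooth_on S (\<lambda>x. \<Prod>i\<in>I. f i x)"
  using assms(2)
  by (induction I rule: infinite_finite_induct)
     (auto simp: smooth_on_const smooth_on_mult assms(1))

lemma smooth_on_cnj: "open S \<Longrightarrow> smooth_on S f \<Longrightarrow> smooth_on S (\<lambda>x. cnj (f x))"
  using smooth_on_linear[OF _ bounded_linear_cnj] by auto

lemma smooth_on_of_real:
  "open S \<Longrightarrow> smooth_on S f \<Longrightarrow> smooth_on S (\<lambda>x. complex_of_real (f x))"
  using smooth_on_linear[OF _ bounded_linear_of_real] by auto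

lemma smooth_on_det:
  fixes A :: "'a::real_normed_vector \<Rightarrow> complex^'n^'n::finite"
  assumes "open S" "\<And>i j. smooth_on S (\<lambda>x. A x $ i $ j)"
  shows "smooth_on S (\<lambda>x. det (A x))"
  unfolding det_def
  by (intro smooth_on_sum smooth_on_mult smooth_on_prod smooth_on_const assms)

text \<open>Taking a whole sequence of outer functions, each the derivative of the previous one,
  replaces an iterated chain rule: the induction on the order runs with m arbitrary.\<close>

lemma smooth_on_compose_real:
  fixes u :: "'a::real_normed_vector \<Rightarrow> real" and F :: "nat \<Rightarrow> real \<Rightarrow> real"
  assumes "open S" "smooth_on S u"
    and F: "\<And>m x. (F m has_real_derivative F (Suc m) x) (at x)"
  shows "smooth_on S (\<lambda>x. F m (u x))"
proof -
  have "Ck_on k S (\<lambda>x. F m (u x))" for k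
  proof (induction k arbitrary: m)
    case 0
    have "continuous_on UNIV (F m)"
      using F DERIV_isCont by (intro continuous_at_imp_continuous_on) blast
    from continuous_on_compose2[OF this smooth_on_continuous[OF assms(2)]]
    show ?case by simp
  next
    case (Suc k)
    show ?case
    proof (rule Ck_on_SucI[OF assms(1)])
      fix x assume "x \<in> S"
      from has_derivative_compose[OF smooth_on_has_derivative[OF assms(2) this]
          F[of m "u x", unfolded has_field_derivative_def]]
      show "((\<lambda>x. F m (u x)) has_derivative
        (\<lambda>v. F (Suc m) (u x) * frechet_derivative u (at x) v)) (at x)" .
    next
      fix v
      have "Ck_on k S (\<lambda>x. frechet_derivative u (at x) v)"
        using smooth_on_frechet[OF assms(2)] by (simp add: smooth_on_def)
      then show "Ck_on k S (\<lambda>x. F (Suc m) (u x) * frechet_derivative u (at x) v)"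
        by (intro Ck_on_bilinear[OF assms(1) bounded_bilinear_mult] Suc)
    qed
  qed
  then show ?thesis by (simp add: smooth_on_def)
qed

subsection \<open>Bump functions\<close>

lemma poly_times_exp_minus_at_top: "((\<lambda>y::real. poly p y * exp (- y)) \<longlongrightarrow> 0) at_top"
proof -
  have "(\<lambda>y. poly p y * exp (- y)) = (\<lambda>y. \<Sum>i\<le>degree p. coeff p i * (y ^ i / exp y))"
    by (simp add: poly_altdef sum_distrib_right exp_minus divide_inverse mult.assoc)
  moreover have "((\<lambda>y. \<Sum>i\<le>degree p. coeff p i * (y ^ i / exp y)) \<longlongrightarrow> (\<Sum>i\<le>degree p. coeff p i * 0)) at_top"
    by (intro tendsto_intros tendsto_power_div_exp_0)
  ultimately show ?thesis by simp
qed

text \<open>The derivatives of \<open>exp (-1/x)\<close> are \<open>p (1/x) exp (-1/x)\<close> with \<open>p\<close> running through the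
  following polynomials.\<close>

primrec flat_poly :: "nat \<Rightarrow> real poly" where
  "flat_poly 0 = 1"
| "flat_poly (Suc m) = [:0, 0, 1:] * (flat_poly m - pderiv (flat_poly m))"

definition flat_fun :: "nat \<Rightarrow> real \<Rightarrow> real" where
  "flat_fun m x = (if x > 0 then poly (flat_poly m) (1/x) * exp (- (1/x)) else 0)"

text \<open>Only the origin, where the two cases of the definition meet, needs an argument: the
  difference quotient is 0 on the left, and on the right the exponential beats every power of
  1/x.\<close>

lemma flat_fun_deriv: "(flat_fun m has_real_derivative flat_fun (Suc m) x) (at x)"
proof -
  consider "x > 0" | "x < 0" | "x = 0" by linarith
  then show ?thesis
  proof cases
    case 1
    have inv: "((\<lambda>x. 1/x) has_real_derivative - (1/x\<^sup>2)) (at x)"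
      using 1 by (auto intro!: derivative_eq_intros simp: power2_eq_square)
    have "((\<lambda>x. poly (flat_poly m) (1/x) * exp (- (1/x))) has_real_derivative
        poly (flat_poly m) (1/x) * (exp (- (1/x)) * - (- (1/x\<^sup>2)))
        + poly (pderiv (flat_poly m)) (1/x) * - (1/x\<^sup>2) * exp (- (1/x))) (at x)"
      by (rule DERIV_mult' DERIV_chain2[OF poly_DERIV] DERIV_chain2[OF DERIV_exp] DERIV_minus inv)+
    also have "poly (flat_poly m) (1/x) * (exp (- (1/x)) * - (- (1/x\<^sup>2)))
        + poly (pderiv (flat_poly m)) (1/x) * - (1/x\<^sup>2) * exp (- (1/x)) = flat_fun (Suc m) x"
      using 1 by (simp add: flat_fun_def algebra_simps power2_eq_square)
    finally have "((\<lambda>x. poly (flat_poly m) (1/x) * exp (- (1/x))) has_real_derivative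
        flat_fun (Suc m) x) (at x)" .
    then show ?thesis
      by (rule has_field_derivative_transform_within_open[where S="{0<..}"])
         (use 1 in \<open>auto simp: flat_fun_def\<close>)
  next
    case 2
    have "((\<lambda>x. 0) has_real_derivative flat_fun (Suc m) x) (at x)"
      using 2 by (simp add: flat_fun_def)
    then show ?thesis
      by (rule has_field_derivative_transform_within_open[where S="{..<0}"])
         (use 2 in \<open>auto simp: flat_fun_def\<close>)
  next
    case 3
    have l: "((\<lambda>x. flat_fun m x / x) \<longlongrightarrow> 0) (at_left 0)"
    proof (rule tendsto_eventually)
      show "\<forall>\<^sub>F x in at_left 0. flat_fun m x / x = 0"
        by (auto simp: eventually_at_filter flat_fun_def)
    qed
    \<comment> \<open>The factor \<open>[:0,1:]\<close>, multiplication by the variable, absorbs the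
      extra 1/x of the difference quotient, which is then again a polynomial in 1/x times the
      exponential.\<close>
    have "((\<lambda>x::real. poly ([:0,1:] * flat_poly m) (1/x) * exp (- (1/x))) \<longlongrightarrow> 0) (at_right 0)"
      using filterlim_compose[OF poly_times_exp_minus_at_top[of "[:0,1:] * flat_poly m"]
          filterlim_inverse_at_top_right]
      by (simp add: divide_inverse)
    moreover have "\<forall>\<^sub>F x in at_right 0.
      poly ([:0,1:] * flat_poly m) (1/x) * exp (- (1/x)) = flat_fun m x / x"
      by (auto simp: eventually_at_filter flat_fun_def)
    ultimately have r: "((\<lambda>x. flat_fun m x / x) \<longlongrightarrow> 0) (at_right 0)"
      by (rule Lim_transform_eventually)
    have "((\<lambda>x. flat_fun m x / x) \<longlongrightarrow> 0) (at 0)"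
      using l r by (simp add: filterlim_split_at)
    then show ?thesis
      using 3 by (simp add: has_field_derivative_iff flat_fun_def)
  qed
qed

lemma smooth_bump:
  fixes a :: "'a::euclidean_space"
  assumes "open V" "a \<in> V"
  shows "\<exists>(\<phi> :: 'a \<Rightarrow> real) K. smooth_on UNIV \<phi> \<and> (\<forall>x. 0 \<le> \<phi> x) \<and> \<phi> a > 0 \<and>
    compact K \<and> K \<subseteq> V \<and> (\<forall>x. x \<notin> K \<longrightarrow> \<phi> x = 0)"
proof -
  obtain r where r: "r > 0" "cball a r \<subseteq> V"
    using assms open_contains_cball by blast
  \<comment> \<open>Positive exactly on the open ball of radius r, so that the bump is exp (-1/u)
    there and 0 elsewhere.\<close>
  define u where "u = (\<lambda>x. r\<^sup>2 - (x - a) \<bullet> (x - a))"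
  have id: "smooth_on UNIV (\<lambda>x::'a. x)"
  proof -
    have "Ck_on k UNIV (\<lambda>x::'a. x)" for k
    proof (cases k)
      case (Suc l)
      show ?thesis
        unfolding Suc by (rule Ck_on_SucI[OF open_UNIV has_derivative_ident Ck_on_const[OF open_UNIV]])
    qed auto
    then show ?thesis by (simp add: smooth_on_def)
  qed
  have u: "smooth_on UNIV u"
    unfolding u_def
    by (intro smooth_on_diff smooth_on_bilinear[OF _ bounded_bilinear_inner] smooth_on_const id) auto
  show ?thesis
  proof (intro exI[of _ "\<lambda>x. flat_fun 0 (u x)"] exI[of _ "cball a r"] conjI allI impI)
    show "smooth_on UNIV (\<lambda>x. flat_fun 0 (u x))"
      by (rule smooth_on_compose_real[where F=flat_fun, OF open_UNIV u flat_fun_deriv])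
    show "0 < flat_fun 0 (u a)" using r by (simp add: flat_fun_def u_def)
    show "0 \<le> flat_fun 0 (u x)" for x by (simp add: flat_fun_def)
    show "flat_fun 0 (u x) = 0" if "x \<notin> cball a r" for x
    proof -
      have "r \<le> norm (x - a)" using that by (simp add: dist_norm norm_minus_commute)
      then have "r\<^sup>2 \<le> (norm (x - a))\<^sup>2" using r by (intro power_mono) auto
      then show ?thesis by (simp add: flat_fun_def u_def power2_norm_eq_inner)
    qed
  qed (use r in auto)
qed

subsection \<open>Symmetry of second derivatives\<close>

text \<open>The mean value theorem is applied twice, in direction u to a difference of f and in
  direction v to its derivative. The second difference is symmetric in u and v, the mixed derivative
  on the right is not visibly so; this yields the symmetry of second derivatives as s tends to
  0.\<close>

lemma second_difference_mvt:
  fixes f :: "'a::real_normed_vector \<Rightarrow> real"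
  assumes f: "smooth_on S f" and "s > 0"
    and S: "\<And>\<sigma> \<tau>. 0 \<le> \<sigma> \<Longrightarrow> \<sigma> \<le> s \<Longrightarrow> 0 \<le> \<tau> \<Longrightarrow> \<tau> \<le> s \<Longrightarrow> z + \<sigma> *\<^sub>R u + \<tau> *\<^sub>R v \<in> S"
  obtains \<sigma> \<tau> where "0 \<le> \<sigma>" "\<sigma> \<le> s" "0 \<le> \<tau>" "\<tau> \<le> s"
    "f (z + s *\<^sub>R u + s *\<^sub>R v) - f (z + s *\<^sub>R u) - f (z + s *\<^sub>R v) + f z
     = s\<^sup>2 * frechet_derivative (\<lambda>y. frechet_derivative f (at y) u) (at (z + \<sigma> *\<^sub>R u + \<tau> *\<^sub>R v)) v"
proof -
  define D where "D = (\<lambda>y. frechet_derivative f (at y) u)"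
  have D: "smooth_on S D"
    unfolding D_def by (rule smooth_on_frechet[OF f])
  have line: "((\<lambda>\<tau>. F (a + \<tau> *\<^sub>R w)) has_real_derivative frechet_derivative F (at (a + t *\<^sub>R w)) w) (at t)"
    if "smooth_on S F" "a + t *\<^sub>R w \<in> S" for F :: "'a \<Rightarrow> real" and a w t
  proof -
    have F: "(F has_derivative frechet_derivative F (at (a + t *\<^sub>R w))) (at (a + t *\<^sub>R w))"
      by (rule smooth_on_has_derivative[OF that])
    have "((\<lambda>\<tau>. a + \<tau> *\<^sub>R w) has_derivative (\<lambda>r. r *\<^sub>R w)) (at t)"
      by (auto intro!: derivative_eq_intros)
    from has_derivative_compose[OF this F]
    show ?thesis
      unfolding has_field_derivative_def
      by (simp add: linear_scale[OF has_derivative_linear[OF F]] mult_commute_abs)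
  qed
  define \<phi> where "\<phi> = (\<lambda>\<sigma>. f ((z + s *\<^sub>R v) + \<sigma> *\<^sub>R u) - f (z + \<sigma> *\<^sub>R u))"
  have "\<exists>\<sigma>>0. \<sigma> < s \<and> \<phi> s - \<phi> 0 = (s - 0) * (D ((z + s *\<^sub>R v) + \<sigma> *\<^sub>R u) - D (z + \<sigma> *\<^sub>R u))"
  proof (rule MVT2[OF \<open>s > 0\<close>])
    fix \<sigma> assume "0 \<le> \<sigma>" "\<sigma> \<le> s"
    then have "(z + s *\<^sub>R v) + \<sigma> *\<^sub>R u \<in> S" "z + \<sigma> *\<^sub>R u \<in> S"
      using S[of \<sigma> s] S[of \<sigma> 0] \<open>s > 0\<close> by (auto simp: algebra_simps)
    then show "(\<phi> has_real_derivative D ((z + s *\<^sub>R v) + \<sigma> *\<^sub>R u) - D (z + \<sigma> *\<^sub>R u)) (at \<sigma>)"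
      unfolding \<phi>_def D_def by (intro DERIV_diff line f)
  qed
  then obtain \<sigma> where \<sigma>: "0 < \<sigma>" "\<sigma> < s"
    "\<phi> s - \<phi> 0 = s * (D ((z + s *\<^sub>R v) + \<sigma> *\<^sub>R u) - D (z + \<sigma> *\<^sub>R u))"
    by auto
  define \<psi> where "\<psi> = (\<lambda>\<tau>. D ((z + \<sigma> *\<^sub>R u) + \<tau> *\<^sub>R v))"
  have "\<exists>\<tau>>0. \<tau> < s \<and> \<psi> s - \<psi> 0 = (s - 0) * frechet_derivative D (at ((z + \<sigma> *\<^sub>R u) + \<tau> *\<^sub>R v)) v"
  proof (rule MVT2[OF \<open>s > 0\<close>])
    fix \<tau> assume "0 \<le> \<tau>" "\<tau> \<le> s"
    then have "(z + \<sigma> *\<^sub>R u) + \<tau> *\<^sub>R v \<in> S"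
      using S[of \<sigma> \<tau>] \<sigma> by auto
    then show "(\<psi> has_real_derivative frechet_derivative D (at ((z + \<sigma> *\<^sub>R u) + \<tau> *\<^sub>R v)) v) (at \<tau>)"
      unfolding \<psi>_def by (intro line D)
  qed
  then obtain \<tau> where \<tau>: "0 < \<tau>" "\<tau> < s"
    "\<psi> s - \<psi> 0 = s * frechet_derivative D (at ((z + \<sigma> *\<^sub>R u) + \<tau> *\<^sub>R v)) v"
    by auto
  have "f (z + s *\<^sub>R u + s *\<^sub>R v) - f (z + s *\<^sub>R u) - f (z + s *\<^sub>R v) + f z = \<phi> s - \<phi> 0"
    by (simp add: \<phi>_def algebra_simps)
  also have "\<dots> = s * (\<psi> s - \<psi> 0)"
    using \<sigma>(3) by (simp add: \<psi>_def add_ac)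
  also have "\<dots> = s\<^sup>2 * frechet_derivative D (at (z + \<sigma> *\<^sub>R u + \<tau> *\<^sub>R v)) v"
    using \<tau>(3) by (simp add: power2_eq_square)
  finally show ?thesis
    using that[of \<sigma> \<tau>] \<sigma> \<tau> unfolding D_def by simp
qed

lemma frechet_derivative_commute_real:
  fixes f :: "'a::real_normed_vector \<Rightarrow> real"
  assumes "open S" "smooth_on S f" "z \<in> S"
  shows "frechet_derivative (\<lambda>y. frechet_derivative f (at y) u) (at z) v
       = frechet_derivative (\<lambda>y. frechet_derivative f (at y) v) (at z) u"
proof -
  define P where "P = (\<lambda>y. frechet_derivative (\<lambda>y. frechet_derivative f (at y) u) (at y) v)"
  define Q where "Q = (\<lambda>y. frechet_derivative (\<lambda>y. frechet_derivative f (at y) v) (at y) u)"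
  have cont: "continuous_on S P" "continuous_on S Q"
    unfolding P_def Q_def by (intro smooth_on_continuous smooth_on_frechet assms)+
  have eps: "\<bar>P z - Q z\<bar> < e" if "e > 0" for e
  proof -
    have "continuous (at z) P" "continuous (at z) Q"
      using cont assms continuous_on_eq_continuous_at by blast+
    then obtain d1 d2 where d: "d1 > 0" "d2 > 0"
      "\<And>y. dist y z < d1 \<Longrightarrow> dist (P y) (P z) < e/2" "\<And>y. dist y z < d2 \<Longrightarrow> dist (Q y) (Q z) < e/2"
      using \<open>e > 0\<close> unfolding continuous_at_eps_delta by (metis half_gt_zero)
    obtain d3 where d3: "d3 > 0" "ball z d3 \<subseteq> S"
      using assms open_contains_ball by blast
    define d where "d = min d1 (min d2 d3)"
    have "d > 0" using d d3 by (simp add: d_def)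
    \<comment> \<open>With this s the whole parallelogram stays within d/2 of z; the summand 1 keeps
      M positive when u and v both vanish.\<close>
    define M where "M = norm u + norm v + 1"
    define s where "s = d / (2 * M)"
    have pos: "M > 0" by (simp add: M_def add_nonneg_pos)
    have s: "s > 0" using \<open>d > 0\<close> pos by (simp add: s_def)
    have near: "dist (z + \<sigma> *\<^sub>R a + \<tau> *\<^sub>R b) z < d"
      if "0 \<le> \<sigma>" "\<sigma> \<le> s" "0 \<le> \<tau>" "\<tau> \<le> s" "{a, b} = {u, v}" for \<sigma> \<tau> a b
    proof -
      have "norm a + norm b \<le> M"
        using that(5) by (auto simp: M_def doubleton_eq_iff)
      have "dist (z + \<sigma> *\<^sub>R a + \<tau> *\<^sub>R b) z \<le> \<sigma> * norm a + \<tau> * norm b"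
        using that norm_triangle_ineq[of "\<sigma> *\<^sub>R a" "\<tau> *\<^sub>R b"] by (simp add: dist_norm add.assoc)
      also have "\<dots> \<le> s * norm a + s * norm b"
        using that by (intro add_mono mult_right_mono) auto
      also have "\<dots> \<le> s * M"
        using s \<open>norm a + norm b \<le> _\<close> by (metis distrib_left mult_left_mono less_imp_le)
      also have "\<dots> = d / 2" using pos by (simp add: s_def)
      also have "\<dots> < d" using \<open>d > 0\<close> by simp
      finally show ?thesis .
    qed
    then have inS: "z + \<sigma> *\<^sub>R a + \<tau> *\<^sub>R b \<in> S"
      if "0 \<le> \<sigma>" "\<sigma> \<le> s" "0 \<le> \<tau>" "\<tau> \<le> s" "{a, b} = {u, v}" for \<sigma> \<tau> a b
      using that d3 by (fastforce simp: d_def dist_commute)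
    obtain \<sigma> \<tau> where 1: "0 \<le> \<sigma>" "\<sigma> \<le> s" "0 \<le> \<tau>" "\<tau> \<le> s"
      "f (z + s *\<^sub>R u + s *\<^sub>R v) - f (z + s *\<^sub>R u) - f (z + s *\<^sub>R v) + f z
        = s\<^sup>2 * P (z + \<sigma> *\<^sub>R u + \<tau> *\<^sub>R v)"
      using second_difference_mvt[OF assms(2) s, of z u v] inS[where a=u and b=v] unfolding P_def by blast
    obtain \<sigma>' \<tau>' where 2: "0 \<le> \<sigma>'" "\<sigma>' \<le> s" "0 \<le> \<tau>'" "\<tau>' \<le> s"
      "f (z + s *\<^sub>R v + s *\<^sub>R u) - f (z + s *\<^sub>R v) - f (z + s *\<^sub>R u) + f z
        = s\<^sup>2 * Q (z + \<sigma>' *\<^sub>R v + \<tau>' *\<^sub>R u)"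
      using second_difference_mvt[OF assms(2) s, of z v u] inS[where a=v and b=u] unfolding Q_def by blast
    have "s\<^sup>2 * P (z + \<sigma> *\<^sub>R u + \<tau> *\<^sub>R v) = s\<^sup>2 * Q (z + \<sigma>' *\<^sub>R v + \<tau>' *\<^sub>R u)"
      using 1(5) 2(5) by (simp add: algebra_simps)
    then have "P (z + \<sigma> *\<^sub>R u + \<tau> *\<^sub>R v) = Q (z + \<sigma>' *\<^sub>R v + \<tau>' *\<^sub>R u)"
      using s by simp
    moreover have "dist (P (z + \<sigma> *\<^sub>R u + \<tau> *\<^sub>R v)) (P z) < e/2"
      using near[OF 1(1-4) refl] by (intro d(3)) (simp add: d_def)
    moreover have "dist (Q (z + \<sigma>' *\<^sub>R v + \<tau>' *\<^sub>R u)) (Q z) < e/2"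
      using near[OF 2(1-4) insert_commute] by (intro d(4)) (simp add: d_def)
    ultimately show ?thesis unfolding dist_real_def abs_less_iff by simp
  qed
  then have "P z = Q z"
    using eps[of "\<bar>P z - Q z\<bar>"] by fastforce
  then show ?thesis by (simp add: P_def Q_def)
qed

lemma frechet_derivative_linear:
  assumes "bounded_linear L" "f differentiable (at z)"
  shows "frechet_derivative (\<lambda>y. L (f y)) (at z) v = L (frechet_derivative f (at z) v)"
proof -
  have "((\<lambda>y. L (f y)) has_derivative (\<lambda>v. L (frechet_derivative f (at z) v))) (at z)"
    using assms(2) frechet_derivative_works by (blast intro: bounded_linear.has_derivative[OF assms(1)])
  from frechet_derivative_at[OF this] show ?thesis by metis
qed

text \<open>The mean value argument needs real values. Composing with real functionals, here the
  real and the imaginary part, reduces complex functions to it.\<close>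

lemma frechet_derivative_commute_linear:
  assumes "open S" "smooth_on S f" "z \<in> S" "bounded_linear (L :: 'b::real_normed_vector \<Rightarrow> real)"
  shows "L (frechet_derivative (\<lambda>y. frechet_derivative f (at y) u) (at z) v)
       = L (frechet_derivative (\<lambda>y. frechet_derivative f (at y) v) (at z) u)"
proof -
  have *: "L (frechet_derivative (\<lambda>y. frechet_derivative f (at y) u) (at z) v)
      = frechet_derivative (\<lambda>y. frechet_derivative (\<lambda>x. L (f x)) (at y) u) (at z) v" for u v
  proof -
    have "L (frechet_derivative (\<lambda>y. frechet_derivative f (at y) u) (at z) v)
        = frechet_derivative (\<lambda>y. L (frechet_derivative f (at y) u)) (at z) v"
      using frechet_derivative_linear[OF assms(4) smooth_onD[OF smooth_on_frechet[OF assms(2)] assms(3)]]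
      by simp
    also have "\<dots> = frechet_derivative (\<lambda>y. frechet_derivative (\<lambda>x. L (f x)) (at y) u) (at z) v"
    proof -
      have "(\<lambda>y. L (frechet_derivative f (at y) u)) differentiable (at z)"
        using smooth_onD[OF smooth_on_linear[OF assms(1,4) smooth_on_frechet[OF assms(2)]] assms(3)] .
      then show ?thesis
        using frechet_derivative_transform_within_open[OF _ assms(1,3),
            of "\<lambda>y. L (frechet_derivative f (at y) u)" "\<lambda>y. frechet_derivative (\<lambda>x. L (f x)) (at y) u"]
        frechet_derivative_linear[OF assms(4) smooth_onD[OF assms(2)]] by simp
    qed
    finally show ?thesis .
  qed
  show ?thesis
    unfolding * by (rule frechet_derivative_commute_real[OF assms(1) smooth_on_linear[OF assms(1,4,2)] assms(3)])
qed

lemma frechet_derivative_commute_complex: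
  fixes f :: "'a::real_normed_vector \<Rightarrow> complex"
  assumes "open S" "smooth_on S f" "z \<in> S"
  shows "frechet_derivative (\<lambda>y. frechet_derivative f (at y) u) (at z) v
       = frechet_derivative (\<lambda>y. frechet_derivative f (at y) v) (at z) u"
  using frechet_derivative_commute_linear[OF assms bounded_linear_Re]
    frechet_derivative_commute_linear[OF assms bounded_linear_Im]
  by (intro complex_eqI) auto

subsection \<open>Complex directional derivatives\<close>

lemma cdir_has_derivative:
  "(f has_derivative f') (at z) \<Longrightarrow> cdir X f z = f' (fst X) + \<i> * f' (snd X)"
  unfolding cdir_def using frechet_derivative_at by metis

text \<open>Smoothness of f ensures that both sides are genuine derivatives, which depend only on
  the values near z. This is how identities valid only on the chart domain get
  differentiated.\<close>

lemma cdir_cong: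
  assumes "open S" "z \<in> S" "smooth_on S f" "\<And>y. y \<in> S \<Longrightarrow> f y = g y"
  shows "cdir X g z = cdir X f z"
  unfolding cdir_def
  using frechet_derivative_transform_within_open[OF smooth_onD[OF assms(3,2)] assms(1,2,4)] by simp

lemma smooth_on_cdir:
  assumes "open S" "smooth_on S f"
  shows "smooth_on S (cdir X f)"
  unfolding cdir_def[abs_def]
  by (intro smooth_on_add smooth_on_mult smooth_on_const smooth_on_frechet assms)

lemma cdir_const [simp]: "cdir X (\<lambda>_. c) z = 0"
  by (simp add: cdir_def)

context
  fixes S :: "(complex^'n::finite) set" and z
  assumes z: "z \<in> S"
begin

lemma cdir_add:
  "smooth_on S f \<Longrightarrow> smooth_on S g \<Longrightarrow> cdir X (\<lambda>y. f y + g y) z = cdir X f z + cdir X g z"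
  by (subst cdir_has_derivative[OF has_derivative_add[OF smooth_on_has_derivative smooth_on_has_derivative]])
     (auto simp: z cdir_def algebra_simps)

lemma cdir_diff:
  "smooth_on S f \<Longrightarrow> smooth_on S g \<Longrightarrow> cdir X (\<lambda>y. f y - g y) z = cdir X f z - cdir X g z"
  by (subst cdir_has_derivative[OF has_derivative_diff[OF smooth_on_has_derivative smooth_on_has_derivative]])
     (auto simp: z cdir_def algebra_simps)

lemma cdir_mult:
  "smooth_on S f \<Longrightarrow> smooth_on S g \<Longrightarrow> cdir X (\<lambda>y. f y * g y) z = f z * cdir X g z + cdir X f z * g z"
  by (subst cdir_has_derivative[OF has_derivative_mult[OF smooth_on_has_derivative smooth_on_has_derivative]])
     (auto simp: z cdir_def algebra_simps)

lemma cdir_cmult: "smooth_on S f \<Longrightarrow> cdir X (\<lambda>y. c * f y) z = c * cdir X f z"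
  by (subst cdir_has_derivative[OF has_derivative_mult_right[OF smooth_on_has_derivative]])
     (auto simp: z cdir_def algebra_simps)

lemma cdir_minus: "smooth_on S f \<Longrightarrow> cdir X (\<lambda>y. - f y) z = - cdir X f z"
  using cdir_cmult[of f X "-1"] by simp

lemma cdir_sum:
  "(\<And>i. i \<in> I \<Longrightarrow> smooth_on S (f i)) \<Longrightarrow> cdir X (\<lambda>y. \<Sum>i\<in>I. f i y) z = (\<Sum>i\<in>I. cdir X (f i) z)"
  by (subst cdir_has_derivative[OF has_derivative_sum[OF smooth_on_has_derivative]])
     (auto simp: z cdir_def sum.distrib sum_distrib_left)

lemma cdir_cnj: "smooth_on S f \<Longrightarrow> cdir X (\<lambda>y. cnj (f y)) z = cnj (cdir (fst X, - snd X) f z)"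
  using linear_neg[OF has_derivative_linear[OF smooth_on_has_derivative[of S f z]]] z
  by (subst cdir_has_derivative[OF bounded_linear.has_derivative[OF bounded_linear_cnj smooth_on_has_derivative]])
     (auto simp: z cdir_def)

lemma cdir_commute:
  assumes "open S" "smooth_on S f"
  shows "cdir X (cdir Y f) z = cdir Y (cdir X f) z"
proof -
  let ?D = "\<lambda>u. \<lambda>y. frechet_derivative f (at y) u"
  have s: "smooth_on S (?D u)" for u by (rule smooth_on_frechet[OF assms(2)])
  have *: "cdir X (cdir Y f) z = cdir X (?D (fst Y)) z + \<i> * cdir X (?D (snd Y)) z" for X Y
    unfolding cdir_def[of Y f, abs_def] using s assms
    by (subst cdir_add) (auto intro!: smooth_on_mult smooth_on_const simp: cdir_cmult)
  show ?thesis
    unfolding * using frechet_derivative_commute_complex[OF assms z]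
    by (simp add: cdir_def algebra_simps)
qed

end

lemma ddz_conj: "(fst (ddz i), - snd (ddz i)) = ddzbar i" "(fst (ddzbar i), - snd (ddzbar i)) = ddz i"
  by (simp_all add: ddz_def ddzbar_def)

subsection \<open>Integration by parts\<close>

lemma integrable_compact_support:
  fixes f :: "'a::euclidean_space \<Rightarrow> complex"
  assumes "compact K" "continuous_on K f" "\<And>x. x \<notin> K \<Longrightarrow> f x = 0"
  shows "integrable lborel f"
proof -
  have "(\<lambda>x. indicator K x *\<^sub>R f x) = f"
    using assms(3) by (auto simp: indicator_def)
  then show ?thesis using borel_integrable_compact[OF assms(1,2)] by simp
qed

text \<open>The integral of a difference quotient vanishes by translation invariance.\<close>

lemma integral_frechet_derivative_eq_0:
  fixes f :: "'a::euclidean_space \<Rightarrow> complex"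
  assumes f: "\<And>x. f differentiable (at x)"
    and cont: "continuous_on UNIV (\<lambda>x. frechet_derivative f (at x) v)"
    and K: "compact K" "\<And>x. x \<notin> K \<Longrightarrow> f x = 0"
  shows "(LINT x|lborel. frechet_derivative f (at x) v) = 0"
proof -
  define D where "D = (\<lambda>x. frechet_derivative f (at x) v)"
  have contf: "continuous_on UNIV f"
    using f by (auto intro: continuous_at_imp_continuous_on differentiable_imp_continuous_within)
  obtain r where r: "\<And>x. x \<in> K \<Longrightarrow> norm x \<le> r"
    using compact_imp_bounded[OF K(1)] unfolding bounded_iff by blast
  \<comment> \<open>Outside radius R a shift by at most v cannot reach K, so one ball of radius R
    carries the dominating function for all difference quotients.\<close>
  define R where "R = r + norm v"
  have D0: "D x = 0" if "norm x > r" for x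
  proof -
    have "open (- K)" using K(1) by (simp add: compact_imp_closed open_Compl)
    moreover have "x \<in> - K" using r that by force
    ultimately have "frechet_derivative (\<lambda>x. 0) (at x) = frechet_derivative f (at x)"
      by (intro frechet_derivative_transform_within_open) (use K(2) in auto)
    then show ?thesis by (metis D_def frechet_derivative_const)
  qed
  obtain B0 where B0: "\<And>x. x \<in> cball 0 (R + norm v) \<Longrightarrow> norm (D x) \<le> B0"
  proof -
    have "compact (D ` cball 0 (R + norm v))"
      using cont unfolding D_def by (intro compact_continuous_image) (auto intro: continuous_on_subset)
    then have "bounded (D ` cball 0 (R + norm v))" by (rule compact_imp_bounded)
    then obtain B where "\<forall>y\<in>D ` cball 0 (R + norm v). norm y \<le> B" unfolding bounded_iff by blast
    then show ?thesis by (intro that[of B]) auto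
  qed
  define B where "B = max B0 0"
  have B: "norm (D x) \<le> B" for x
  proof (cases "norm x \<le> R + norm v")
    case False
    then have "norm x > r" using norm_ge_zero[of v] unfolding R_def by linarith
    then show ?thesis by (simp add: D0 B_def)
  qed (use B0[of x] in \<open>auto simp: B_def\<close>)
  define s where "s = (\<lambda>n::nat. inverse (real (Suc n)))"
  have s: "s n > 0" "s n \<le> 1" for n by (auto simp: s_def field_simps)
  define q where "q = (\<lambda>n x. (f (s n *\<^sub>R v + x) - f x) /\<^sub>R s n)"
  have line: "((\<lambda>t. f (t *\<^sub>R v + x)) has_vector_derivative D (t *\<^sub>R v + x)) (at t)" for x t
  proof -
    have F: "(f has_derivative frechet_derivative f (at (t *\<^sub>R v + x))) (at (t *\<^sub>R v + x))"
      using f frechet_derivative_works by blast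
    have "((\<lambda>t. t *\<^sub>R v + x) has_derivative (\<lambda>r. r *\<^sub>R v)) (at t)"
      by (auto intro!: derivative_eq_intros)
    from has_derivative_compose[OF this F]
    show ?thesis
      unfolding has_vector_derivative_def D_def
      by (simp add: linear_scale[OF has_derivative_linear[OF F]])
  qed
  have int_f: "integrable lborel f"
    by (rule integrable_compact_support[OF K(1) continuous_on_subset[OF contf] K(2)]) auto
  have int_shift: "integrable lborel (\<lambda>x. f (c + x))" and shift: "(LINT x|lborel. f (c + x)) = integral\<^sup>L lborel f" for c
  proof -
    have [measurable]: "f \<in> borel_measurable borel" using contf by (simp add: borel_measurable_continuous_onI)
    have "integrable (distr lborel borel ((+) c)) f" using int_f lborel_distr_plus[of c] by simp
    then show "integrable lborel (\<lambda>x. f (c + x))" by (subst (asm) integrable_distr_eq) auto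
    have "integral\<^sup>L lborel f = integral\<^sup>L (distr lborel borel ((+) c)) f" using lborel_distr_plus[of c] by simp
    also have "\<dots> = (LINT x|lborel. f (c + x))" by (subst integral_distr) auto
    finally show "(LINT x|lborel. f (c + x)) = integral\<^sup>L lborel f" by simp
  qed
  have q0: "integral\<^sup>L lborel (q n) = 0" for n
    unfolding q_def using int_f int_shift shift by simp
  have "(\<lambda>n. integral\<^sup>L lborel (q n)) \<longlonglongrightarrow> integral\<^sup>L lborel D"
  proof (rule integral_dominated_convergence)
    show "D \<in> borel_measurable lborel"
      using cont unfolding D_def by (simp add: borel_measurable_continuous_onI)
    show "q n \<in> borel_measurable lborel" for n
      unfolding q_def using int_f int_shift by (intro borel_measurable_integrable) auto
    show "integrable lborel (\<lambda>x. indicator (cball 0 R) x * B)"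
      by (intro integrable_mult_left) (auto intro!: emeasure_compact_finite)
    show "AE x in lborel. (\<lambda>n. q n x) \<longlonglongrightarrow> D x"
    proof (rule AE_I2)
      fix x
      have "((\<lambda>h. (f ((0 + h) *\<^sub>R v + x) - f (0 *\<^sub>R v + x)) /\<^sub>R h) \<longlongrightarrow> D (0 *\<^sub>R v + x)) (at 0)"
      proof -
        have "((\<lambda>h. norm (f (h *\<^sub>R v + x) - f x - h *\<^sub>R D x) / norm h) \<longlongrightarrow> 0) (at 0)"
          using line[of x 0] by (simp add: has_vector_derivative_def has_derivative_at)
        moreover have "\<forall>\<^sub>F h in at 0. norm (f (h *\<^sub>R v + x) - f x - h *\<^sub>R D x) / norm h
          = norm ((f (h *\<^sub>R v + x) - f x) /\<^sub>R h - D x)"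
        proof -
          have "norm (f (h *\<^sub>R v + x) - f x - h *\<^sub>R D x) / norm h
            = norm ((f (h *\<^sub>R v + x) - f x) /\<^sub>R h - D x)" if "h \<noteq> 0" for h
          proof -
            have "(f (h *\<^sub>R v + x) - f x) /\<^sub>R h - D x = (f (h *\<^sub>R v + x) - f x - h *\<^sub>R D x) /\<^sub>R h"
              using that by (simp add: scaleR_diff_right)
            then show ?thesis by (simp add: divide_inverse mult.commute)
          qed
          then show ?thesis by (auto simp: eventually_at_filter)
        qed
        ultimately have "((\<lambda>h. norm ((f (h *\<^sub>R v + x) - f x) /\<^sub>R h - D x)) \<longlongrightarrow> 0) (at 0)"
          by (rule Lim_transform_eventually)
        then show ?thesis by (simp add: tendsto_norm_zero_iff Lim_null[of _ "D x"])
      qed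
      moreover have "filterlim s (at 0) sequentially"
        using LIMSEQ_inverse_real_of_nat s by (auto simp: filterlim_at s_def less_imp_neq[symmetric])
      ultimately show "(\<lambda>n. q n x) \<longlonglongrightarrow> D x"
        unfolding q_def using filterlim_compose by fastforce
    qed
    show "AE x in lborel. norm (q n x) \<le> indicator (cball 0 R) x * B" for n
    proof (rule AE_I2)
      fix x
      show "norm (q n x) \<le> indicator (cball 0 R) x * B"
      proof (cases "norm x \<le> R")
        case False
        have "norm (s n *\<^sub>R v) \<le> norm v" using s[of n] by (simp add: mult_left_le_one_le)
        moreover have "norm x \<le> norm (s n *\<^sub>R v + x) + norm (s n *\<^sub>R v)"
          by (metis add_diff_cancel_left' norm_triangle_ineq4)
        ultimately have "norm (s n *\<^sub>R v + x) > r" using False by (simp add: R_def)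
        then have "f (s n *\<^sub>R v + x) = 0" using K(2) r by force
        moreover have "norm x > r" using False norm_ge_zero[of v] unfolding R_def by linarith
        then have "f x = 0" using K(2) r by force
        ultimately show ?thesis using False by (simp add: q_def)
      next
        case True
        \<comment> \<open>The mean value inequality along the segment in direction v bounds the
          difference quotient by B, uniformly in n.\<close>
        have "norm (f (s n *\<^sub>R v + x) - f (0 *\<^sub>R v + x)) \<le> B * norm (s n - 0)"
        proof (rule differentiable_bound[of UNIV _ "\<lambda>t r. r *\<^sub>R D (t *\<^sub>R v + x)"])
          show "onorm (\<lambda>r. r *\<^sub>R D (t *\<^sub>R v + x)) \<le> B" for t
            using B[of "t *\<^sub>R v + x"] by (intro onorm_le) (simp add: mult.commute[of B] mult_left_mono)
        qed (use line in \<open>auto simp: has_vector_derivative_def\<close>)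
        moreover have "norm (q n x) = norm (f (s n *\<^sub>R v + x) - f (0 *\<^sub>R v + x)) / s n"
          using s[of n] by (simp add: q_def divide_inverse mult.commute)
        ultimately show ?thesis using True s[of n] by (simp add: pos_divide_le_eq)
      qed
    qed
  qed
  then have "integral\<^sup>L lborel D = 0"
    unfolding q0 LIMSEQ_const_iff by simp
  then show ?thesis by (simp add: D_def)
qed

subsection \<open>Hermitian metrics in a chart\<close>

lemma cstruct_component [simp]: "cstruct v $ i = \<i> * v $ i"
  by (simp add: cstruct_def)

lemma cstruct_cstruct [simp]: "cstruct (cstruct v) = - v"
  by (simp add: vec_eq_iff)

lemma cstruct_linear [simp]:
  "cstruct (u + v) = cstruct u + cstruct v" "cstruct (u - v) = cstruct u - cstruct v"
  "cstruct (- v) = - cstruct v" "cstruct (r *\<^sub>R v) = r *\<^sub>R cstruct v" "cstruct 0 = 0"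
  "cstruct (c *s v) = c *s cstruct v"
  by (simp_all add: vec_eq_iff algebra_simps)

lemma cstruct_axis [simp]: "cstruct (axis i 1) = axis i \<i>" "cstruct (axis i \<i>) = - axis i 1"
  by (simp_all add: vec_eq_iff axis_def)

lemma bounded_linear_cstruct: "bounded_linear (cstruct :: complex^'n::finite \<Rightarrow> _)"
  by (intro linear_conv_bounded_linear[THEN iffD1] linearI) auto

lemma complex_vector_scale: "c *s v = Re c *\<^sub>R v + Im c *\<^sub>R cstruct v"
  by (simp add: vec_eq_iff) (simp add: complex_eq_iff)

text \<open>The vector field \<open>\<Sum> a\<^sub>m \<partial>/\<partial>z\<^sup>m\<close> of type (1,0).\<close>

definition emb10 :: "complex^'n \<Rightarrow> 'n::finite ctan" where
  "emb10 a = ((1/2) *\<^sub>R a, - (1/2) *\<^sub>R cstruct a)"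

lemma emb10_axis: "emb10 (axis i 1) = ddz i"
  by (simp add: emb10_def ddz_def)

text \<open>The sesquilinear form whose matrix in the basis \<^term>\<open>axis i 1\<close> is \<open>h\<close>.\<close>

definition herm :: "'n metric \<Rightarrow> complex^'n \<Rightarrow> complex^'n \<Rightarrow> complex^'n::finite \<Rightarrow> complex" where
  "herm g z u w = (of_real (g z u w) + \<i> * of_real (g z u (cstruct w))) / 2"

locale hermitian_chart =
  fixes V :: "(complex^'n::finite) set" and g :: "'n metric"
  assumes open_V: "open V" and metric: "hermitian_metric_on V g"
begin

lemma bilinear_g: "z \<in> V \<Longrightarrow> bilinear (g z)"
  and g_sym: "z \<in> V \<Longrightarrow> g z X Y = g z Y X"
  and g_pos: "z \<in> V \<Longrightarrow> X \<noteq> 0 \<Longrightarrow> 0 < g z X X"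
  and g_J: "z \<in> V \<Longrightarrow> g z (cstruct X) (cstruct Y) = g z X Y"
  and smooth_g: "smooth_on V (\<lambda>y. g y X Y)"
  using metric unfolding hermitian_metric_on_def by blast+

lemma g_linear:
  assumes "z \<in> V"
  shows "g z (X + Y) W = g z X W + g z Y W" "g z X (Y + W) = g z X Y + g z X W"
    "g z (X - Y) W = g z X W - g z Y W" "g z X (Y - W) = g z X Y - g z X W"
    "g z (- X) W = - g z X W" "g z X (- W) = - g z X W"
    "g z (r *\<^sub>R X) W = r * g z X W" "g z X (r *\<^sub>R W) = r * g z X W"
    "g z 0 W = 0" "g z X 0 = 0"
  using bilinear_g[OF assms]
  by (simp_all add: bilinear_ladd bilinear_radd bilinear_lsub bilinear_rsub bilinear_lneg
      bilinear_rneg bilinear_lmul bilinear_rmul bilinear_lzero bilinear_rzero)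

lemma g_J_left: "z \<in> V \<Longrightarrow> g z (cstruct X) Y = - g z X (cstruct Y)"
  using g_J[of z X "- cstruct Y"] by (simp add: g_linear)

lemma herm_axis:
  assumes "z \<in> V"
  shows "h_lo g z i j = herm g z (axis i 1) (axis j 1)"
proof -
  have "g z (axis i \<i>) (axis j \<i>) = g z (axis i 1) (axis j 1)"
    "g z (axis i \<i>) (axis j 1) = - g z (axis i 1) (axis j \<i>)"
    using g_J[OF assms, of "axis i 1" "axis j 1"] g_J_left[OF assms, of "axis i 1" "axis j 1"] by simp_all
  then show ?thesis
    unfolding h_lo_def herm_def cbilin_def ddz_def ddzbar_def
    by (simp add: g_linear[OF assms] complex_eq_iff)
qed

lemma herm_linear:
  assumes "z \<in> V"
  shows "herm g z (u + v) w = herm g z u w + herm g z v w"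
    "herm g z (u - v) w = herm g z u w - herm g z v w"
    "herm g z (c *s u) w = c * herm g z u w"
    "herm g z 0 w = 0"
  unfolding complex_vector_scale herm_def
  using g_J_left[OF assms] g_J[OF assms]
  by (simp_all add: g_linear[OF assms] complex_eq_iff field_simps)

lemma herm_cnj: "z \<in> V \<Longrightarrow> cnj (herm g z u w) = herm g z w u"
  unfolding herm_def using g_sym[of z u w] g_sym[of z u "cstruct w"] g_J_left[of z w u]
  by (simp add: complex_eq_iff)

lemma herm_expand:
  assumes "z \<in> V"
  shows "herm g z u (axis l 1) = (\<Sum>a\<in>UNIV. u $ a * h_lo g z a l)"
proof -
  have "herm g z (\<Sum>a\<in>A. (u $ a) *s axis a 1) w = (\<Sum>a\<in>A. u $ a * herm g z (axis a 1) w)"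
    if "finite A" for A w
    using that by induction (auto simp: herm_linear[OF assms])
  from this[of UNIV "axis l 1"] show ?thesis
    by (simp add: basis_expansion herm_axis[OF assms])
qed

lemma cbilin_emb10: "z \<in> V \<Longrightarrow> cbilin (g z) (emb10 b) (ddzbar l) = herm g z b (axis l 1)"
  using g_J[of z b "axis l 1"] g_J_left[of z b "axis l 1"]
  by (simp add: emb10_def ddzbar_def cbilin_def herm_def g_linear complex_eq_iff)

lemma h_lo_cnj: "z \<in> V \<Longrightarrow> cnj (h_lo g z i j) = h_lo g z j i"
  by (simp add: herm_axis herm_cnj)

text \<open>The conjugate u of a kernel vector is orthogonal to every basis vector for
  \<open>herm\<close>, hence to itself, and the real part of \<open>herm g z u u\<close> is half of
  g(u,u); positivity gives u = 0.\<close>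

lemma invertible_h:
  assumes "z \<in> V"
  shows "invertible (\<chi> a b. h_lo g z a b)"
proof -
  have "x = 0" if x: "(\<chi> a b. h_lo g z a b) *v x = 0" for x
  proof -
    define u where "u = (\<chi> a. cnj (x $ a))"
    have "herm g z u (axis a 1) = 0" for a
    proof -
      have "cnj (herm g z u (axis a 1)) = (\<Sum>b\<in>UNIV. h_lo g z a b * x $ b)"
        unfolding herm_expand[OF assms] by (simp add: u_def h_lo_cnj[OF assms] mult.commute)
      also have "\<dots> = ((\<chi> a b. h_lo g z a b) *v x) $ a"
        by (simp add: matrix_vector_mult_def)
      finally show ?thesis using x by simp
    qed
    then have 0: "herm g z (axis a 1) u = 0" for a
      using herm_cnj[OF assms, of u "axis a 1"] by simp
    have "herm g z (\<Sum>a\<in>A. (u $ a) *s axis a 1) u = 0" if "finite A" for A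
      using that by induction (auto simp: herm_linear[OF assms] 0)
    from this[of UNIV] have "herm g z u u = 0" by (simp add: basis_expansion)
    then have "g z u u = 0" by (simp add: herm_def complex_eq_iff)
    then have "u = 0" using g_pos[OF assms, of u] by fastforce
    then show "x = 0" by (simp add: u_def vec_eq_iff)
  qed
  then show ?thesis
    by (simp add: invertible_left_inverse matrix_left_invertible_ker)
qed

lemma h_inv:
  assumes "z \<in> V"
  shows h_inv1: "(\<Sum>l\<in>UNIV. h_lo g z a l * h_up g z c l) = (if a = c then 1 else 0)"
    and h_inv2: "(\<Sum>a\<in>UNIV. h_up g z a l * h_lo g z a m) = (if l = m then 1 else 0)"
proof -
  let ?H = "\<chi> a b. h_lo g z a b"
  have "\<exists>A'. ?H ** A' = mat 1 \<and> A' ** ?H = mat 1"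
    using invertible_h[OF assms] by (simp add: invertible_def)
  from someI_ex[OF this]
  have inv: "?H ** matrix_inv ?H = mat 1" "matrix_inv ?H ** ?H = mat 1"
    unfolding matrix_inv_def by auto
  have "(?H ** matrix_inv ?H) $ a $ c = (if a = c then 1 else 0)"
    unfolding inv by (simp add: mat_def)
  then show "(\<Sum>l\<in>UNIV. h_lo g z a l * h_up g z c l) = (if a = c then 1 else 0)"
    by (simp add: matrix_matrix_mult_def h_up_def transpose_def)
  have "(matrix_inv ?H ** ?H) $ l $ m = (if l = m then 1 else 0)"
    unfolding inv by (simp add: mat_def)
  then show "(\<Sum>a\<in>UNIV. h_up g z a l * h_lo g z a m) = (if l = m then 1 else 0)"
    by (simp add: matrix_matrix_mult_def h_up_def transpose_def)
qed

lemma
  assumes "z \<in> V"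
  shows raise_lower: "(\<Sum>p\<in>UNIV. (\<Sum>l\<in>UNIV. h_up g z p l * x l) * h_lo g z p m) = x m"
    and lower_raise: "(\<Sum>l\<in>UNIV. h_up g z m l * (\<Sum>a\<in>UNIV. y a * h_lo g z a l)) = y m"
    and lower_raise_bar: "(\<Sum>k\<in>UNIV. h_up g z k m * (\<Sum>l\<in>UNIV. x l * h_lo g z k l)) = x m"
proof -
  have "(\<Sum>p\<in>UNIV. (\<Sum>l\<in>UNIV. h_up g z p l * x l) * h_lo g z p m)
    = (\<Sum>l\<in>UNIV. x l * (\<Sum>p\<in>UNIV. h_up g z p l * h_lo g z p m))"
    unfolding sum_distrib_left sum_distrib_right by (subst sum.swap) (simp add: mult_ac)
  then show "(\<Sum>p\<in>UNIV. (\<Sum>l\<in>UNIV. h_up g z p l * x l) * h_lo g z p m) = x m"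
    by (simp add: h_inv2[OF assms] if_distrib[of "\<lambda>c. _ * c"] cong: if_cong)
  have "(\<Sum>l\<in>UNIV. h_up g z m l * (\<Sum>a\<in>UNIV. y a * h_lo g z a l))
    = (\<Sum>a\<in>UNIV. y a * (\<Sum>l\<in>UNIV. h_lo g z a l * h_up g z m l))"
    unfolding sum_distrib_left sum_distrib_right by (subst sum.swap) (simp add: mult_ac)
  then show "(\<Sum>l\<in>UNIV. h_up g z m l * (\<Sum>a\<in>UNIV. y a * h_lo g z a l)) = y m"
    by (simp add: h_inv1[OF assms] if_distrib[of "\<lambda>c. _ * c"] cong: if_cong)
  have "(\<Sum>k\<in>UNIV. h_up g z k m * (\<Sum>l\<in>UNIV. x l * h_lo g z k l))
    = (\<Sum>l\<in>UNIV. x l * (\<Sum>k\<in>UNIV. h_up g z k m * h_lo g z k l))"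
    unfolding sum_distrib_left sum_distrib_right by (subst sum.swap) (simp add: mult_ac)
  then show "(\<Sum>k\<in>UNIV. h_up g z k m * (\<Sum>l\<in>UNIV. x l * h_lo g z k l)) = x m"
    by (simp add: h_inv2[OF assms] if_distrib[of "\<lambda>c. _ * c"] cong: if_cong)
qed

text \<open>The conjugate transpose of the inverse of a hermitian matrix is again an inverse, and
  inverses are unique.\<close>

lemma h_up_cnj:
  assumes "z \<in> V"
  shows "cnj (h_up g z i j) = h_up g z j i"
proof -
  have *: "(\<Sum>a\<in>UNIV. cnj (h_up g z i a) * h_lo g z a l) = cnj (\<Sum>a\<in>UNIV. h_lo g z l a * h_up g z i a)" for l
    by (simp add: h_lo_cnj[OF assms] mult.commute)
  have "cnj (h_up g z i j) = (\<Sum>l\<in>UNIV. h_up g z j l * (\<Sum>a\<in>UNIV. cnj (h_up g z i a) * h_lo g z a l))"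
    by (rule lower_raise[OF assms, symmetric])
  then show ?thesis
    unfolding * by (simp add: h_inv1[OF assms] if_distrib[of "\<lambda>c. _ * c"] if_distrib[of cnj] cong: if_cong)
qed

lemma smooth_h_lo: "smooth_on V (\<lambda>y. h_lo g y i j)"
proof -
  have "smooth_on V (\<lambda>y. cbilin (g y) X Y)" for X Y
    unfolding cbilin_def Complex_eq
    by (intro smooth_on_add smooth_on_mult smooth_on_const smooth_on_of_real smooth_on_diff smooth_g open_V)
  then show ?thesis by (simp add: h_lo_def)
qed

lemma det_h_nonzero: "z \<in> V \<Longrightarrow> det (\<chi> a b. h_lo g z a b) \<noteq> 0"
  using invertible_h invertible_det_nz by blast

lemma smooth_det_h: "smooth_on V (\<lambda>y. det (\<chi> a b. h_lo g y a b))"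
  by (rule smooth_on_det[OF open_V]) (simp add: smooth_h_lo)

text \<open>By Cramer's rule every entry of the inverse is a quotient of determinants with smooth
  entries and nonvanishing denominator.\<close>

lemma smooth_h_up: "smooth_on V (\<lambda>y. h_up g y i j)"
proof (rule smooth_on_cong[OF open_V])
  let ?H = "\<lambda>y. \<chi> a b. h_lo g y a b"
  let ?D = "\<lambda>y. \<chi> a b. if b = j then axis i 1 $ a else ?H y $ a $ b"
  have "smooth_on V (\<lambda>y. ?D y $ a $ b)" for a b
    by (cases "b = j") (auto simp: smooth_h_lo smooth_on_const[OF open_V])
  then show "smooth_on V (\<lambda>y. det (?D y) * inverse (det (?H y)))"
    by (intro smooth_on_mult smooth_on_inverse smooth_on_det det_h_nonzero open_V)
       (simp_all add: smooth_h_lo)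
  fix y assume y: "y \<in> V"
  have "?H y *v (\<chi> l. h_up g y i l) = axis i 1"
    using h_inv1[OF y] by (simp add: matrix_vector_mult_def vec_eq_iff axis_def)
  from cramer[OF det_h_nonzero[OF y], THEN iffD1, OF this]
  have "(\<chi> l. h_up g y i l) $ j = det (?D y) / det (?H y)"
    by (simp only: vec_lambda_beta)
  then show "det (?D y) * inverse (det (?H y)) = h_up g y i j"
    by (simp add: divide_inverse)
qed

text \<open>Differentiate the relation between h and its inverse, which holds throughout the open
  set V, and cancel h with \<open>lower_raise_bar\<close>.\<close>

lemma cdir_h_up:
  assumes z: "z \<in> V"
  shows "cdir X (\<lambda>y. h_up g y i j) z
    = - (\<Sum>p\<in>UNIV. \<Sum>q\<in>UNIV. h_up g z i q * h_up g z p j * cdir X (\<lambda>y. h_lo g y p q) z)"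
proof -
  have "(\<Sum>l\<in>UNIV. h_lo g z a l * cdir X (\<lambda>y. h_up g y i l) z)
    = - (\<Sum>l\<in>UNIV. cdir X (\<lambda>y. h_lo g y a l) z * h_up g z i l)" for a
  proof -
    have s: "smooth_on V (\<lambda>y. h_lo g y a l * h_up g y i l)" for l
      by (intro smooth_on_mult smooth_h_lo smooth_h_up open_V)
    have "cdir X (\<lambda>y. \<Sum>l\<in>UNIV. h_lo g y a l * h_up g y i l) z = cdir X (\<lambda>_. if a = i then 1 else 0) z"
      by (rule cdir_cong[OF open_V z smooth_on_const[OF open_V]]) (simp add: h_inv1)
    then show ?thesis
      by (simp add: cdir_sum[OF z s] cdir_mult[OF z smooth_h_lo smooth_h_up] sum.distrib
          add_eq_0_iff)
  qed
  then have "cdir X (\<lambda>y. h_up g y i j) z = - (\<Sum>p\<in>UNIV. h_up g z p j *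
      (\<Sum>q\<in>UNIV. cdir X (\<lambda>y. h_lo g y p q) z * h_up g z i q))"
    using lower_raise_bar[OF z, of j "\<lambda>l. cdir X (\<lambda>y. h_up g y i l) z"]
    by (simp add: mult.commute sum_negf)
  then show ?thesis
    by (simp add: sum_distrib_left mult_ac)
qed

end

section \<open>Derivatives of determinants\<close>

lemma cdir_prod:
  fixes f :: "'i \<Rightarrow> complex^'n::finite \<Rightarrow> complex"
  assumes "z \<in> S" "\<And>i. i \<in> I \<Longrightarrow> smooth_on S (f i)"
  shows "cdir X (\<lambda>y. \<Prod>i\<in>I. f i y) z = (\<Sum>i\<in>I. cdir X (f i) z * (\<Prod>j\<in>I - {i}. f j z))"
  using assms
  by (subst cdir_has_derivative[OF has_derivative_prod[OF smooth_on_has_derivative]])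
     (auto simp: cdir_def sum.distrib sum_distrib_left algebra_simps)

lemma cdir_det:
  fixes A :: "complex^'n::finite \<Rightarrow> complex^'m^'m::finite"
  assumes S: "open S" and z: "z \<in> S" and A: "\<And>i j. smooth_on S (\<lambda>y. A y $ i $ j)"
  shows "cdir X (\<lambda>y. det (A y)) z
    = (\<Sum>i\<in>UNIV. det (\<chi> r. if r = i then (\<chi> j. cdir X (\<lambda>y. A y $ i $ j) z) else row r (A z)))"
proof -
  have s: "smooth_on S (\<lambda>y. of_int (sign p) * (\<Prod>i\<in>UNIV. A y $ i $ p i))" for p
    by (intro smooth_on_mult smooth_on_const smooth_on_prod S A)
  have "cdir X (\<lambda>y. det (A y)) z = (\<Sum>p | p permutes UNIV. of_int (sign p) *
      (\<Sum>i\<in>UNIV. cdir X (\<lambda>y. A y $ i $ p i) z * (\<Prod>j\<in>UNIV - {i}. A z $ j $ p j)))"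
    unfolding det_def
    by (simp add: cdir_sum[OF z s] cdir_cmult[OF z smooth_on_prod[OF S A]] cdir_prod[OF z A])
  also have "\<dots> = (\<Sum>i\<in>UNIV. \<Sum>p | p permutes UNIV. of_int (sign p) *
      (cdir X (\<lambda>y. A y $ i $ p i) z * (\<Prod>j\<in>UNIV - {i}. A z $ j $ p j)))"
    unfolding sum_distrib_left by (rule sum.swap)
  also have "\<dots> = (\<Sum>i\<in>UNIV. det (\<chi> r. if r = i then (\<chi> j. cdir X (\<lambda>y. A y $ i $ j) z) else row r (A z)))"
  proof (intro sum.cong refl)
    fix i :: 'm
    let ?M = "\<chi> r. if r = i then (\<chi> j. cdir X (\<lambda>y. A y $ i $ j) z) else row r (A z)"
    have "(\<Prod>r\<in>UNIV. ?M $ r $ p r) = cdir X (\<lambda>y. A y $ i $ p i) z * (\<Prod>j\<in>UNIV - {i}. A z $ j $ p j)" for p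
      by (subst prod.remove[of UNIV i]) (auto simp: row_def intro!: prod.cong)
    then show "(\<Sum>p | p permutes UNIV. of_int (sign p) *
      (cdir X (\<lambda>y. A y $ i $ p i) z * (\<Prod>j\<in>UNIV - {i}. A z $ j $ p j))) = det ?M"
      by (simp add: det_def)
  qed
  finally show ?thesis .
qed

context hermitian_chart
begin

lemma cdir_det_h:
  assumes z: "z \<in> V"
  shows "cdir X (\<lambda>y. det (\<chi> a b. h_lo g y a b)) z
    = (\<Sum>k\<in>UNIV. \<Sum>l\<in>UNIV. h_up g z k l * cdir X (\<lambda>y. h_lo g y k l) z) * det (\<chi> a b. h_lo g z a b)"
proof -
  let ?H = "\<chi> a b. h_lo g z a b"
  have *: "det (\<chi> r. if r = i then (\<chi> j. cdir X (\<lambda>y. h_lo g y i j) z) else row r ?H)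
    = (\<Sum>l\<in>UNIV. h_up g z i l * cdir X (\<lambda>y. h_lo g y i l) z) * det ?H" for i
  proof -
    \<comment> \<open>The coefficients of the differentiated row in the basis of rows of H. By
      Cramer's lemma only the coefficient of the row that was replaced contributes to the
      determinant.\<close>
    define c where "c = (\<chi> m. \<Sum>l\<in>UNIV. h_up g z m l * cdir X (\<lambda>y. h_lo g y i l) z)"
    have eq: "(\<chi> j. cdir X (\<lambda>y. h_lo g y i j) z) = (\<Sum>m\<in>UNIV. c $ m *s row m ?H)"
      using raise_lower[OF z] by (simp add: vec_eq_iff c_def row_def)
    show ?thesis
      unfolding eq cramer_lemma_transpose by (simp add: c_def)
  qed
  have s: "smooth_on V (\<lambda>y. (\<chi> a b. h_lo g y a b) $ i $ j)" for i j
    by (simp add: smooth_h_lo)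
  show ?thesis
    unfolding cdir_det[OF open_V z s] by (simp only: vec_lambda_beta * sum_distrib_right cong del: if_weak_cong)
qed

text \<open>The torsion with its upper index lowered. It is linear in first derivatives of h and
  free of the inverse metric, which makes it the convenient form for everything below.\<close>

definition torsion_lo :: "complex^'n \<Rightarrow> 'n \<Rightarrow> 'n \<Rightarrow> 'n \<Rightarrow> complex" where
  "torsion_lo z i j l = cdir (ddz i) (\<lambda>y. h_lo g y j l) z - cdir (ddz j) (\<lambda>y. h_lo g y i l) z"

lemma torsion_raise: "torsion g z i j k = (\<Sum>l\<in>UNIV. h_up g z k l * torsion_lo z i j l)"
  by (simp add: torsion_def Chern_Gamma_def torsion_lo_def sum_subtractf algebra_simps)

lemma torsion_lower: "z \<in> V \<Longrightarrow> (\<Sum>k\<in>UNIV. torsion g z i j k * h_lo g z k l) = torsion_lo z i j l"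
  unfolding torsion_raise by (rule raise_lower)

lemma torsion_lo_skew: "torsion_lo z i j l = - torsion_lo z j i l"
  by (simp add: torsion_lo_def)

lemma smooth_dh: "smooth_on V (cdir X (\<lambda>y. h_lo g y i j))"
  by (intro smooth_on_cdir smooth_h_lo open_V)

lemma smooth_torsion_lo: "smooth_on V (\<lambda>y. torsion_lo y i j l)"
  unfolding torsion_lo_def using smooth_dh by (intro smooth_on_diff open_V) auto

lemma smooth_torsion: "smooth_on V (\<lambda>y. torsion g y i j k)"
  unfolding torsion_raise
  by (intro smooth_on_sum smooth_on_mult smooth_h_up smooth_torsion_lo open_V)

lemma cdir_h_cnj:
  assumes "z \<in> V"
  shows "cnj (cdir (ddz i) (\<lambda>y. h_lo g y j k) z) = cdir (ddzbar i) (\<lambda>y. h_lo g y k j) z"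
    and "cnj (cdir (ddzbar i) (\<lambda>y. h_lo g y j k) z) = cdir (ddz i) (\<lambda>y. h_lo g y k j) z"
proof -
  have "cdir X (\<lambda>y. h_lo g y k j) z = cdir X (\<lambda>y. cnj (h_lo g y j k)) z" for X
    by (rule cdir_cong[OF open_V assms]) (auto intro: smooth_on_cnj smooth_h_lo open_V simp: h_lo_cnj)
  then show "cnj (cdir (ddz i) (\<lambda>y. h_lo g y j k) z) = cdir (ddzbar i) (\<lambda>y. h_lo g y k j) z"
    "cnj (cdir (ddzbar i) (\<lambda>y. h_lo g y j k) z) = cdir (ddz i) (\<lambda>y. h_lo g y k j) z"
    by (simp_all add: cdir_cnj[OF assms smooth_h_lo] ddz_conj)
qed

lemma torsion_lo_cnj:
  "z \<in> V \<Longrightarrow> cnj (torsion_lo z i j l) = cdir (ddzbar i) (\<lambda>y. h_lo g y l j) z - cdir (ddzbar j) (\<lambda>y. h_lo g y l i) z"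
  by (simp add: torsion_lo_def cdir_h_cnj)

end

subsection \<open>Gauduchon connections\<close>

lemma smooth_on_vec:
  fixes a :: "'b::real_normed_vector \<Rightarrow> complex^'n::finite"
  assumes "open S" "\<And>m. smooth_on S (\<lambda>y. a y $ m)"
  shows "smooth_on S a"
proof -
  have "bounded_linear (\<lambda>c. c *s axis m (1::complex))" for m :: 'n
    by (intro linear_conv_bounded_linear[THEN iffD1] linearI) (simp_all add: vec_eq_iff algebra_simps)
  from smooth_on_linear[OF assms(1) this assms(2)]
  have "smooth_on S (\<lambda>y. \<Sum>m\<in>UNIV. (a y $ m) *s axis m 1)"
    by (rule smooth_on_sum[OF assms(1)])
  then show ?thesis by (simp add: basis_expansion)
qed

text \<open>For fields of type (1,0) in the form \<open>emb10 a\<close>, the imaginary unit acts on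
  a as \<open>cstruct\<close>. The combination on the left is thus the derivative of a in the
  complex direction X.\<close>

lemma frechet_derivative_component:
  assumes "a differentiable (at z)"
  shows "(frechet_derivative a (at z) (fst X) + cstruct (frechet_derivative a (at z) (snd X))) $ m
    = cdir X (\<lambda>y. a y $ m) z"
  by (simp add: cdir_def frechet_derivative_linear[OF bounded_linear_vec_nth assms])

section \<open>First derivatives of the metric and the Koszul form of the connections\<close>

context hermitian_chart
begin

definition dg :: "complex^'n \<Rightarrow> complex^'n \<Rightarrow> complex^'n \<Rightarrow> complex^'n \<Rightarrow> real" where
  "dg z x y w = frechet_derivative (\<lambda>p. g p y w) (at z) x"

lemma dg_has_derivative: "z \<in> V \<Longrightarrow> ((\<lambda>p. g p y w) has_derivative (\<lambda>x. dg z x y w)) (at z)"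
  unfolding dg_def using smooth_on_has_derivative[OF smooth_g] .

lemma dg_eqI:
  assumes "z \<in> V" "(f has_derivative f') (at z)" "\<And>p. p \<in> V \<Longrightarrow> f p = g p y w"
  shows "dg z x y w = f' x"
proof -
  have "((\<lambda>p. g p y w) has_derivative f') (at z)"
    using has_derivative_transform_within_open[OF assms(2) open_V assms(1)] assms(3) by simp
  then show ?thesis unfolding dg_def by (metis frechet_derivative_at)
qed

lemma dg_sym: "z \<in> V \<Longrightarrow> dg z x y w = dg z x w y"
  by (rule dg_eqI[OF _ dg_has_derivative g_sym])

lemma dg_J: "z \<in> V \<Longrightarrow> dg z x (cstruct y) (cstruct w) = dg z x y w"
  by (rule dg_eqI[OF _ dg_has_derivative g_J[symmetric]])

lemma dg_linear:
  assumes z: "z \<in> V"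
  shows "dg z (x + x') y w = dg z x y w + dg z x' y w"
    "dg z (- x) y w = - dg z x y w"
    "dg z (x - x') y w = dg z x y w - dg z x' y w"
    "dg z (r *\<^sub>R x) y w = r * dg z x y w"
    "dg z x (y + y') w = dg z x y w + dg z x y' w"
    "dg z x (- y) w = - dg z x y w"
    "dg z x (y - y') w = dg z x y w - dg z x y' w"
    "dg z x (r *\<^sub>R y) w = r * dg z x y w"
    "dg z x y (w + w') = dg z x y w + dg z x y w'"
    "dg z x y (- w) = - dg z x y w"
    "dg z x y (w - w') = dg z x y w - dg z x y w'"
    "dg z x y (r *\<^sub>R w) = r * dg z x y w"
proof -
  note lin = has_derivative_linear[OF dg_has_derivative[OF z]]
  show "dg z (x + x') y w = dg z x y w + dg z x' y w" "dg z (- x) y w = - dg z x y w"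
    "dg z (x - x') y w = dg z x y w - dg z x' y w" "dg z (r *\<^sub>R x) y w = r * dg z x y w"
    using linear_add[OF lin] linear_neg[OF lin] linear_diff[OF lin] linear_scale[OF lin] by auto
  have 2: "dg z x (y + y') w = dg z x y w + dg z x y' w" for y y' w
    by (rule dg_eqI[OF z has_derivative_add[OF dg_has_derivative[OF z] dg_has_derivative[OF z]]])
       (simp add: g_linear)
  have 3: "dg z x (- y) w = - dg z x y w" for y w
    by (rule dg_eqI[OF z has_derivative_minus[OF dg_has_derivative[OF z]]]) (simp add: g_linear)
  have 4: "dg z x (r *\<^sub>R y) w = r * dg z x y w" for y w
    by (rule dg_eqI[OF z has_derivative_mult_right[OF dg_has_derivative[OF z]]]) (simp add: g_linear)
  show "dg z x (y + y') w = dg z x y w + dg z x y' w" "dg z x (- y) w = - dg z x y w"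
    "dg z x (y - y') w = dg z x y w - dg z x y' w" "dg z x (r *\<^sub>R y) w = r * dg z x y w"
    using 2[of y y' w] 2[of y "- y'" w] 3 4 by auto
  show "dg z x y (w + w') = dg z x y w + dg z x y w'" "dg z x y (- w) = - dg z x y w"
    "dg z x y (w - w') = dg z x y w - dg z x y w'" "dg z x y (r *\<^sub>R w) = r * dg z x y w"
    using 2[of w w' y] 2[of w "- w'" y] 3[of w' y] 3[of w y] 4[of w y] dg_sym[OF z, of x y] by simp_all
qed

lemma dg_J_left: "z \<in> V \<Longrightarrow> dg z x (cstruct y) w = - dg z x y (cstruct w)"
  using dg_J[of z x y "- cstruct w"] by (simp add: dg_linear)

lemma d_fund_form_dg:
  "d_fund_form g z x y w = dg z x (cstruct y) w - dg z y (cstruct x) w + dg z w (cstruct x) y"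
  by (simp add: d_fund_form_def fund_form_def dg_def)

definition koszul_LC :: "complex^'n \<Rightarrow> complex^'n \<Rightarrow> complex^'n \<Rightarrow> complex^'n \<Rightarrow> real" where
  "koszul_LC z x y w = (dg z x y w + dg z y x w - dg z w x y) / 2"

text \<open>The value of g(nabla_x y, w) for the Gauduchon connection on constant fields.\<close>

definition koszul :: "real \<Rightarrow> complex^'n \<Rightarrow> complex^'n \<Rightarrow> complex^'n \<Rightarrow> complex^'n \<Rightarrow> real" where
  "koszul t z x y w = koszul_LC z x y w
     + t / 2 * d_fund_form g z (cstruct x) (cstruct y) (cstruct w)
     + (t - 1) / 2 * d_fund_form g z (cstruct x) y w"

lemma koszul_linear:
  assumes z: "z \<in> V"
  shows "koszul t z (x + x') y w = koszul t z x y w + koszul t z x' y w"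
    "koszul t z (r *\<^sub>R x) y w = r * koszul t z x y w"
    "koszul t z x (y + y') w = koszul t z x y w + koszul t z x y' w"
    "koszul t z x (r *\<^sub>R y) w = r * koszul t z x y w"
    "koszul t z x y (w + w') = koszul t z x y w + koszul t z x y w'"
    "koszul t z x y (r *\<^sub>R w) = r * koszul t z x y w"
    "koszul_LC z x y (w + w') = koszul_LC z x y w + koszul_LC z x y w'"
    "koszul_LC z x y (r *\<^sub>R w) = r * koszul_LC z x y w"
  unfolding koszul_def koszul_LC_def d_fund_form_dg
  by (simp_all add: dg_linear[OF z] field_simps)

text \<open>This says that the connection preserves J. The coefficient of t, half of d
  omega(Jx,Jy,Jw) + d omega(Jx,y,w), has the symmetry for algebraic reasons; the content is the case
  t = 0, the Chern connection, where J being constant in a holomorphic chart enters.\<close>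

lemma koszul_J:
  assumes z: "z \<in> V"
  shows "koszul t z x (cstruct y) w = - koszul t z x y (cstruct w)"
proof -
  show ?thesis
    unfolding koszul_def koszul_LC_def d_fund_form_dg
    by (simp add: dg_linear[OF z] dg_J_left[OF z] field_simps)
qed

lemma g_nondegenerate:
  assumes "z \<in> V" "\<And>w. g z u w = g z v w"
  shows "u = v"
  using g_pos[OF assms(1), of "u - v"] assms(2)[of "u - v"] g_linear[OF assms(1)] by force

text \<open>The connections are defined by their pairings with all w under g, so each such definite
  description needs a representing vector for g and its uniqueness.\<close>

lemma riesz:
  assumes z: "z \<in> V" and "linear \<phi>"
  shows "\<exists>!v. \<forall>w. g z v w = \<phi> w"
proof -
  have lin: "linear (g z u)" "linear (\<lambda>v. g z v u)" for u
    using bilinear_g[OF z] by (auto simp: bilinear_def)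
  have expand: "\<psi> w = (\<Sum>b\<in>Basis. (w \<bullet> b) * \<psi> b)" if "linear \<psi>" for \<psi> :: "complex^'n \<Rightarrow> real" and w
  proof -
    have "\<psi> w = \<psi> (\<Sum>b\<in>Basis. (w \<bullet> b) *\<^sub>R b)" by (simp add: euclidean_representation)
    then show ?thesis by (simp add: linear_sum[OF that] linear_scale[OF that])
  qed
  \<comment> \<open>The operator that represents g by the standard inner product. Positivity of g
    makes it injective, finite dimension then surjective.\<close>
  define f where "f v = (\<Sum>b\<in>Basis. g z v b *\<^sub>R b)" for v
  have f: "f v \<bullet> b = g z v b" if "b \<in> Basis" for v b
    using that by (simp add: f_def)
  have "linear f"
    unfolding f_def by (intro linear_compose_sum ballI linearI) (auto simp: g_linear[OF z] algebra_simps)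
  moreover have "inj f"
    unfolding linear_injective_0[OF \<open>linear f\<close>]
  proof (intro allI impI)
    fix v assume "f v = 0"
    then have "g z v b = 0" if "b \<in> Basis" for b
      using f[OF that, of v] by simp
    then have "g z v v = 0"
      using expand[OF lin(1), of v v] by simp
    then show "v = 0" using g_pos[OF z, of v] by fastforce
  qed
  ultimately have "surj f"
    using linear_injective_imp_surjective by blast
  then obtain v where v: "f v = (\<Sum>b\<in>Basis. \<phi> b *\<^sub>R b)" by (metis surjD)
  have "g z v b = \<phi> b" if "b \<in> Basis" for b
    using f[OF that, of v] that by (simp add: v)
  then have "g z v w = \<phi> w" for w
    using expand[OF lin(1), of v w] expand[OF assms(2), of w] by simp
  then show ?thesis
    using g_nondegenerate[OF z] by metis
qed

definition conn :: "real \<Rightarrow> complex^'n \<Rightarrow> complex^'n \<Rightarrow> complex^'n \<Rightarrow> complex^'n" where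
  "conn t z x y = (THE v. \<forall>w. g z v w = koszul t z x y w)"

lemma conn:
  assumes z: "z \<in> V"
  shows "g z (conn t z x y) w = koszul t z x y w"
proof -
  have "linear (koszul t z x y)"
    by (intro linearI) (simp_all add: koszul_linear[OF z])
  from theI'[OF riesz[OF z this]] show ?thesis
    unfolding conn_def by blast
qed

text \<open>Only the Levi-Civita term differentiates Y; the d omega terms are tensorial. Hence the
  connection is the flat one plus the bilinear map \<open>conn\<close>.\<close>

lemma gauduchon_conn:
  assumes z: "z \<in> V"
  shows "gauduchon g t X Y z = frechet_derivative Y (at z) (X z) + conn t z (X z) (Y z)"
proof -
  have "linear (koszul_LC z (X z) (Y z))"
    by (intro linearI) (simp_all add: koszul_linear[OF z])
  from theI'[OF riesz[OF z this]]
  have LC: "g z (christoffel_LC g z (X z) (Y z)) w = koszul_LC z (X z) (Y z) w" for w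
    unfolding christoffel_LC_def koszul_LC_def dg_def by blast
  show ?thesis
    unfolding gauduchon_def
  proof (rule the_equality)
    show *: "\<forall>W. g z (frechet_derivative Y (at z) (X z) + conn t z (X z) (Y z)) W =
        g z (levi_civita g X Y z) W + t / 2 * d_fund_form g z (cstruct (X z)) (cstruct (Y z)) (cstruct W)
        + (t - 1) / 2 * d_fund_form g z (cstruct (X z)) (Y z) W"
      by (simp add: levi_civita_def g_linear[OF z] conn[OF z] LC koszul_def)
    fix v assume "\<forall>W. g z v W =
        g z (levi_civita g X Y z) W + t / 2 * d_fund_form g z (cstruct (X z)) (cstruct (Y z)) (cstruct W)
        + (t - 1) / 2 * d_fund_form g z (cstruct (X z)) (Y z) W"
    with * show "v = frechet_derivative Y (at z) (X z) + conn t z (X z) (Y z)"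
      by (intro g_nondegenerate[OF z]) simp
  qed
qed

lemma conn_linear:
  assumes z: "z \<in> V"
  shows "conn t z (x + x') y = conn t z x y + conn t z x' y"
    "conn t z (r *\<^sub>R x) y = r *\<^sub>R conn t z x y"
    "conn t z x (y + y') = conn t z x y + conn t z x y'"
    "conn t z x (r *\<^sub>R y) = r *\<^sub>R conn t z x y"
    "conn t z x (cstruct y) = cstruct (conn t z x y)"
  by (rule g_nondegenerate[OF z];
      simp add: conn[OF z] g_linear[OF z] koszul_linear[OF z] koszul_J[OF z] g_J_left[OF z])+

lemma conn_0: "z \<in> V \<Longrightarrow> conn t z 0 y = 0"
  using conn_linear(2)[of z t 0 0 y] by simp

text \<open>The operator on \<open>T\<^sup>1\<^sup>,\<^sup>0M\<close>, identified with \<^typ>\<open>complex^'n\<close> by \<^const>\<open>emb10\<close>, by which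
  the complexified connection differs from the flat one in a complex direction.\<close>

definition conn10 :: "real \<Rightarrow> complex^'n \<Rightarrow> 'n ctan \<Rightarrow> complex^'n \<Rightarrow> complex^'n" where
  "conn10 t z X a = conn t z (fst X) a + cstruct (conn t z (snd X) a)"

lemma conn10_linear:
  assumes z: "z \<in> V"
  shows "conn10 t z X (a + b) = conn10 t z X a + conn10 t z X b"
    "conn10 t z X (c *s a) = c *s conn10 t z X a"
    "conn10 t z X 0 = 0"
proof -
  show "conn10 t z X (a + b) = conn10 t z X a + conn10 t z X b"
    "conn10 t z X (c *s a) = c *s conn10 t z X a" for a b c
    unfolding complex_vector_scale conn10_def
    by (simp_all add: conn_linear[OF z] algebra_simps)
  from this(2)[of 0 0] show "conn10 t z X 0 = 0"
    by (simp add: vec_eq_iff)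
qed

text \<open>The lowered connection matrix: h applied to the covariant derivative of the k-th frame
  field in direction X and to the l-th conjugate frame field.\<close>

definition conn_coeff :: "real \<Rightarrow> complex^'n \<Rightarrow> 'n ctan \<Rightarrow> 'n \<Rightarrow> 'n \<Rightarrow> complex" where
  "conn_coeff t z X k l = herm g z (conn10 t z X (axis k 1)) (axis l 1)"

lemma herm_conn10:
  assumes z: "z \<in> V"
  shows "herm g z (conn10 t z X a) (axis l 1) = (\<Sum>k\<in>UNIV. a $ k * conn_coeff t z X k l)"
proof -
  have "herm g z (conn10 t z X (\<Sum>k\<in>A. (a $ k) *s axis k 1)) (axis l 1)
    = (\<Sum>k\<in>A. a $ k * conn_coeff t z X k l)" if "finite A" for A
    using that by induction (auto simp: herm_linear[OF z] conn10_linear[OF z] conn_coeff_def)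
  from this[of UNIV] show ?thesis by (simp add: basis_expansion)
qed

lemma conn10_component:
  assumes z: "z \<in> V"
  shows "conn10 t z X (axis k 1) $ m = (\<Sum>l\<in>UNIV. h_up g z m l * conn_coeff t z X k l)"
  unfolding conn_coeff_def herm_expand[OF z] lower_raise[OF z] ..

lemma cdir_h_lo:
  assumes z: "z \<in> V"
  shows "cdir X (\<lambda>y. h_lo g y k l) z =
    Complex (dg z (fst X) (axis k 1) (axis l 1) - dg z (snd X) (axis k 1) (axis l \<i>))
            (dg z (fst X) (axis k 1) (axis l \<i>) + dg z (snd X) (axis k 1) (axis l 1)) / 2"
proof -
  let ?f = "\<lambda>y. (complex_of_real (g y (axis k 1) (axis l 1)) + \<i> * complex_of_real (g y (axis k 1) (axis l \<i>))) * (1/2)"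
  have "smooth_on V ?f"
    by (intro smooth_on_add smooth_on_mult smooth_on_const smooth_on_of_real smooth_g open_V)
  then have "cdir X (\<lambda>y. h_lo g y k l) z = cdir X ?f z"
    by (rule cdir_cong[OF open_V z]) (simp add: herm_axis herm_def)
  also have "\<dots> = Complex (dg z (fst X) (axis k 1) (axis l 1) - dg z (snd X) (axis k 1) (axis l \<i>))
            (dg z (fst X) (axis k 1) (axis l \<i>) + dg z (snd X) (axis k 1) (axis l 1)) / 2"
  proof -
    have "(?f has_derivative (\<lambda>x. (complex_of_real (dg z x (axis k 1) (axis l 1))
      + \<i> * complex_of_real (dg z x (axis k 1) (axis l \<i>))) * (1/2))) (at z)"
      by (intro has_derivative_mult_left has_derivative_mult_right has_derivative_add has_derivative_of_real
        dg_has_derivative z)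
    from cdir_has_derivative[OF this] show ?thesis
      by (simp add: complex_eq_iff)
  qed
  finally show ?thesis .
qed

lemma conn_coeff_koszul:
  assumes z: "z \<in> V"
  shows "conn_coeff t z X k l =
    Complex (koszul t z (fst X) (axis k 1) (axis l 1) - koszul t z (snd X) (axis k 1) (axis l \<i>))
            (koszul t z (fst X) (axis k 1) (axis l \<i>) + koszul t z (snd X) (axis k 1) (axis l 1)) / 2"
  using g_J[OF z, of "conn t z (snd X) (axis k 1)" "axis l 1"]
  by (simp add: conn_coeff_def conn10_def herm_def g_linear[OF z] g_J_left[OF z] conn[OF z] complex_eq_iff)

text \<open>These are the coordinate formulas for the restricted connection with the upper index
  lowered. They follow by comparing real and imaginary parts, all of them combinations of values of
  \<open>dg\<close>.\<close>

lemma
  assumes z: "z \<in> V"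
  shows conn_coeff_ddz: "conn_coeff t z (ddz i) k l
      = cdir (ddz i) (\<lambda>y. h_lo g y k l) z - of_real t * torsion_lo z i k l"
    and conn_coeff_ddzbar: "conn_coeff t z (ddzbar i) k l = of_real t * cnj (torsion_lo z i l k)"
proof -
  have J: "dg z x (axis a \<i>) (axis b \<i>) = dg z x (axis a 1) (axis b 1)"
    "dg z x (axis a \<i>) (axis b 1) = - dg z x (axis a 1) (axis b \<i>)" for x a b
    using dg_J[OF z, of x "axis a 1" "axis b 1"] dg_J_left[OF z, of x "axis a 1" "axis b 1"] by simp_all
  \<comment> \<open>The facts \<open>J\<close> remove the second imaginary basis vector, and the
    instances of \<open>dg_sym\<close> sort the last two slots in the order i, k, l, so that equal
    terms become syntactically equal.\<close>
  note rules = conn_coeff_koszul[OF z] koszul_def koszul_LC_def d_fund_form_dg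
    cdir_h_lo[OF z] torsion_lo_def torsion_lo_cnj[OF z] ddz_def ddzbar_def dg_linear[OF z] J
    dg_sym[OF z, of _ "axis k 1" "axis i _"] dg_sym[OF z, of _ "axis l 1" "axis i _"]
    dg_sym[OF z, of _ "axis l 1" "axis k _"]
  show "conn_coeff t z (ddz i) k l
      = cdir (ddz i) (\<lambda>y. h_lo g y k l) z - of_real t * torsion_lo z i k l"
    by (simp add: rules complex_eq_iff) (simp add: field_simps)
  show "conn_coeff t z (ddzbar i) k l = of_real t * cnj (torsion_lo z i l k)"
    by (simp add: rules complex_eq_iff) (simp add: field_simps)
qed

text \<open>Since \<open>conn\<close> commutes with \<open>cstruct\<close>, the real and imaginary
  parts of the result fit together to an \<open>emb10\<close> again. Thus the complexified
  connection stays in the (1,0) part and can be iterated.\<close>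

lemma cextend_gauduchon:
  assumes z: "z \<in> V" and a: "a differentiable (at z)"
    and Z: "\<And>y. y \<in> V \<Longrightarrow> Z y = emb10 (a y)"
  shows "cextend (gauduchon g t) (\<lambda>_. X) Z z = emb10 (frechet_derivative a (at z) (fst X)
     + cstruct (frechet_derivative a (at z) (snd X)) + conn10 t z X (a z))"
proof -
  have fd: "frechet_derivative (\<lambda>y. L (Z y)) (at z) v = L' (frechet_derivative a (at z) v)"
    if "bounded_linear L'" "\<And>b. L (emb10 b) = L' b" for L and L' :: "complex^'n \<Rightarrow> complex^'n" and v
  proof -
    have "((\<lambda>y. L' (a y)) has_derivative (\<lambda>v. L' (frechet_derivative a (at z) v))) (at z)"
      using a frechet_derivative_works by (blast intro: bounded_linear.has_derivative[OF that(1)])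
    then have "((\<lambda>y. L (Z y)) has_derivative (\<lambda>v. L' (frechet_derivative a (at z) v))) (at z)"
      by (rule has_derivative_transform_within_open[OF _ open_V z]) (simp add: Z that)
    from frechet_derivative_at[OF this] show ?thesis by metis
  qed
  have 1: "frechet_derivative (\<lambda>y. fst (Z y)) (at z) v = (1/2) *\<^sub>R frechet_derivative a (at z) v" for v
    by (rule fd) (auto simp: emb10_def intro: bounded_linear_scaleR_right)
  have 2: "frechet_derivative (\<lambda>y. snd (Z y)) (at z) v
      = - (1/2) *\<^sub>R cstruct (frechet_derivative a (at z) v)" for v
    by (rule fd) (auto simp: emb10_def intro!: bounded_linear_minus
      bounded_linear_compose[OF bounded_linear_scaleR_right bounded_linear_cstruct])
  have minus: "conn t z x (- y) = - conn t z x y" for x y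
    using conn_linear(4)[OF z, of t x "-1" y] by simp
  show ?thesis
    unfolding cextend_def comp_def gauduchon_conn[OF z] 1 2
    by (simp add: Z[OF z] emb10_def conn10_def conn_linear[OF z] minus scaleR_left.diff[symmetric]
        algebra_simps)
qed

text \<open>Let H be the matrix of h and A_X that of \<open>conn_coeff\<close>. The operator in
  direction X is A_X times the inverse of H, and differentiating the inverse contributes -X(H). This
  is why each product pairs a coefficient in one direction with A - X(H) in the other.\<close>

lemma gauduchon_curv_const:
  assumes z: "z \<in> V"
    and X: "\<And>k l. smooth_on V (\<lambda>y. conn_coeff t y X k l)"
    and Y: "\<And>k l. smooth_on V (\<lambda>y. conn_coeff t y Y k l)"
  shows "gauduchon_curv g t (\<lambda>_. X) (\<lambda>_. Y) (\<lambda>_. ddz k) (\<lambda>_. ddzbar l) z =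
    cdir X (\<lambda>y. conn_coeff t y Y k l) z - cdir Y (\<lambda>y. conn_coeff t y X k l) z
    + (\<Sum>p\<in>UNIV. \<Sum>q\<in>UNIV. h_up g z p q *
       (conn_coeff t z Y k q * (conn_coeff t z X p l - cdir X (\<lambda>y. h_lo g y p l) z)
      - conn_coeff t z X k q * (conn_coeff t z Y p l - cdir Y (\<lambda>y. h_lo g y p l) z)))"
proof -
  let ?N = "cextend (gauduchon g t)"
  let ?B = "\<lambda>Y y. conn10 t y Y (axis k 1)"
  define D where "D X Y = frechet_derivative (?B Y) (at z) (fst X)
      + cstruct (frechet_derivative (?B Y) (at z) (snd X))" for X Y
  have once: "?N (\<lambda>_. Y) (\<lambda>_. ddz k) y = emb10 (?B Y y)" if "y \<in> V" for Y y
    by (subst cextend_gauduchon[OF that, of "\<lambda>_. axis k 1"]) (auto simp: emb10_axis)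
  have B: "smooth_on V (\<lambda>y. ?B Y y $ m)" if "\<And>k l. smooth_on V (\<lambda>y. conn_coeff t y Y k l)" for Y m
  proof (rule smooth_on_cong[OF open_V])
    show "smooth_on V (\<lambda>y. \<Sum>l\<in>UNIV. h_up g y m l * conn_coeff t y Y k l)"
      by (intro smooth_on_sum smooth_on_mult smooth_h_up that open_V)
  qed (simp add: conn10_component)
  have diff: "?B Y differentiable (at z)" if "\<And>k l. smooth_on V (\<lambda>y. conn_coeff t y Y k l)" for Y
    by (rule smooth_onD[OF smooth_on_vec[OF open_V B[OF that]] z])
  have twice: "?N (\<lambda>_. X) (?N (\<lambda>_. Y) (\<lambda>_. ddz k)) z = emb10 (D X Y + conn10 t z X (?B Y z))"
    if "\<And>k l. smooth_on V (\<lambda>y. conn_coeff t y Y k l)" for X Y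
    unfolding D_def by (rule cextend_gauduchon[OF z diff[OF that] once])
  have br: "cextend lie_bracket (\<lambda>_. X) (\<lambda>_. Y) = (\<lambda>_. (0, 0))"
    by (simp add: cextend_def lie_bracket_def comp_def)
  have bracket: "?N (cextend lie_bracket (\<lambda>_. X) (\<lambda>_. Y)) (\<lambda>_. ddz k) z = 0"
    unfolding br once[OF z] by (simp add: conn10_def conn_0[OF z] emb10_def zero_prod_def)
  have low: "herm g z (D X Y) (axis l 1) = cdir X (\<lambda>y. conn_coeff t y Y k l) z
      - (\<Sum>p\<in>UNIV. \<Sum>q\<in>UNIV. h_up g z p q * conn_coeff t z Y k q * cdir X (\<lambda>y. h_lo g y p l) z)"
    if Y: "\<And>k l. smooth_on V (\<lambda>y. conn_coeff t y Y k l)" for X Y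
  proof -
    have s: "smooth_on V (\<lambda>y. ?B Y y $ m * h_lo g y m l)" for m
      by (intro smooth_on_mult B Y smooth_h_lo open_V)
    \<comment> \<open>The product rule for operator times h, to be solved for the derivative of the
      operator; the inverse metric is never differentiated.\<close>
    have "cdir X (\<lambda>y. conn_coeff t y Y k l) z = cdir X (\<lambda>y. \<Sum>m\<in>UNIV. ?B Y y $ m * h_lo g y m l) z"
      by (rule cdir_cong[OF open_V z smooth_on_sum[OF open_V s]])
         (simp add: conn_coeff_def herm_expand)
    also have "\<dots> = (\<Sum>m\<in>UNIV. ?B Y z $ m * cdir X (\<lambda>y. h_lo g y m l) z) + herm g z (D X Y) (axis l 1)"
      unfolding herm_expand[OF z] D_def frechet_derivative_component[OF diff[OF Y]]
      by (simp add: cdir_sum[OF z s] cdir_mult[OF z B[OF Y] smooth_h_lo] sum.distrib)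
    finally show ?thesis
      by (simp add: conn10_component[OF z] sum_distrib_right)
  qed
  have quad: "herm g z (conn10 t z X (?B Y z)) (axis l 1)
    = (\<Sum>p\<in>UNIV. \<Sum>q\<in>UNIV. h_up g z p q * conn_coeff t z Y k q * conn_coeff t z X p l)" for X Y
    by (simp add: herm_conn10[OF z] conn10_component[OF z] sum_distrib_right)
  have emb_diff: "emb10 u - emb10 v - 0 = emb10 (u - v)" for u v :: "complex^'n"
    by (simp add: emb10_def scaleR_diff_right)
  have "gauduchon_curv g t (\<lambda>_. X) (\<lambda>_. Y) (\<lambda>_. ddz k) (\<lambda>_. ddzbar l) z
    = herm g z (D X Y + conn10 t z X (?B Y z) - (D Y X + conn10 t z Y (?B X z))) (axis l 1)"
    unfolding gauduchon_curv_def Let_def twice[OF X] twice[OF Y] bracket emb_diff cbilin_emb10[OF z] ..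
  also have "\<dots> = cdir X (\<lambda>y. conn_coeff t y Y k l) z - cdir Y (\<lambda>y. conn_coeff t y X k l) z
    + (\<Sum>p\<in>UNIV. \<Sum>q\<in>UNIV. h_up g z p q *
       (conn_coeff t z Y k q * (conn_coeff t z X p l - cdir X (\<lambda>y. h_lo g y p l) z)
      - conn_coeff t z X k q * (conn_coeff t z Y p l - cdir Y (\<lambda>y. h_lo g y p l) z)))"
    unfolding herm_linear[OF z] low[OF X] low[OF Y] quad
    by (simp add: sum_subtractf sum.distrib algebra_simps)
  finally show ?thesis .
qed

text \<open>For X = \<open>ddz i\<close> the difference A - X(h) is -t T, so one product is purely
  of degree two in t. The other one is the product of dh - t T with the corresponding conjugate-type
  factor: its term of degree 0 is the quadratic part of \<open>Chern_curv\<close>, its linear terms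
  complete the second derivatives to Chern curvatures, and its term of degree two is the remaining
  torsion product.\<close>

lemma R_G_lowered:
  assumes z: "z \<in> V"
  shows "R_G g t z i j k l = Chern_curv g z i j k l
    + of_real t * (Chern_curv g z i l k j + Chern_curv g z k j i l - 2 * Chern_curv g z i j k l)
    + (of_real t)\<^sup>2 * (\<Sum>p\<in>UNIV. \<Sum>q\<in>UNIV. h_up g z p q *
       (torsion_lo z i k q * cnj (torsion_lo z j l p) - torsion_lo z i p l * cnj (torsion_lo z j q k)))"
proof -
  have X: "smooth_on V (\<lambda>y. conn_coeff t y (ddz i) k l)" for k l
  proof (rule smooth_on_cong[OF open_V])
    show "smooth_on V (\<lambda>y. cdir (ddz i) (\<lambda>y. h_lo g y k l) y - of_real t * torsion_lo y i k l)"
      using smooth_dh by (intro smooth_on_diff smooth_on_mult smooth_on_const smooth_torsion_lo open_V) auto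
  qed (simp add: conn_coeff_ddz)
  have Y: "smooth_on V (\<lambda>y. conn_coeff t y (ddzbar j) k l)" for k l
  proof (rule smooth_on_cong[OF open_V])
    show "smooth_on V (\<lambda>y. of_real t * cnj (torsion_lo y j l k))"
      by (intro smooth_on_mult smooth_on_const smooth_on_cnj smooth_torsion_lo open_V)
  qed (simp add: conn_coeff_ddzbar)
  let ?h = "\<lambda>a b y. h_lo g y a b"
  have dX: "cdir (ddzbar j) (\<lambda>y. conn_coeff t y (ddz i) k l) z
    = cdir (ddzbar j) (cdir (ddz i) (?h k l)) z
      - of_real t * (cdir (ddzbar j) (cdir (ddz i) (?h k l)) z - cdir (ddzbar j) (cdir (ddz k) (?h i l)) z)"
  proof -
    have "cdir (ddzbar j) (\<lambda>y. conn_coeff t y (ddz i) k l) z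
      = cdir (ddzbar j) (\<lambda>y. cdir (ddz i) (?h k l) y - of_real t * (cdir (ddz i) (?h k l) y - cdir (ddz k) (?h i l) y)) z"
      by (rule cdir_cong[OF open_V z])
         (auto intro!: smooth_dh smooth_on_diff smooth_on_mult smooth_on_const open_V
           simp: conn_coeff_ddz torsion_lo_def)
    then show ?thesis
      using smooth_dh
      by (simp add: cdir_diff[OF z] cdir_cmult[OF z] smooth_on_diff smooth_on_mult smooth_on_const open_V)
  qed
  have dY: "cdir (ddz i) (\<lambda>y. conn_coeff t y (ddzbar j) k l) z
    = of_real t * (cdir (ddz i) (cdir (ddzbar j) (?h k l)) z - cdir (ddz i) (cdir (ddzbar l) (?h k j)) z)"
  proof -
    have "cdir (ddz i) (\<lambda>y. conn_coeff t y (ddzbar j) k l) z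
      = cdir (ddz i) (\<lambda>y. of_real t * (cdir (ddzbar j) (?h k l) y - cdir (ddzbar l) (?h k j) y)) z"
      by (rule cdir_cong[OF open_V z])
         (auto intro!: smooth_dh smooth_on_diff smooth_on_mult smooth_on_const open_V
           simp: conn_coeff_ddzbar torsion_lo_cnj)
    then show ?thesis
      using smooth_dh
      by (simp add: cdir_diff[OF z] cdir_cmult[OF z] smooth_on_diff open_V)
  qed
  show ?thesis
    unfolding R_G_def gauduchon_curv_const[OF z X Y] dX dY
      conn_coeff_ddz[OF z] conn_coeff_ddzbar[OF z] Chern_curv_def
      cdir_commute[OF z open_V smooth_h_lo, of "ddzbar j" "ddz _"]
    by (simp add: torsion_lo_def cdir_h_cnj[OF z] sum_subtractf sum.distrib sum_distrib_left algebra_simps power2_eq_square)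
qed

end

subsection \<open>Formal adjoints\<close>

lemma sum_length_0: "(\<Sum>I | length I = 0. f I) = f []"
  by simp

text \<open>Peels off one index at a time, which turns the sums over lists in
  \<open>form_inner\<close> into iterated sums over indices.\<close>

lemma sum_length_Suc:
  fixes f :: "'n::finite list \<Rightarrow> complex"
  shows "(\<Sum>I | length I = Suc n. f I) = (\<Sum>i\<in>UNIV. \<Sum>I | length I = n. f (i # I))"
proof -
  have "{I::'n list. length I = Suc n} = (\<lambda>(i, I). i # I) ` (UNIV \<times> {I. length I = n})"
    by (auto simp: length_Suc_conv image_iff)
  moreover have "inj_on (\<lambda>(i, I). i # I) (UNIV \<times> {I::'n list. length I = n})"
    by (auto simp: inj_on_def)
  ultimately have "(\<Sum>I | length I = Suc n. f I) = (\<Sum>(i, I)\<in>UNIV \<times> {I. length I = n}. f (i # I))"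
    by (simp add: sum.reindex case_prod_unfold)
  also have "\<dots> = (\<Sum>i\<in>UNIV. \<Sum>I | length I = n. f (i # I))"
    using finite_lists_length_eq[of "UNIV::'n set" n] by (subst sum.cartesian_product) auto
  finally show ?thesis .
qed

lemmas sum_length = sum_length_0 sum_length_Suc

lemma form_inner_11: "form_inner g z 1 1 \<alpha> \<beta> = (\<Sum>i\<in>UNIV. \<Sum>k\<in>UNIV. \<Sum>j\<in>UNIV. \<Sum>l\<in>UNIV.
    h_up g z i k * h_up g z l j * \<alpha> [i] [j] * cnj (\<beta> [k] [l]))"
  by (simp add: form_inner_def sum_length del: length_0_conv)

lemma form_inner_01: "form_inner g z 0 1 \<alpha> \<beta> =
    (\<Sum>j\<in>UNIV. \<Sum>l\<in>UNIV. h_up g z l j * \<alpha> [] [j] * cnj (\<beta> [] [l]))"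
  by (simp add: form_inner_def sum_length del: length_0_conv)

lemma form_inner_10: "form_inner g z 1 0 \<alpha> \<beta> =
    (\<Sum>i\<in>UNIV. \<Sum>k\<in>UNIV. h_up g z i k * \<alpha> [i] [] * cnj (\<beta> [k] []))"
  by (simp add: form_inner_def sum_length del: length_0_conv)

section \<open>Forms of type (0,1) and (1,0)\<close>

definition form01 :: "('n \<Rightarrow> complex) \<Rightarrow> 'n cform" where
  "form01 a I J = (if length I = 0 \<and> length J = 1 then a (hd J) else 0)"

definition form10 :: "('n \<Rightarrow> complex) \<Rightarrow> 'n cform" where
  "form10 a I J = (if length I = 1 \<and> length J = 0 then a (hd I) else 0)"

lemma form01_simp [simp]: "form01 a [] [j] = a j"
  by (simp add: form01_def)

lemma form10_simp [simp]: "form10 a [i] [] = a i"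
  by (simp add: form10_def)

text \<open>The antisymmetry conditions are vacuous on lists of length at most one.\<close>

lemma pq_form_01: "pq_form 0 1 \<alpha> \<longleftrightarrow> (\<exists>a. \<alpha> = form01 a)"
proof
  assume *: "pq_form 0 1 \<alpha>"
  have "\<alpha> I J = form01 (\<lambda>j. \<alpha> [] [j]) I J" for I J
    using * by (cases "length I = 0 \<and> length J = 1") (auto simp: pq_form_def form01_def length_Suc_conv)
  then show "\<exists>a. \<alpha> = form01 a" by blast
next
  assume "\<exists>a. \<alpha> = form01 a"
  then show "pq_form 0 1 \<alpha>" by (auto simp: pq_form_def form01_def swap_nth_def)
qed

lemma pq_form_10: "pq_form 1 0 \<alpha> \<longleftrightarrow> (\<exists>a. \<alpha> = form10 a)"
proof
  assume *: "pq_form 1 0 \<alpha>"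
  have "\<alpha> I J = form10 (\<lambda>i. \<alpha> [i] []) I J" for I J
    using * by (cases "length I = 1 \<and> length J = 0") (auto simp: pq_form_def form10_def length_Suc_conv)
  then show "\<exists>a. \<alpha> = form10 a" by blast
next
  assume "\<exists>a. \<alpha> = form10 a"
  then show "pq_form 1 0 \<alpha>" by (auto simp: pq_form_def form10_def swap_nth_def)
qed

lemma smooth_form_01:
  assumes "open V" "\<And>j. smooth_on V (\<lambda>z. a z j)"
  shows "smooth_form V 0 1 (\<lambda>z. form01 (a z))"
  unfolding smooth_form_def
proof (intro conjI ballI allI)
  have "smooth_on V (\<lambda>z. if P then a z j else 0)" for P j
    using assms by (cases P) (simp_all add: smooth_on_const)
  then show "smooth_on V (\<lambda>z. form01 (a z) I J)" for I J
    unfolding form01_def .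
qed (use pq_form_01 in blast)

lemma smooth_form_10:
  assumes "open V" "\<And>j. smooth_on V (\<lambda>z. a z j)"
  shows "smooth_form V 1 0 (\<lambda>z. form10 (a z))"
  unfolding smooth_form_def
proof (intro conjI ballI allI)
  have "smooth_on V (\<lambda>z. if P then a z j else 0)" for P j
    using assms by (cases P) (simp_all add: smooth_on_const)
  then show "smooth_on V (\<lambda>z. form10 (a z) I J)" for I J
    unfolding form10_def .
qed (use pq_form_10 in blast)

section \<open>Functions with compact support in an open set\<close>

context
  fixes V K :: "(complex^'n::finite) set" and f :: "complex^'n \<Rightarrow> complex"
  assumes V: "open V" and K: "compact K" "K \<subseteq> V"
    and f0: "\<And>y. y \<notin> K \<Longrightarrow> f y = 0"
begin

lemma set_integrable_test: "continuous_on V f \<Longrightarrow> set_integrable lborel V f"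
  unfolding set_integrable_def
  using K f0 by (intro integrable_compact_support[OF K(1)])
    (auto intro!: continuous_on_eq[of K f] continuous_on_subset[of V f] simp: indicator_def)

lemma set_integral_test: "(LINT y:V|lborel. f y) = (LINT y|lborel. f y)"
  unfolding set_lebesgue_integral_def
  using K f0 by (intro Bochner_Integration.integral_cong) (auto simp: indicator_def)

lemma continuous_on_test:
  assumes "continuous_on V f"
  shows "continuous_on UNIV f"
proof -
  have "open (- K)" using K(1) by (simp add: compact_imp_closed open_Compl)
  moreover have "continuous_on (- K) f"
    by (rule continuous_on_eq[of _ "\<lambda>_. 0"]) (auto simp: f0)
  ultimately have "continuous_on (V \<union> - K) f"
    using continuous_on_open_Un[OF V] assms by blast
  moreover have "V \<union> - K = UNIV" using K(2) by blast
  ultimately show ?thesis by simp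
qed

lemma frechet_derivative_test:
  assumes "y \<notin> K"
  shows "(f has_derivative (\<lambda>_. 0)) (at y)"
proof -
  have "open (- K)" using K(1) by (simp add: compact_imp_closed open_Compl)
  then show ?thesis
    using has_derivative_transform_within_open[OF has_derivative_const[of 0], of "- K" y f] assms f0 by auto
qed

end

text \<open>V and the complement of K form an open cover, so f is differentiable on the whole space
  and the integral may be taken there, separately for the real and the imaginary part of X.\<close>

lemma set_integral_cdir_eq_0:
  fixes V :: "(complex^'n::finite) set"
  assumes V: "open V" and K: "compact K" "K \<subseteq> V" and f0: "\<And>y. y \<notin> K \<Longrightarrow> f y = 0"
    and f: "smooth_on V f"
  shows "(LINT y:V|lborel. cdir X f y) = 0"
proof -
  have supp: "(f has_derivative (\<lambda>_. 0)) (at y)" if "y \<notin> K" for y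
    by (rule frechet_derivative_test[OF V K _ that]) (rule f0)
  have fd0: "frechet_derivative f (at y) v = 0" if "y \<notin> K" for y v
    using frechet_derivative_at[OF supp[OF that]] by metis
  have contV: "continuous_on V (\<lambda>y. frechet_derivative f (at y) v)" for v
    by (intro smooth_on_continuous smooth_on_frechet f)
  have cont: "continuous_on UNIV (\<lambda>y. frechet_derivative f (at y) v)" for v
    using continuous_on_test[OF V K, of "\<lambda>y. frechet_derivative f (at y) v"] fd0 contV by blast
  have diff: "f differentiable (at y)" for y
    using supp[of y] smooth_onD[OF f, of y] K(2) unfolding differentiable_def by blast
  have int0: "(LINT y|lborel. frechet_derivative f (at y) v) = 0" for v
    by (rule integral_frechet_derivative_eq_0[OF diff cont K(1) f0])
  have int: "integrable lborel (\<lambda>y. frechet_derivative f (at y) v)" for v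
    by (rule integrable_compact_support[OF K(1) continuous_on_subset[OF cont] fd0]) auto
  have "(LINT y:V|lborel. cdir X f y) = (LINT y|lborel. cdir X f y)"
    by (rule set_integral_test[OF V K]) (simp add: cdir_def fd0)
  also have "\<dots> = 0"
    unfolding cdir_def using int by (simp add: int0)
  finally show ?thesis .
qed

text \<open>Multiplying r by a bump function positive at z gives a continuous nonnegative function
  with integral 0. The set where it does not vanish is open and null, hence empty.\<close>

lemma fundamental_lemma:
  fixes V :: "(complex^'n::finite) set" and r :: "complex^'n \<Rightarrow> real"
  assumes V: "open V" and cont: "continuous_on V r" and nonneg: "\<And>y. y \<in> V \<Longrightarrow> 0 \<le> r y"
    and int0: "\<And>\<phi> K. smooth_on UNIV \<phi> \<Longrightarrow> compact K \<Longrightarrow> K \<subseteq> V \<Longrightarrow> (\<And>y. y \<notin> K \<Longrightarrow> \<phi> y = 0) \<Longrightarrow>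
      (LINT y:V|lborel. complex_of_real (\<phi> y * r y)) = 0"
    and z: "z \<in> V"
  shows "r z = 0"
proof -
  obtain \<phi> :: "complex^'n \<Rightarrow> real" and K where \<phi>: "smooth_on UNIV \<phi>" "\<And>x. 0 \<le> \<phi> x" "\<phi> z > 0"
    "compact K" "K \<subseteq> V" "\<And>x. x \<notin> K \<Longrightarrow> \<phi> x = 0"
    using smooth_bump[OF V z] by blast
  define F where "F y = \<phi> y * r y" for y
  have F0: "complex_of_real (F y) = 0" if "y \<notin> K" for y
    using \<phi>(6)[OF that] by (simp add: F_def)
  have cV: "continuous_on V (\<lambda>y. complex_of_real (F y))"
    unfolding F_def using smooth_on_continuous[OF \<phi>(1)] cont
    by (intro continuous_on_of_real continuous_on_mult) (auto intro: continuous_on_subset)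
  have cU: "continuous_on UNIV (\<lambda>y. complex_of_real (F y))"
    by (rule continuous_on_test[where f="\<lambda>y. complex_of_real (F y)", OF V \<phi>(4,5) F0 cV])
  have cF: "continuous_on UNIV F"
    using continuous_on_Re[OF cU] by simp
  have intF: "integrable lborel F"
    using integrable_compact_support[OF \<phi>(4) continuous_on_subset[OF cU] F0]
    by (simp add: complex_of_real_integrable_eq)
  have nn: "0 \<le> F y" for y
    using \<phi>(2,5,6) nonneg[of y] by (cases "y \<in> K") (auto simp: F_def)
  have "complex_of_real (LINT y|lborel. F y) = (LINT y:V|lborel. complex_of_real (F y))"
    using set_integral_test[where f="\<lambda>y. complex_of_real (F y)", OF V \<phi>(4,5) F0] by simp
  also have "\<dots> = 0"
    unfolding F_def by (rule int0[OF \<phi>(1,4,5,6)])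
  finally have "(LINT y|lborel. F y) = 0" by simp
  then have "AE y in lborel. F y = 0"
    using integral_nonneg_eq_0_iff_AE[OF intF] nn by simp
  moreover have op: "open {y. F y \<noteq> 0}"
    using cF by (intro open_Collect_neq) auto
  ultimately have "{y. F y \<noteq> 0} \<in> null_sets lborel"
    by (subst AE_iff_null_sets) auto
  then have "negligible {y. F y \<noteq> 0}"
    by (simp add: negligible_iff_null_sets null_sets_completionI)
  with op have "F z = 0"
    using open_not_negligible[of "{y. F y \<noteq> 0}"] by blast
  then show ?thesis using \<phi>(3) by (simp add: F_def)
qed

context hermitian_chart
begin

lemma smooth_vol: "smooth_on V (vol_density g)"
  unfolding vol_density_def[abs_def] by (intro smooth_on_mult smooth_on_const smooth_det_h open_V)

lemma vol_nonzero: "z \<in> V \<Longrightarrow> vol_density g z \<noteq> 0"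
  using det_h_nonzero by (simp add: vol_density_def)

lemma cdir_vol:
  "z \<in> V \<Longrightarrow> cdir X (vol_density g) z
    = (\<Sum>k\<in>UNIV. \<Sum>l\<in>UNIV. h_up g z k l * cdir X (\<lambda>y. h_lo g y k l) z) * vol_density g z"
  unfolding vol_density_def[abs_def]
  by (simp add: cdir_cmult[OF _ smooth_det_h] cdir_det_h)

text \<open>Testing with the multiples of \<open>cnj vol \<cdot> W \<gamma>\<close> by bump functions turns the pairing into the
  integral of a nonnegative function.\<close>

lemma pairing_nondegenerate:
  fixes M W :: "complex^'n \<Rightarrow> 'n \<Rightarrow> 'n \<Rightarrow> complex"
  assumes W: "\<And>m j. smooth_on V (\<lambda>y. W y m j)"
    and MW: "\<And>y l m. y \<in> V \<Longrightarrow> (\<Sum>j\<in>UNIV. M y l j * W y m j) = (if l = m then 1 else 0)"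
    and \<gamma>: "\<And>j. smooth_on V (\<lambda>y. \<gamma> y j)"
    and int0: "\<And>a K. (\<And>j. smooth_on V (\<lambda>y. a y j)) \<Longrightarrow> compact K \<Longrightarrow> K \<subseteq> V \<Longrightarrow>
      (\<And>y j. y \<notin> K \<Longrightarrow> a y j = 0) \<Longrightarrow>
      (LINT y:V|lborel. (\<Sum>j\<in>UNIV. \<Sum>l\<in>UNIV. M y l j * a y j * cnj (\<gamma> y l)) * vol_density g y) = 0"
    and z: "z \<in> V"
  shows "\<gamma> z j = 0"
proof -
  define r where "r y = (cmod (vol_density g y))\<^sup>2 * (\<Sum>l\<in>UNIV. (cmod (\<gamma> y l))\<^sup>2)" for y
  have "r z = 0"
  proof (rule fundamental_lemma[OF open_V _ _ _ z])
    show "continuous_on V r"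
      unfolding r_def by (intro continuous_intros smooth_on_continuous smooth_vol \<gamma>)
    show "0 \<le> r y" for y
      by (simp add: r_def sum_nonneg)
    fix \<phi> :: "complex^'n \<Rightarrow> real" and K
    assume \<phi>: "smooth_on UNIV \<phi>" and K: "compact K" "K \<subseteq> V" and \<phi>0: "\<And>y. y \<notin> K \<Longrightarrow> \<phi> y = 0"
    define a where "a y j = of_real (\<phi> y) * (cnj (vol_density g y) * (\<Sum>m\<in>UNIV. W y m j * \<gamma> y m))" for y j
    have "Ck_on k V \<phi>" for k
    proof -
      have "Ck_on k UNIV f \<Longrightarrow> Ck_on k V f" for f :: "complex^'n \<Rightarrow> real"
        by (induction k arbitrary: f) (auto intro: continuous_on_subset)
      then show ?thesis using \<phi> by (simp add: smooth_on_def)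
    qed
    then have "smooth_on V \<phi>" by (simp add: smooth_on_def)
    then have a: "smooth_on V (\<lambda>y. a y j)" for j
      unfolding a_def
      by (intro smooth_on_mult smooth_on_of_real smooth_on_cnj smooth_vol smooth_on_sum W \<gamma> open_V)
    have "(LINT y:V|lborel. complex_of_real (\<phi> y * r y))
      = (LINT y:V|lborel. (\<Sum>j\<in>UNIV. \<Sum>l\<in>UNIV. M y l j * a y j * cnj (\<gamma> y l)) * vol_density g y)"
    proof (rule set_lebesgue_integral_cong)
      show "\<forall>y. y \<in> V \<longrightarrow> complex_of_real (\<phi> y * r y)
        = (\<Sum>j\<in>UNIV. \<Sum>l\<in>UNIV. M y l j * a y j * cnj (\<gamma> y l)) * vol_density g y"
      proof (intro allI impI)
        fix y assume y: "y \<in> V"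
        define S where "S j = (\<Sum>m\<in>UNIV. W y m j * \<gamma> y m)" for j
        have contr: "(\<Sum>j\<in>UNIV. M y l j * S j) = \<gamma> y l" for l
        proof -
          have "(\<Sum>j\<in>UNIV. M y l j * S j) = (\<Sum>m\<in>UNIV. \<gamma> y m * (\<Sum>j\<in>UNIV. M y l j * W y m j))"
            unfolding S_def sum_distrib_left by (subst sum.swap) (simp add: mult_ac)
          then show ?thesis
            by (simp add: MW[OF y] if_distrib[of "\<lambda>c. _ * c"] cong: if_cong)
        qed
        have "(\<Sum>j\<in>UNIV. \<Sum>l\<in>UNIV. M y l j * a y j * cnj (\<gamma> y l))
          = (\<Sum>l\<in>UNIV. \<Sum>j\<in>UNIV. M y l j * a y j * cnj (\<gamma> y l))"
          by (rule sum.swap)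
        also have "\<dots> = (\<Sum>l\<in>UNIV. of_real (\<phi> y) * cnj (vol_density g y) * cnj (\<gamma> y l)
              * (\<Sum>j\<in>UNIV. M y l j * S j))"
        proof -
          have "a y j = of_real (\<phi> y) * (cnj (vol_density g y) * S j)" for j
            by (simp add: a_def S_def)
          then show ?thesis
            unfolding sum_distrib_left by (simp add: mult_ac)
        qed
        also have "\<dots> = of_real (\<phi> y) * cnj (vol_density g y) * (\<Sum>l\<in>UNIV. of_real ((cmod (\<gamma> y l))\<^sup>2))"
          unfolding contr sum_distrib_left
          by (intro sum.cong refl) (simp only: complex_norm_square mult_ac)
        finally show "complex_of_real (\<phi> y * r y)
          = (\<Sum>j\<in>UNIV. \<Sum>l\<in>UNIV. M y l j * a y j * cnj (\<gamma> y l)) * vol_density g y"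
          by (simp add: r_def complex_norm_square[of "vol_density g y"] mult_ac flip: of_real_power of_real_sum)
      qed
    qed (use open_V in auto)
    also have "\<dots> = 0"
      by (rule int0[OF a K]) (simp add: a_def \<phi>0)
    finally show "(LINT y:V|lborel. complex_of_real (\<phi> y * r y)) = 0" .
  qed
  then have "(\<Sum>l\<in>UNIV. (cmod (\<gamma> z l))\<^sup>2) = 0"
    using vol_nonzero[OF z] by (simp add: r_def)
  then have "(cmod (\<gamma> z j))\<^sup>2 = 0"
    by (subst (asm) sum_nonneg_eq_0_iff) auto
  then show ?thesis by simp
qed

lemma test_form_01:
  assumes "\<And>j. smooth_on V (\<lambda>y. a y j)" "compact K" "K \<subseteq> V" "\<And>y j. y \<notin> K \<Longrightarrow> a y j = 0"
  shows "test_form V 0 1 (\<lambda>y. form01 (a y))"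
  unfolding test_form_def using assms smooth_form_01[OF open_V]
  by (auto intro!: exI[of _ K] ext simp: form01_def)

lemma test_form_10:
  assumes "\<And>j. smooth_on V (\<lambda>y. a y j)" "compact K" "K \<subseteq> V" "\<And>y j. y \<notin> K \<Longrightarrow> a y j = 0"
  shows "test_form V 1 0 (\<lambda>y. form10 (a y))"
  unfolding test_form_def using assms smooth_form_10[OF open_V]
  by (auto intro!: exI[of _ K] ext simp: form10_def)

lemma set_integrable_pairing:
  assumes "\<And>j. smooth_on V (\<lambda>y. a y j)" "compact K" "K \<subseteq> V" "\<And>y j. y \<notin> K \<Longrightarrow> a y j = 0"
    "\<And>l j. smooth_on V (\<lambda>y. M y l j)" "\<And>j. smooth_on V (\<lambda>y. b y j)"
  shows "set_integrable lborel V
    (\<lambda>y. (\<Sum>j\<in>UNIV. \<Sum>l\<in>UNIV. M y l j * a y j * cnj (b y l)) * vol_density g y)"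
  by (rule set_integrable_test[OF open_V assms(2,3)])
     (auto simp: assms(4) intro!: smooth_on_continuous smooth_on_mult smooth_on_sum smooth_on_cnj
        assms(1,5,6) smooth_vol open_V)

lemma L2_inner_01_unique:
  assumes b: "\<And>j. smooth_on V (\<lambda>y. b y j)" and b': "\<And>j. smooth_on V (\<lambda>y. b' y j)"
    and eq: "\<And>\<alpha>. test_form V 0 1 \<alpha> \<Longrightarrow>
      L2_inner V g 0 1 \<alpha> (\<lambda>y. form01 (b y)) = L2_inner V g 0 1 \<alpha> (\<lambda>y. form01 (b' y))"
    and z: "z \<in> V"
  shows "b z j = b' z j"
proof -
  have "(\<lambda>y j. b y j - b' y j) z j = 0"
  proof (rule pairing_nondegenerate[of "\<lambda>y m j. h_lo g y m j" "\<lambda>y l j. h_up g y l j", OF smooth_h_lo _ _ _ z])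
    show "(\<Sum>j\<in>UNIV. h_up g y l j * h_lo g y m j) = (if l = m then 1 else 0)" if "y \<in> V" for y l m
      using h_inv1[OF that, of m l] by (simp add: mult.commute eq_commute)
    show "smooth_on V (\<lambda>y. b y j - b' y j)" for j
      by (intro smooth_on_diff b b' open_V)
    fix a :: "complex^'n \<Rightarrow> 'n \<Rightarrow> complex" and K
    assume a: "\<And>j. smooth_on V (\<lambda>y. a y j)" and K: "compact K" "K \<subseteq> V" "\<And>y j. y \<notin> K \<Longrightarrow> a y j = 0"
    have "(LINT y:V|lborel. (\<Sum>j\<in>UNIV. \<Sum>l\<in>UNIV. h_up g y l j * a y j * cnj (b y l - b' y l)) * vol_density g y)
      = (LINT y:V|lborel. (\<Sum>j\<in>UNIV. \<Sum>l\<in>UNIV. h_up g y l j * a y j * cnj (b y l)) * vol_density g y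
          - (\<Sum>j\<in>UNIV. \<Sum>l\<in>UNIV. h_up g y l j * a y j * cnj (b' y l)) * vol_density g y)"
      by (simp add: algebra_simps sum_subtractf)
    also have "\<dots> = 0"
    proof -
      have "test_form V 0 1 (\<lambda>y. form01 (a y))"
        by (rule test_form_01[OF a K])
      from eq[OF this, unfolded L2_inner_def form_inner_01 form01_simp]
      show ?thesis
        by (subst set_integral_diff) (auto intro!: set_integrable_pairing[OF a K] smooth_h_up b b')
    qed
    finally show "(LINT y:V|lborel. (\<Sum>j\<in>UNIV. \<Sum>l\<in>UNIV. h_up g y l j * a y j * cnj (b y l - b' y l)) * vol_density g y) = 0" .
  qed
  then show ?thesis by simp
qed

text \<open>\<open>form_inner\<close> contracts a holomorphic index of its first argument with the
  first index of \<open>h_up\<close> and an antiholomorphic one with the second; hence the matrices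
  are transposed compared with type (0,1).\<close>

lemma L2_inner_10_unique:
  assumes b: "\<And>j. smooth_on V (\<lambda>y. b y j)" and b': "\<And>j. smooth_on V (\<lambda>y. b' y j)"
    and eq: "\<And>\<alpha>. test_form V 1 0 \<alpha> \<Longrightarrow>
      L2_inner V g 1 0 \<alpha> (\<lambda>y. form10 (b y)) = L2_inner V g 1 0 \<alpha> (\<lambda>y. form10 (b' y))"
    and z: "z \<in> V"
  shows "b z j = b' z j"
proof -
  have "(\<lambda>y j. b y j - b' y j) z j = 0"
  proof (rule pairing_nondegenerate[of "\<lambda>y m j. h_lo g y j m" "\<lambda>y l j. h_up g y j l", OF smooth_h_lo _ _ _ z])
    show "(\<Sum>j\<in>UNIV. h_up g y j l * h_lo g y j m) = (if l = m then 1 else 0)" if "y \<in> V" for y l m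
      by (rule h_inv2[OF that])
    show "smooth_on V (\<lambda>y. b y j - b' y j)" for j
      by (intro smooth_on_diff b b' open_V)
    fix a :: "complex^'n \<Rightarrow> 'n \<Rightarrow> complex" and K
    assume a: "\<And>j. smooth_on V (\<lambda>y. a y j)" and K: "compact K" "K \<subseteq> V" "\<And>y j. y \<notin> K \<Longrightarrow> a y j = 0"
    have "(LINT y:V|lborel. (\<Sum>j\<in>UNIV. \<Sum>l\<in>UNIV. h_up g y j l * a y j * cnj (b y l - b' y l)) * vol_density g y)
      = (LINT y:V|lborel. (\<Sum>j\<in>UNIV. \<Sum>l\<in>UNIV. h_up g y j l * a y j * cnj (b y l)) * vol_density g y
          - (\<Sum>j\<in>UNIV. \<Sum>l\<in>UNIV. h_up g y j l * a y j * cnj (b' y l)) * vol_density g y)"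
      by (simp add: algebra_simps sum_subtractf)
    also have "\<dots> = 0"
    proof -
      have "test_form V 1 0 (\<lambda>y. form10 (a y))"
        by (rule test_form_10[OF a K])
      from eq[OF this, unfolded L2_inner_def form_inner_10 form10_simp]
      show ?thesis
        by (subst set_integral_diff) (auto intro!: set_integrable_pairing[OF a K] smooth_h_up b b')
    qed
    finally show "(LINT y:V|lborel. (\<Sum>j\<in>UNIV. \<Sum>l\<in>UNIV. h_up g y j l * a y j * cnj (b y l - b' y l)) * vol_density g y) = 0" .
  qed
  then show ?thesis by simp
qed

end

lemma smooth_form_cong:
  assumes "open V" "smooth_form V p q \<alpha>" "\<And>y. y \<in> V \<Longrightarrow> \<alpha> y = \<beta> y"
  shows "smooth_form V p q \<beta>"
  unfolding smooth_form_def
proof (intro conjI ballI allI)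
  fix I J
  have "smooth_on V (\<lambda>y. \<alpha> y I J)" using assms(2) by (simp add: smooth_form_def)
  from smooth_on_cong[OF assms(1) this, of "\<lambda>y. \<beta> y I J"]
  show "smooth_on V (\<lambda>y. \<beta> y I J)" using assms(3) by simp
qed (use assms in \<open>auto simp: smooth_form_def\<close>)

lemma set_integral_sum_test:
  fixes f :: "'i \<Rightarrow> 'b::euclidean_space \<Rightarrow> complex"
  assumes "\<And>i. i \<in> I \<Longrightarrow> set_integrable lborel V (f i)"
  shows "set_integrable lborel V (\<lambda>y. \<Sum>i\<in>I. f i y)"
    and "(LINT y:V|lborel. (\<Sum>i\<in>I. f i y)) = (\<Sum>i\<in>I. LINT y:V|lborel. f i y)"
  using assms unfolding set_integrable_def set_lebesgue_integral_def
  by (simp_all add: scaleR_sum_right)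

section \<open>The formal adjoints of del and delbar applied to omega\<close>

context hermitian_chart
begin

lemma L2_inner_cong:
  assumes "\<And>y. y \<in> V \<Longrightarrow> form_inner g y p q (\<alpha> y) (\<beta> y) = form_inner g y p' q' (\<alpha>' y) (\<beta>' y)"
  shows "L2_inner V g p q \<alpha> \<beta> = L2_inner V g p' q' \<alpha>' \<beta>'"
  unfolding L2_inner_def using open_V assms by (intro set_lebesgue_integral_cong) auto

definition torsion_trace :: "complex^'n \<Rightarrow> 'n \<Rightarrow> complex" where
  "torsion_trace z j = (\<Sum>k\<in>UNIV. torsion g z j k k)"

lemma smooth_torsion_trace: "smooth_on V (\<lambda>y. torsion_trace y j)"
  unfolding torsion_trace_def by (intro smooth_on_sum smooth_torsion open_V)

text \<open>Two copies of the inverse metric meet one h in omega and leave one copy, that is, the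
  trace of A; the scalar is \<open>cnj \<i>\<close>.\<close>

lemma form_inner_11_omega:
  assumes y: "y \<in> V"
  shows "form_inner g y 1 1 A (omega g y) = - \<i> * (\<Sum>i\<in>UNIV. \<Sum>j\<in>UNIV. h_up g y i j * A [i] [j])"
proof -
  have tr: "(\<Sum>k\<in>UNIV. h_up g y i k * (\<Sum>l\<in>UNIV. h_up g y l j * h_lo g y l k)) = h_up g y i j" for i j
    by (simp add: h_inv2[OF y] if_distrib[of "\<lambda>c. _ * c"] cong: if_cong)
  have "form_inner g y 1 1 A (omega g y) = (\<Sum>i\<in>UNIV. \<Sum>j\<in>UNIV. \<Sum>k\<in>UNIV. \<Sum>l\<in>UNIV.
      h_up g y i k * h_up g y l j * A [i] [j] * cnj (\<i> * h_lo g y k l))"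
    unfolding form_inner_11 by (subst (2) sum.swap) (simp add: omega_def)
  also have "\<dots> = (\<Sum>i\<in>UNIV. \<Sum>j\<in>UNIV. - \<i> * A [i] [j]
      * (\<Sum>k\<in>UNIV. h_up g y i k * (\<Sum>l\<in>UNIV. h_up g y l j * h_lo g y l k)))"
    by (simp add: h_lo_cnj[OF y] sum_distrib_left mult_ac)
  finally show ?thesis
    unfolding tr by (simp add: sum_distrib_left sum_negf mult_ac)
qed

lemma smooth_density: "smooth_on V (\<lambda>y. h_up g y i j * vol_density g y)"
  by (intro smooth_on_mult smooth_h_up smooth_vol open_V)

lemma cdir_density:
  assumes y: "y \<in> V"
  shows "cdir X (\<lambda>y. h_up g y i j * vol_density g y) y =
    (\<Sum>k\<in>UNIV. \<Sum>l\<in>UNIV. h_up g y i j * h_up g y k l * cdir X (\<lambda>y. h_lo g y k l) y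
      - h_up g y i l * h_up g y k j * cdir X (\<lambda>y. h_lo g y k l) y) * vol_density g y"
  unfolding cdir_mult[OF y smooth_h_up smooth_vol] cdir_h_up[OF y] cdir_vol[OF y]
  by (simp add: sum_distrib_left sum_distrib_right sum_subtractf algebra_simps)

text \<open>The volume density contributes the trace of the derivatives of h, the inverse metric the
  same expression with i and k exchanged under the derivative and the opposite sign. Their
  difference is the trace of the torsion.\<close>

lemma divergence_ddz:
  assumes y: "y \<in> V"
  shows "(\<Sum>i\<in>UNIV. cdir (ddz i) (\<lambda>y. h_up g y i j * vol_density g y) y)
    = (\<Sum>i\<in>UNIV. h_up g y i j * torsion_trace y i) * vol_density g y"
proof -
  have swap: "(\<Sum>i\<in>UNIV. \<Sum>k\<in>UNIV. \<Sum>l\<in>UNIV. h_up g y i l * h_up g y k j * cdir (ddz i) (\<lambda>y. h_lo g y k l) y)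
    = (\<Sum>i\<in>UNIV. \<Sum>k\<in>UNIV. \<Sum>l\<in>UNIV. h_up g y i j * h_up g y k l * cdir (ddz k) (\<lambda>y. h_lo g y i l) y)"
    by (subst sum.swap) (simp add: mult_ac)
  show ?thesis
    unfolding cdir_density[OF y] sum_distrib_right[symmetric]
    by (simp add: sum_subtractf swap[unfolded mult.assoc] torsion_trace_def torsion_raise torsion_lo_def
        sum_distrib_left right_diff_distrib mult.assoc)
qed

lemma divergence_ddzbar:
  assumes y: "y \<in> V"
  shows "(\<Sum>j\<in>UNIV. cdir (ddzbar j) (\<lambda>y. h_up g y i j * vol_density g y) y)
    = (\<Sum>j\<in>UNIV. h_up g y i j * cnj (torsion_trace y j)) * vol_density g y"
proof -
  have tr: "cnj (torsion_trace y j) = (\<Sum>k\<in>UNIV. \<Sum>l\<in>UNIV. h_up g y k l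
      * (cdir (ddzbar j) (\<lambda>y. h_lo g y k l) y - cdir (ddzbar l) (\<lambda>y. h_lo g y k j) y))" for j
    unfolding torsion_trace_def torsion_raise cnj_sum
    by (subst sum.swap) (simp add: h_up_cnj[OF y] torsion_lo_cnj[OF y])
  have swap: "(\<Sum>j\<in>UNIV. \<Sum>k\<in>UNIV. \<Sum>l\<in>UNIV. h_up g y i l * h_up g y k j * cdir (ddzbar j) (\<lambda>y. h_lo g y k l) y)
    = (\<Sum>j\<in>UNIV. \<Sum>k\<in>UNIV. \<Sum>l\<in>UNIV. h_up g y i j * h_up g y k l * cdir (ddzbar l) (\<lambda>y. h_lo g y k j) y)"
  proof -
    have "(\<Sum>j\<in>UNIV. \<Sum>k\<in>UNIV. \<Sum>l\<in>UNIV. f j k l) = (\<Sum>l\<in>UNIV. \<Sum>k\<in>UNIV. \<Sum>j\<in>UNIV. f j k l)"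
      for f :: "'n \<Rightarrow> 'n \<Rightarrow> 'n \<Rightarrow> complex"
      by (subst sum.swap, subst (2) sum.swap, subst sum.swap) (rule refl)
    then show ?thesis by simp
  qed
  show ?thesis
    unfolding cdir_density[OF y] sum_distrib_right[symmetric] tr
    by (simp add: sum_subtractf swap[unfolded mult.assoc] sum_distrib_left right_diff_distrib mult.assoc)
qed

text \<open>Integration by parts: the two integrands differ by a divergence.\<close>

lemma del_star_omega_adjoint:
  assumes "test_form V 0 1 \<alpha>"
  shows "L2_inner V g (Suc 0) 1 (del \<alpha>) (omega g)
    = L2_inner V g 0 1 \<alpha> (\<lambda>y. form01 (\<lambda>j. - \<i> * cnj (torsion_trace y j)))"
proof -
  define a where "a j y = \<alpha> y [] [j]" for j y
  have a: "smooth_on V (a j)" for j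
    using assms by (simp add: test_form_def smooth_form_def a_def[abs_def])
  obtain K where K: "compact K" "K \<subseteq> V" and a0: "\<And>y j. y \<notin> K \<Longrightarrow> a j y = 0"
    using assms unfolding test_form_def a_def by (metis (no_types))
  \<comment> \<open>Up to the scalar this is the field obtained by raising the index of \<alpha>,
    times the volume density. Its divergence is the difference of the two integrands to be
    compared.\<close>
  define F where "F i y = - \<i> * (\<Sum>j\<in>UNIV. h_up g y i j * vol_density g y * a j y)" for i y
  define B where "B y = (\<Sum>j\<in>UNIV. \<Sum>l\<in>UNIV. h_up g y l j * a j y * (\<i> * torsion_trace y l)) * vol_density g y" for y
  have sF': "smooth_on V (\<lambda>y. \<Sum>j\<in>UNIV. h_up g y i j * vol_density g y * a j y)" for i
    by (intro smooth_on_sum smooth_on_mult a smooth_h_up smooth_vol open_V)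
  have sF: "smooth_on V (F i)" for i
    unfolding F_def[abs_def] by (intro smooth_on_mult smooth_on_const sF' open_V)
  have F0: "F i y = 0" if "y \<notin> K" for i y
    using a0[OF that] by (simp add: F_def)
  have dF: "(\<Sum>i\<in>UNIV. cdir (ddz i) (F i) y) + B y
      = - \<i> * (\<Sum>i\<in>UNIV. \<Sum>j\<in>UNIV. h_up g y i j * cdir (ddz i) (a j) y) * vol_density g y"
    if y: "y \<in> V" for y
  proof -
    have s: "smooth_on V (\<lambda>y. h_up g y i j * vol_density g y * a j y)" for i j
      by (intro smooth_on_mult a smooth_h_up smooth_vol open_V)
    have "cdir (ddz i) (F i) y = - \<i> * (\<Sum>j\<in>UNIV. h_up g y i j * vol_density g y * cdir (ddz i) (a j) y)
        - \<i> * (\<Sum>j\<in>UNIV. cdir (ddz i) (\<lambda>y. h_up g y i j * vol_density g y) y * a j y)" for i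
      unfolding F_def[abs_def] cdir_cmult[OF y sF'] cdir_sum[OF y s] cdir_mult[OF y smooth_density a]
      by (simp add: sum.distrib algebra_simps)
    then have "(\<Sum>i\<in>UNIV. cdir (ddz i) (F i) y)
      = - \<i> * (\<Sum>i\<in>UNIV. \<Sum>j\<in>UNIV. h_up g y i j * vol_density g y * cdir (ddz i) (a j) y)
        - \<i> * (\<Sum>i\<in>UNIV. \<Sum>j\<in>UNIV. cdir (ddz i) (\<lambda>y. h_up g y i j * vol_density g y) y * a j y)"
      by (simp add: sum_subtractf sum_distrib_left sum_negf)
    also have "(\<Sum>i\<in>UNIV. \<Sum>j\<in>UNIV. cdir (ddz i) (\<lambda>y. h_up g y i j * vol_density g y) y * a j y)
      = (\<Sum>j\<in>UNIV. (\<Sum>i\<in>UNIV. cdir (ddz i) (\<lambda>y. h_up g y i j * vol_density g y) y) * a j y)"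
      unfolding sum_distrib_right by (rule sum.swap)
    finally show ?thesis
      unfolding divergence_ddz[OF y] B_def
      by (simp add: sum_distrib_left sum_distrib_right mult_ac)
  qed
  have cdirF0: "cdir (ddz i) (F i) y = 0" if "y \<notin> K" for i y
  proof -
    have "(F i has_derivative (\<lambda>_. 0)) (at y)"
      by (rule frechet_derivative_test[OF open_V K _ that]) (rule F0)
    from cdir_has_derivative[OF this] show ?thesis by simp
  qed
  have int: "set_integrable lborel V (cdir (ddz i) (F i))" for i
    by (rule set_integrable_test[OF open_V K cdirF0 smooth_on_continuous[OF smooth_on_cdir[OF open_V sF]]])
  have "smooth_on V B"
    unfolding B_def[abs_def]
    by (intro smooth_on_mult smooth_on_sum smooth_on_const a smooth_h_up smooth_vol smooth_torsion_trace open_V)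
  then have intB: "set_integrable lborel V B"
    by (intro set_integrable_test[OF open_V K] smooth_on_continuous) (simp_all add: B_def a0)
  have "L2_inner V g (Suc 0) 1 (del \<alpha>) (omega g) = (LINT y:V|lborel. (\<Sum>i\<in>UNIV. cdir (ddz i) (F i) y) + B y)"
    unfolding L2_inner_def
    using open_V form_inner_11_omega dF
    by (intro set_lebesgue_integral_cong) (auto simp: del_def del_nth_def a_def[abs_def])
  also have "\<dots> = (LINT y:V|lborel. (\<Sum>i\<in>UNIV. cdir (ddz i) (F i) y)) + (LINT y:V|lborel. B y)"
    by (intro set_integral_add set_integral_sum_test int intB)
  also have "(LINT y:V|lborel. (\<Sum>i\<in>UNIV. cdir (ddz i) (F i) y)) = (\<Sum>i\<in>UNIV. LINT y:V|lborel. cdir (ddz i) (F i) y)"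
    by (intro set_integral_sum_test int)
  also have "\<dots> = 0"
    using set_integral_cdir_eq_0[OF open_V K F0 sF] by simp
  also have "(LINT y:V|lborel. B y)
    = L2_inner V g 0 1 \<alpha> (\<lambda>y. form01 (\<lambda>j. - \<i> * cnj (torsion_trace y j)))"
    unfolding L2_inner_def form_inner_01 B_def a_def by simp
  finally show ?thesis by simp
qed

lemma delbar_star_omega_adjoint:
  assumes "test_form V 1 0 \<alpha>"
  shows "L2_inner V g 1 (Suc 0) (delbar \<alpha>) (omega g)
    = L2_inner V g 1 0 \<alpha> (\<lambda>y. form10 (\<lambda>j. \<i> * torsion_trace y j))"
proof -
  define a where "a i y = \<alpha> y [i] []" for i y
  have a: "smooth_on V (a i)" for i
    using assms by (simp add: test_form_def smooth_form_def a_def[abs_def])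
  obtain K where K: "compact K" "K \<subseteq> V" and a0: "\<And>y j. y \<notin> K \<Longrightarrow> a j y = 0"
    using assms unfolding test_form_def a_def by (metis (no_types))
  \<comment> \<open>The scalar is now \<open>\<i>\<close>, because \<open>delbar\<close> of a
    (1,0)-form carries the sign of moving the conjugate differential past one holomorphic
    one.\<close>
  define F where "F j y = \<i> * (\<Sum>i\<in>UNIV. h_up g y i j * vol_density g y * a i y)" for j y
  define B where "B y = (\<Sum>i\<in>UNIV. \<Sum>k\<in>UNIV. h_up g y i k * a i y * cnj (\<i> * torsion_trace y k)) * vol_density g y" for y
  have sF': "smooth_on V (\<lambda>y. \<Sum>i\<in>UNIV. h_up g y i j * vol_density g y * a i y)" for j
    by (intro smooth_on_sum smooth_on_mult a smooth_h_up smooth_vol open_V)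
  have sF: "smooth_on V (F j)" for j
    unfolding F_def[abs_def] by (intro smooth_on_mult smooth_on_const sF' open_V)
  have F0: "F j y = 0" if "y \<notin> K" for j y
    using a0[OF that] by (simp add: F_def)
  have dF: "(\<Sum>j\<in>UNIV. cdir (ddzbar j) (F j) y) + B y
      = - \<i> * (\<Sum>i\<in>UNIV. \<Sum>j\<in>UNIV. h_up g y i j * - cdir (ddzbar j) (a i) y) * vol_density g y"
    if y: "y \<in> V" for y
  proof -
    have s: "smooth_on V (\<lambda>y. h_up g y i j * vol_density g y * a i y)" for i j
      by (intro smooth_on_mult a smooth_h_up smooth_vol open_V)
    have "cdir (ddzbar j) (F j) y = \<i> * (\<Sum>i\<in>UNIV. h_up g y i j * vol_density g y * cdir (ddzbar j) (a i) y)
        + \<i> * (\<Sum>i\<in>UNIV. cdir (ddzbar j) (\<lambda>y. h_up g y i j * vol_density g y) y * a i y)" for j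
      unfolding F_def[abs_def] cdir_cmult[OF y sF'] cdir_sum[OF y s] cdir_mult[OF y smooth_density a]
      by (simp add: sum.distrib algebra_simps)
    then have "(\<Sum>j\<in>UNIV. cdir (ddzbar j) (F j) y)
      = \<i> * (\<Sum>j\<in>UNIV. \<Sum>i\<in>UNIV. h_up g y i j * vol_density g y * cdir (ddzbar j) (a i) y)
        + \<i> * (\<Sum>j\<in>UNIV. \<Sum>i\<in>UNIV. cdir (ddzbar j) (\<lambda>y. h_up g y i j * vol_density g y) y * a i y)"
      by (simp add: sum.distrib sum_distrib_left)
    also have "(\<Sum>j\<in>UNIV. \<Sum>i\<in>UNIV. cdir (ddzbar j) (\<lambda>y. h_up g y i j * vol_density g y) y * a i y)
      = (\<Sum>i\<in>UNIV. (\<Sum>j\<in>UNIV. cdir (ddzbar j) (\<lambda>y. h_up g y i j * vol_density g y) y) * a i y)"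
      unfolding sum_distrib_right by (rule sum.swap)
    also have "(\<Sum>j\<in>UNIV. \<Sum>i\<in>UNIV. h_up g y i j * vol_density g y * cdir (ddzbar j) (a i) y)
      = (\<Sum>i\<in>UNIV. \<Sum>j\<in>UNIV. h_up g y i j * vol_density g y * cdir (ddzbar j) (a i) y)"
      by (rule sum.swap)
    finally show ?thesis
      unfolding divergence_ddzbar[OF y] B_def
      by (simp add: sum_distrib_left sum_distrib_right sum_negf mult_ac)
  qed
  have cdirF0: "cdir (ddzbar j) (F j) y = 0" if "y \<notin> K" for j y
  proof -
    have "(F j has_derivative (\<lambda>_. 0)) (at y)"
      by (rule frechet_derivative_test[OF open_V K _ that]) (rule F0)
    from cdir_has_derivative[OF this] show ?thesis by simp
  qed
  have int: "set_integrable lborel V (cdir (ddzbar j) (F j))" for j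
    by (rule set_integrable_test[OF open_V K cdirF0 smooth_on_continuous[OF smooth_on_cdir[OF open_V sF]]])
  have "smooth_on V B"
    unfolding B_def[abs_def]
    by (intro smooth_on_mult smooth_on_sum smooth_on_const smooth_on_cnj a smooth_h_up smooth_vol
        smooth_torsion_trace open_V)
  then have intB: "set_integrable lborel V B"
    by (intro set_integrable_test[OF open_V K] smooth_on_continuous) (simp_all add: B_def a0)
  have "L2_inner V g 1 (Suc 0) (delbar \<alpha>) (omega g) = (LINT y:V|lborel. (\<Sum>j\<in>UNIV. cdir (ddzbar j) (F j) y) + B y)"
    unfolding L2_inner_def
    using open_V form_inner_11_omega dF
    by (intro set_lebesgue_integral_cong) (auto simp: delbar_def del_nth_def a_def[abs_def])
  also have "\<dots> = (LINT y:V|lborel. (\<Sum>j\<in>UNIV. cdir (ddzbar j) (F j) y)) + (LINT y:V|lborel. B y)"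
    by (intro set_integral_add set_integral_sum_test int intB)
  also have "(LINT y:V|lborel. (\<Sum>j\<in>UNIV. cdir (ddzbar j) (F j) y)) = (\<Sum>j\<in>UNIV. LINT y:V|lborel. cdir (ddzbar j) (F j) y)"
    by (intro set_integral_sum_test int)
  also have "\<dots> = 0"
    using set_integral_cdir_eq_0[OF open_V K F0 sF] by simp
  also have "(LINT y:V|lborel. B y) = L2_inner V g 1 0 \<alpha> (\<lambda>y. form10 (\<lambda>j. \<i> * torsion_trace y j))"
    unfolding L2_inner_def form_inner_10 B_def a_def by simp
  finally show ?thesis by simp
qed

text \<open>Integration by parts shows that the candidate is an adjoint. Any other one agrees with
  it on V by \<open>L2_inner_01_unique\<close> and outside V by the normalization in
  \<open>del_star\<close>, so the description denotes it.\<close>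

lemma del_star_omega:
  assumes z: "z \<in> V"
  shows "del_star V g 0 1 (omega g) z = form01 (\<lambda>j. - \<i> * cnj (torsion_trace z j))"
proof -
  define b where "b y = (\<lambda>j. - \<i> * cnj (torsion_trace y j))" for y
  \<comment> \<open>The values outside V must be set to 0, since \<open>del_star\<close> asks for a
    function on the whole space that vanishes there.\<close>
  define \<beta> where "\<beta> y = (if y \<in> V then form01 (b y) else (\<lambda>I J. 0))" for y
  have b: "smooth_on V (\<lambda>y. b y j)" for j
    unfolding b_def by (intro smooth_on_mult smooth_on_const smooth_on_cnj smooth_torsion_trace open_V)
  have adj: "L2_inner V g (Suc 0) 1 (del \<alpha>) (omega g) = L2_inner V g 0 1 \<alpha> (\<lambda>y. form01 (b y))"
    if "test_form V 0 1 \<alpha>" for \<alpha>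
    using del_star_omega_adjoint[OF that] by (simp add: b_def)
  have "del_star V g 0 1 (omega g) = \<beta>"
    unfolding del_star_def
  proof (rule the_equality, intro conjI allI impI)
    show "smooth_form V 0 1 \<beta>"
      by (rule smooth_form_cong[OF open_V smooth_form_01[OF open_V b]]) (simp add: \<beta>_def)
    show "\<beta> y = (\<lambda>I J. 0)" if "y \<notin> V" for y using that by (simp add: \<beta>_def)
    show "L2_inner V g (Suc 0) 1 (del \<alpha>) (omega g) = L2_inner V g 0 1 \<alpha> \<beta>" if "test_form V 0 1 \<alpha>" for \<alpha>
      unfolding adj[OF that] by (rule L2_inner_cong) (simp add: \<beta>_def)
  next
    fix \<beta>'
    assume *: "smooth_form V 0 1 \<beta>' \<and> (\<forall>y. y \<notin> V \<longrightarrow> \<beta>' y = (\<lambda>I J. 0)) \<and>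
      (\<forall>\<alpha>. test_form V 0 1 \<alpha> \<longrightarrow> L2_inner V g (Suc 0) 1 (del \<alpha>) (omega g) = L2_inner V g 0 1 \<alpha> \<beta>')"
    define b' where "b' y j = \<beta>' y [] [j]" for y j
    have b': "smooth_on V (\<lambda>y. b' y j)" for j
      using * by (simp add: smooth_form_def b'_def)
    have \<beta>': "\<beta>' y = form01 (b' y)" if y: "y \<in> V" for y
    proof -
      from * y obtain c where "\<beta>' y = form01 c"
        unfolding smooth_form_def pq_form_01 by blast
      then show ?thesis by (simp add: b'_def[abs_def])
    qed
    have "b' y j = b y j" if "y \<in> V" for y j
    proof (rule L2_inner_01_unique[OF b' b _ that])
      fix \<alpha> assume "test_form V 0 1 \<alpha>"
      moreover have "L2_inner V g 0 1 \<alpha> (\<lambda>y. form01 (b' y)) = L2_inner V g 0 1 \<alpha> \<beta>'"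
        by (rule L2_inner_cong) (simp add: \<beta>')
      ultimately show "L2_inner V g 0 1 \<alpha> (\<lambda>y. form01 (b' y)) = L2_inner V g 0 1 \<alpha> (\<lambda>y. form01 (b y))"
        using * adj by metis
    qed
    then have "b' y = b y" if "y \<in> V" for y using that by blast
    then show "\<beta>' = \<beta>"
      using \<beta>' * by (auto simp: \<beta>_def)
  qed
  then show ?thesis using z by (simp add: \<beta>_def b_def)
qed

lemma delbar_star_omega:
  assumes z: "z \<in> V"
  shows "delbar_star V g 1 0 (omega g) z = form10 (\<lambda>j. \<i> * torsion_trace z j)"
proof -
  define b where "b y = (\<lambda>j. \<i> * torsion_trace y j)" for y
  define \<beta> where "\<beta> y = (if y \<in> V then form10 (b y) else (\<lambda>I J. 0))" for y
  have b: "smooth_on V (\<lambda>y. b y j)" for j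
    unfolding b_def by (intro smooth_on_mult smooth_on_const smooth_torsion_trace open_V)
  have adj: "L2_inner V g 1 (Suc 0) (delbar \<alpha>) (omega g) = L2_inner V g 1 0 \<alpha> (\<lambda>y. form10 (b y))"
    if "test_form V 1 0 \<alpha>" for \<alpha>
    using delbar_star_omega_adjoint[OF that] by (simp add: b_def)
  have "delbar_star V g 1 0 (omega g) = \<beta>"
    unfolding delbar_star_def
  proof (rule the_equality, intro conjI allI impI)
    show "smooth_form V 1 0 \<beta>"
      by (rule smooth_form_cong[OF open_V smooth_form_10[OF open_V b]]) (simp add: \<beta>_def)
    show "\<beta> y = (\<lambda>I J. 0)" if "y \<notin> V" for y using that by (simp add: \<beta>_def)
    show "L2_inner V g 1 (Suc 0) (delbar \<alpha>) (omega g) = L2_inner V g 1 0 \<alpha> \<beta>" if "test_form V 1 0 \<alpha>" for \<alpha>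
      unfolding adj[OF that] by (rule L2_inner_cong) (simp add: \<beta>_def)
  next
    fix \<beta>'
    assume *: "smooth_form V 1 0 \<beta>' \<and> (\<forall>y. y \<notin> V \<longrightarrow> \<beta>' y = (\<lambda>I J. 0)) \<and>
      (\<forall>\<alpha>. test_form V 1 0 \<alpha> \<longrightarrow> L2_inner V g 1 (Suc 0) (delbar \<alpha>) (omega g) = L2_inner V g 1 0 \<alpha> \<beta>')"
    define b' where "b' y j = \<beta>' y [j] []" for y j
    have b': "smooth_on V (\<lambda>y. b' y j)" for j
      using * by (simp add: smooth_form_def b'_def)
    have \<beta>': "\<beta>' y = form10 (b' y)" if y: "y \<in> V" for y
    proof -
      from * y obtain c where "\<beta>' y = form10 c"
        unfolding smooth_form_def pq_form_10 by blast
      then show ?thesis by (simp add: b'_def[abs_def])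
    qed
    have "b' y j = b y j" if "y \<in> V" for y j
    proof (rule L2_inner_10_unique[OF b' b _ that])
      fix \<alpha> assume "test_form V 1 0 \<alpha>"
      moreover have "L2_inner V g 1 0 \<alpha> (\<lambda>y. form10 (b' y)) = L2_inner V g 1 0 \<alpha> \<beta>'"
        by (rule L2_inner_cong) (simp add: \<beta>')
      ultimately show "L2_inner V g 1 0 \<alpha> (\<lambda>y. form10 (b' y)) = L2_inner V g 1 0 \<alpha> (\<lambda>y. form10 (b y))"
        using * adj by metis
    qed
    then have "b' y = b y" if "y \<in> V" for y using that by blast
    then show "\<beta>' = \<beta>"
      using \<beta>' * by (auto simp: \<beta>_def)
  qed
  then show ?thesis using z by (simp add: \<beta>_def b_def)
qed

end

subsection \<open>The contraction with the fundamental form\<close>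

definition form11 :: "('n \<Rightarrow> 'n \<Rightarrow> complex) \<Rightarrow> 'n cform" where
  "form11 a I J = (if length I = 1 \<and> length J = 1 then a (hd I) (hd J) else 0)"

lemma form11_simp [simp]: "form11 a [i] [j] = a i j"
  by (simp add: form11_def)

lemma pq_form_11: "pq_form 1 1 \<alpha> \<longleftrightarrow> (\<exists>a. \<alpha> = form11 a)"
proof
  assume *: "pq_form 1 1 \<alpha>"
  have "\<alpha> I J = form11 (\<lambda>i j. \<alpha> [i] [j]) I J" for I J
    using * by (cases "length I = 1 \<and> length J = 1") (auto simp: pq_form_def form11_def length_Suc_conv)
  then show "\<exists>a. \<alpha> = form11 a" by blast
next
  assume "\<exists>a. \<alpha> = form11 a"
  then show "pq_form 1 1 \<alpha>" by (auto simp: pq_form_def form11_def swap_nth_def)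
qed

lemma sum_rotate: "(\<Sum>i\<in>A. \<Sum>j\<in>B. \<Sum>k\<in>C. f i j k) = (\<Sum>j\<in>B. \<Sum>k\<in>C. \<Sum>i\<in>A. f i j k)"
  by (subst sum.swap) (intro sum.cong refl sum.swap)

lemma sum_swap2: "(\<Sum>i\<in>A. \<Sum>j\<in>B. \<Sum>k\<in>C. \<Sum>l\<in>D. f i j k l) = (\<Sum>k\<in>C. \<Sum>l\<in>D. \<Sum>i\<in>A. \<Sum>j\<in>B. f i j k l)"
proof -
  have "(\<Sum>i\<in>A. \<Sum>j\<in>B. \<Sum>k\<in>C. \<Sum>l\<in>D. f i j k l) = (\<Sum>i\<in>A. \<Sum>k\<in>C. \<Sum>l\<in>D. \<Sum>j\<in>B. f i j k l)"
    by (rule sum.cong[OF refl], rule sum_rotate)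
  then show ?thesis by (rule trans[OF _ sum_rotate])
qed

lemma sum_pair: "(\<Sum>P\<in>UNIV. f P) = (\<Sum>a\<in>UNIV. \<Sum>b\<in>UNIV. f (a, b))"
  for f :: "'a::finite \<times> 'b::finite \<Rightarrow> complex"
  by (simp add: sum.cartesian_product)

lemma sum_pair_swap: "(\<Sum>P\<in>UNIV. f (prod.swap P)) = (\<Sum>P\<in>UNIV. f P)"
  for f :: "'a::finite \<times> 'a \<Rightarrow> complex"
  by (rule sum.reindex_bij_betw[of prod.swap]) (simp add: bij_swap)

text \<open>With pairs as index set, exchanging two arguments of a form is the bijection
  \<open>prod.swap\<close>, and antisymmetry can be used as a change of summation variable.\<close>

definition pair_list :: "'a \<times> 'a \<Rightarrow> 'a list" where
  "pair_list P = [fst P, snd P]"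

lemma form_inner_22:
  "form_inner g z (Suc 1) (Suc 1) \<alpha> \<beta> = (\<Sum>I\<in>UNIV. \<Sum>K\<in>UNIV. \<Sum>J\<in>UNIV. \<Sum>L\<in>UNIV.
     (h_up g z (fst I) (fst K) * h_up g z (snd I) (snd K)) * (h_up g z (fst L) (fst J) * h_up g z (snd L) (snd J))
     * \<alpha> (pair_list I) (pair_list J) * cnj (\<beta> (pair_list K) (pair_list L))) / 4"
  by (simp add: form_inner_def sum_length sum_pair pair_list_def del: length_0_conv)

lemma form_inner_21:
  "form_inner g z 2 1 \<alpha> \<beta> = (\<Sum>a\<in>UNIV. \<Sum>b\<in>UNIV. \<Sum>c\<in>UNIV. \<Sum>d\<in>UNIV. \<Sum>j\<in>UNIV. \<Sum>l\<in>UNIV.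
     h_up g z a c * h_up g z b d * h_up g z l j * \<alpha> [a, b] [j] * cnj (\<beta> [c, d] [l])) / 2"
  by (simp add: form_inner_def sum_length numeral_2_eq_2 del: length_0_conv)

lemma omega_wedge_22:
  "omega_wedge g z \<alpha> [i, i'] [j, j'] = - \<i> * (h_lo g z i j * \<alpha> [i'] [j'] - h_lo g z i j' * \<alpha> [i'] [j]
     - h_lo g z i' j * \<alpha> [i] [j'] + h_lo g z i' j' * \<alpha> [i] [j])"
  by (simp add: omega_wedge_def omega_def del_nth_def algebra_simps)

context hermitian_chart
begin

lemma form_inner_11_nondegenerate:
  assumes z: "z \<in> V" and "\<And>\<alpha>. pq_form 1 1 \<alpha> \<Longrightarrow> form_inner g z 1 1 \<alpha> (form11 b) = form_inner g z 1 1 \<alpha> (form11 b')"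
  shows "b = b'"
proof (intro ext)
  fix m n
  \<comment> \<open>This product of two columns of h cancels both inverse metrics in the pairing and
    picks out a single coefficient.\<close>
  have "form_inner g z 1 1 (form11 (\<lambda>i j. h_lo g z i m * h_lo g z n j)) (form11 c) = cnj (c m n)" for c
  proof -
    have "form_inner g z 1 1 (form11 (\<lambda>i j. h_lo g z i m * h_lo g z n j)) (form11 c)
      = (\<Sum>k\<in>UNIV. \<Sum>i\<in>UNIV. \<Sum>l\<in>UNIV. \<Sum>j\<in>UNIV.
          h_up g z i k * h_up g z l j * (h_lo g z i m * h_lo g z n j) * cnj (c k l))"
      unfolding form_inner_11 form11_simp
      by (subst sum.swap) (intro sum.cong refl sum.swap)
    also have "\<dots> = (\<Sum>k\<in>UNIV. \<Sum>l\<in>UNIV. (\<Sum>i\<in>UNIV. h_up g z i k * h_lo g z i m)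
        * (\<Sum>j\<in>UNIV. h_lo g z n j * h_up g z l j) * cnj (c k l))"
      unfolding sum_distrib_left sum_distrib_right
      by (rule sum.cong[OF refl], subst sum_rotate) (simp add: mult_ac)
    also have "\<dots> = cnj (c m n)"
      unfolding h_inv[OF z] by (simp add: if_distrib[of "\<lambda>c. c * _"] if_distrib[of "\<lambda>c. _ * c"] cong: if_cong)
    finally show ?thesis .
  qed
  then have "cnj (b m n) = cnj (b' m n)"
    using assms(2) pq_form_11 by metis
  then show "b m n = b' m n" by simp
qed

text \<open>The four terms of omega wedge \<alpha> are one product with the holomorphic pair, the
  antiholomorphic pair, both or neither exchanged. As \<eta> is antisymmetric they contribute
  equally, which cancels the 1/4 in \<open>form_inner_22\<close>.\<close>

lemma Lambda_11:
  assumes z: "z \<in> V"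
    and skew: "\<And>a b J. \<eta> [a, b] J = - \<eta> [b, a] J" "\<And>a b I. \<eta> I [a, b] = - \<eta> I [b, a]"
  shows "Lambda g 1 1 z \<eta>
    = form11 (\<lambda>k l. \<i> * (\<Sum>p\<in>UNIV. \<Sum>q\<in>UNIV. h_up g z p q * \<eta> [p, k] [q, l]))"
proof -
  define b where "b = (\<lambda>k l. \<i> * (\<Sum>p\<in>UNIV. \<Sum>q\<in>UNIV. h_up g z p q * \<eta> [p, k] [q, l]))"
  have adj: "form_inner g z (Suc 1) (Suc 1) (omega_wedge g z \<alpha>) \<eta> = form_inner g z 1 1 \<alpha> (form11 b)" for \<alpha>
  proof -
    let ?hh = "\<lambda>P Q. h_up g z (fst P) (fst Q) * h_up g z (snd P) (snd Q)"
    let ?e = "\<lambda>K L. cnj (\<eta> (pair_list K) (pair_list L))"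
    define H where "H I J = h_lo g z (fst I) (fst J) * \<alpha> [snd I] [snd J]" for I J
    \<comment> \<open>The conjugate of \<eta> with all indices raised; it inherits both
      antisymmetries.\<close>
    define U where "U I J = (\<Sum>K\<in>UNIV. \<Sum>L\<in>UNIV. ?hh I K * ?hh L J * ?e K L)" for I J
    have U1: "U (prod.swap I) J = - U I J" for I J
    proof -
      have "U (prod.swap I) J = (\<Sum>K\<in>UNIV. \<Sum>L\<in>UNIV. ?hh (prod.swap I) (prod.swap K) * ?hh L J * ?e (prod.swap K) L)"
        unfolding U_def by (rule sum_pair_swap[symmetric])
      also have "\<dots> = - U I J"
        unfolding U_def sum_negf[symmetric]
        by (intro sum.cong refl) (simp add: pair_list_def skew(1)[of "snd _" "fst _"] mult_ac)
      finally show ?thesis .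
    qed
    have U2: "U I (prod.swap J) = - U I J" for I J
    proof -
      have "U I (prod.swap J) = (\<Sum>K\<in>UNIV. \<Sum>L\<in>UNIV. ?hh I K * ?hh (prod.swap L) (prod.swap J) * ?e K (prod.swap L))"
        unfolding U_def by (intro sum.cong refl sum_pair_swap[symmetric])
      also have "\<dots> = - U I J"
        unfolding U_def sum_negf[symmetric]
        by (intro sum.cong refl) (simp add: pair_list_def skew(2)[of _ "snd _" "fst _"] mult_ac)
      finally show ?thesis .
    qed
    have sw2: "(\<Sum>I\<in>UNIV. \<Sum>J\<in>UNIV. H I (prod.swap J) * U I J) = - (\<Sum>I\<in>UNIV. \<Sum>J\<in>UNIV. H I J * U I J)"
    proof -
      have "(\<Sum>J\<in>UNIV. H I (prod.swap J) * U I J) = (\<Sum>J\<in>UNIV. H I J * U I (prod.swap J))" for I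
        using sum_pair_swap[of "\<lambda>J. H I (prod.swap J) * U I J"] by simp
      then show ?thesis by (simp add: U2 sum_negf)
    qed
    have sw1: "(\<Sum>I\<in>UNIV. \<Sum>J\<in>UNIV. H (prod.swap I) (f J) * U I J) = - (\<Sum>I\<in>UNIV. \<Sum>J\<in>UNIV. H I (f J) * U I J)" for f
    proof -
      have "(\<Sum>I\<in>UNIV. \<Sum>J\<in>UNIV. H (prod.swap I) (f J) * U I J) = (\<Sum>I\<in>UNIV. \<Sum>J\<in>UNIV. H I (f J) * U (prod.swap I) J)"
        using sum_pair_swap[of "\<lambda>I. \<Sum>J\<in>UNIV. H (prod.swap I) (f J) * U I J"] by simp
      then show ?thesis by (simp add: U1 sum_negf)
    qed
    \<comment> \<open>The first indices of H carry the metric itself, so contracting them leaves one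
      inverse metric, the one that takes the trace of \<eta>; the second indices carry
      \<alpha>.\<close>
    have contr: "(\<Sum>I\<in>UNIV. \<Sum>J\<in>UNIV. ?hh I K * ?hh L J * H I J)
      = h_up g z (fst L) (fst K) * (\<Sum>i\<in>UNIV. \<Sum>j\<in>UNIV. h_up g z i (snd K) * h_up g z (snd L) j * \<alpha> [i] [j])"
      for K L
    proof -
      have tr: "(\<Sum>i\<in>UNIV. \<Sum>j\<in>UNIV. h_up g z i (fst K) * h_up g z (fst L) j * h_lo g z i j) = h_up g z (fst L) (fst K)"
      proof -
        have "(\<Sum>i\<in>UNIV. \<Sum>j\<in>UNIV. h_up g z i (fst K) * h_up g z (fst L) j * h_lo g z i j)
          = (\<Sum>j\<in>UNIV. h_up g z (fst L) j * (\<Sum>i\<in>UNIV. h_up g z i (fst K) * h_lo g z i j))"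
          unfolding sum_distrib_left by (subst sum.swap) (simp add: mult_ac)
        then show ?thesis
          by (simp add: h_inv2[OF z] if_distrib[of "\<lambda>c. _ * c"] cong: if_cong)
      qed
      have "(\<Sum>I\<in>UNIV. \<Sum>J\<in>UNIV. ?hh I K * ?hh L J * H I J)
        = (\<Sum>i\<in>UNIV. \<Sum>j\<in>UNIV. h_up g z i (fst K) * h_up g z (fst L) j * h_lo g z i j)
          * (\<Sum>i\<in>UNIV. \<Sum>j\<in>UNIV. h_up g z i (snd K) * h_up g z (snd L) j * \<alpha> [i] [j])"
        unfolding sum_pair sum_distrib_right sum_distrib_left H_def fst_conv snd_conv
        by (subst sum.swap, rule sum.cong[OF refl], rule trans[OF _ sum_rotate[symmetric]])
           (simp add: mult_ac)
      then show ?thesis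
        unfolding tr .
    qed
    have "form_inner g z (Suc 1) (Suc 1) (omega_wedge g z \<alpha>) \<eta>
      = (\<Sum>I\<in>UNIV. \<Sum>J\<in>UNIV. omega_wedge g z \<alpha> (pair_list I) (pair_list J) * U I J) / 4"
    proof -
      have "(\<Sum>K\<in>UNIV. \<Sum>J\<in>UNIV. \<Sum>L\<in>UNIV. ?hh I K * ?hh L J * omega_wedge g z \<alpha> (pair_list I) (pair_list J) * ?e K L)
        = (\<Sum>J\<in>UNIV. omega_wedge g z \<alpha> (pair_list I) (pair_list J) * U I J)" for I
        unfolding U_def sum_distrib_left by (subst sum.swap) (simp add: mult_ac)
      then show ?thesis unfolding form_inner_22 by simp
    qed
    also have "(\<Sum>I\<in>UNIV. \<Sum>J\<in>UNIV. omega_wedge g z \<alpha> (pair_list I) (pair_list J) * U I J)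
      = - \<i> * ((\<Sum>I\<in>UNIV. \<Sum>J\<in>UNIV. H I J * U I J) - (\<Sum>I\<in>UNIV. \<Sum>J\<in>UNIV. H I (prod.swap J) * U I J)
        - (\<Sum>I\<in>UNIV. \<Sum>J\<in>UNIV. H (prod.swap I) J * U I J)
        + (\<Sum>I\<in>UNIV. \<Sum>J\<in>UNIV. H (prod.swap I) (prod.swap J) * U I J))"
      unfolding sum_subtractf[symmetric] sum.distrib[symmetric] sum_distrib_left
      by (intro sum.cong refl) (simp add: pair_list_def omega_wedge_22 H_def algebra_simps)
    also have "\<dots> = - 4 * \<i> * (\<Sum>I\<in>UNIV. \<Sum>J\<in>UNIV. H I J * U I J)"
      using sw1[of "\<lambda>J. J"] sw1[of prod.swap] sw2 by simp
    also have "(\<Sum>I\<in>UNIV. \<Sum>J\<in>UNIV. H I J * U I J)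
      = (\<Sum>K\<in>UNIV. \<Sum>L\<in>UNIV. ?e K L * (\<Sum>I\<in>UNIV. \<Sum>J\<in>UNIV. ?hh I K * ?hh L J * H I J))"
    proof -
      show ?thesis
        unfolding U_def sum_distrib_left by (subst sum_swap2) (simp add: mult_ac)
    qed
    finally have 1: "form_inner g z (Suc 1) (Suc 1) (omega_wedge g z \<alpha>) \<eta>
      = - \<i> * (\<Sum>K\<in>UNIV. \<Sum>L\<in>UNIV. ?e K L * (h_up g z (fst L) (fst K)
          * (\<Sum>i\<in>UNIV. \<Sum>j\<in>UNIV. h_up g z i (snd K) * h_up g z (snd L) j * \<alpha> [i] [j])))"
      unfolding contr by simp
    define Y where "Y k l = (\<Sum>i\<in>UNIV. \<Sum>j\<in>UNIV. h_up g z i k * h_up g z l j * \<alpha> [i] [j])" for k l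
    have cb: "cnj (b k l) = - \<i> * (\<Sum>p\<in>UNIV. \<Sum>q\<in>UNIV. h_up g z q p * cnj (\<eta> [p, k] [q, l]))" for k l
      by (simp add: b_def h_up_cnj[OF z])
    have "form_inner g z 1 1 \<alpha> (form11 b) = (\<Sum>k\<in>UNIV. \<Sum>l\<in>UNIV. Y k l * cnj (b k l))"
      unfolding form_inner_11 form11_simp Y_def sum_distrib_right
      by (subst sum.swap, rule sum.cong[OF refl], rule sum_rotate[symmetric])
    also have "\<dots> = - \<i> * (\<Sum>k\<in>UNIV. \<Sum>p\<in>UNIV. \<Sum>l\<in>UNIV. \<Sum>q\<in>UNIV. Y k l * (h_up g z q p * cnj (\<eta> [p, k] [q, l])))"
      unfolding cb sum_distrib_left by (rule sum.cong[OF refl], subst sum.swap) (simp add: mult_ac)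
    also have "\<dots> = - \<i> * (\<Sum>p\<in>UNIV. \<Sum>k\<in>UNIV. \<Sum>q\<in>UNIV. \<Sum>l\<in>UNIV. Y k l * (h_up g z q p * cnj (\<eta> [p, k] [q, l])))"
      by (subst sum.swap) (intro arg_cong[where f="\<lambda>x. - \<i> * x"] sum.cong refl sum.swap)
    also have "\<dots> = form_inner g z (Suc 1) (Suc 1) (omega_wedge g z \<alpha>) \<eta>"
      unfolding 1 Y_def[symmetric] sum_pair by (simp add: pair_list_def mult_ac)
    finally show ?thesis by simp
  qed
  have "Lambda g 1 1 z \<eta> = form11 b"
    unfolding Lambda_def
  proof (rule the_equality)
    show "pq_form 1 1 (form11 b) \<and> (\<forall>\<alpha>. pq_form 1 1 \<alpha> \<longrightarrow>
        form_inner g z (Suc 1) (Suc 1) (omega_wedge g z \<alpha>) \<eta> = form_inner g z 1 1 \<alpha> (form11 b))"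
      using adj pq_form_11 by blast
  next
    fix \<beta>
    assume *: "pq_form 1 1 \<beta> \<and> (\<forall>\<alpha>. pq_form 1 1 \<alpha> \<longrightarrow>
        form_inner g z (Suc 1) (Suc 1) (omega_wedge g z \<alpha>) \<eta> = form_inner g z 1 1 \<alpha> \<beta>)"
    then obtain b' where b': "\<beta> = form11 b'" using pq_form_11 by blast
    have "b' = b"
      by (rule form_inner_11_nondegenerate[OF z]) (use * adj b' in metis)
    then show "\<beta> = form11 b" using b' by simp
  qed
  then show ?thesis by (simp add: b_def)
qed

end

subsection \<open>Traces of the Chern curvature and of the torsion\<close>

context hermitian_chart
begin

text \<open>The four traces of the Chern curvature, numbered like the Ricci forms but without the
  factor \<open>\<i>\<close>; every index other than 1, 2, 3 stands for the fourth. One indexed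
  function allows them to be unfolded together.\<close>

definition chern_ric :: "complex^'n \<Rightarrow> nat \<Rightarrow> 'n \<Rightarrow> 'n \<Rightarrow> complex" where
  "chern_ric z a i j = (\<Sum>k\<in>UNIV. \<Sum>l\<in>UNIV. h_up g z k l *
     (if a = 1 then Chern_curv g z i j k l else if a = 2 then Chern_curv g z k l i j
      else if a = 3 then Chern_curv g z i l k j else Chern_curv g z k j i l))"

text \<open>The torsion form T applied to the raised adjoint of omega, up to the factor
  \<open>\<i>\<close>.\<close>

definition torsion_contract :: "complex^'n \<Rightarrow> 'n \<Rightarrow> 'n \<Rightarrow> complex" where
  "torsion_contract z i j = (\<Sum>p\<in>UNIV. \<Sum>q\<in>UNIV. h_up g z p q * torsion_lo z i p j * cnj (torsion_trace z q))"

lemma torsion_trace_lo: "(\<Sum>k\<in>UNIV. \<Sum>l\<in>UNIV. h_up g z k l * torsion_lo z j k l) = torsion_trace z j"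
  by (simp add: torsion_trace_def torsion_raise)

lemma Chern_curv_cnj:
  assumes z: "z \<in> V"
  shows "cnj (Chern_curv g z i j k l) = Chern_curv g z j i l k"
proof -
  have "cnj (cdir (ddz i) (cdir (ddzbar j) (\<lambda>y. h_lo g y k l)) z)
    = cdir (ddzbar i) (\<lambda>y. cnj (cdir (ddzbar j) (\<lambda>y. h_lo g y k l) y)) z"
    by (simp add: cdir_cnj[OF z smooth_dh] ddz_conj)
  also have "\<dots> = cdir (ddzbar i) (cdir (ddz j) (\<lambda>y. h_lo g y l k)) z"
    by (rule cdir_cong[OF open_V z smooth_dh]) (simp add: cdir_h_cnj)
  also have "\<dots> = cdir (ddz j) (cdir (ddzbar i) (\<lambda>y. h_lo g y l k)) z"
    by (rule cdir_commute[OF z open_V smooth_h_lo])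
  finally have dd: "cnj (cdir (ddz i) (cdir (ddzbar j) (\<lambda>y. h_lo g y k l)) z)
    = cdir (ddz j) (cdir (ddzbar i) (\<lambda>y. h_lo g y l k)) z" .
  have "(\<Sum>p\<in>UNIV. \<Sum>q\<in>UNIV. h_up g z q p * cdir (ddz j) (\<lambda>y. h_lo g y l p) z * cdir (ddzbar i) (\<lambda>y. h_lo g y q k) z)
    = (\<Sum>p\<in>UNIV. \<Sum>q\<in>UNIV. h_up g z p q * cdir (ddzbar i) (\<lambda>y. h_lo g y p k) z * cdir (ddz j) (\<lambda>y. h_lo g y l q) z)"
    by (subst sum.swap) (simp add: mult_ac)
  then show ?thesis
    by (simp add: Chern_curv_def dd h_up_cnj[OF z] cdir_h_cnj[OF z])
qed

text \<open>This is the first Bianchi identity of the Chern connection. The second derivatives of h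
  are those of two curvatures; what remains are products of first derivatives, which must
  cancel.\<close>

lemma cdir_torsion:
  assumes z: "z \<in> V"
  shows "cdir (ddzbar i) (\<lambda>y. torsion g y j k p) z
    = (\<Sum>l\<in>UNIV. h_up g z p l * (Chern_curv g z k i j l - Chern_curv g z j i k l))"
proof -
  have dT: "cdir (ddzbar i) (\<lambda>y. torsion_lo y j k l) z
    = Chern_curv g z k i j l - Chern_curv g z j i k l
      + (\<Sum>a\<in>UNIV. \<Sum>b\<in>UNIV. h_up g z a b * cdir (ddzbar i) (\<lambda>y. h_lo g y a l) z * torsion_lo z j k b)" for l
  proof -
    have "cdir (ddzbar i) (\<lambda>y. torsion_lo y j k l) z
      = cdir (ddzbar i) (cdir (ddz j) (\<lambda>y. h_lo g y k l)) z - cdir (ddzbar i) (cdir (ddz k) (\<lambda>y. h_lo g y j l)) z"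
      unfolding torsion_lo_def using smooth_dh by (subst cdir_diff[OF z]) auto
    then show ?thesis
      unfolding cdir_commute[OF z open_V smooth_h_lo, of "ddzbar i"] Chern_curv_def torsion_lo_def
      by (simp add: right_diff_distrib sum_subtractf)
  qed
  have "cdir (ddzbar i) (\<lambda>y. torsion g y j k p) z = (\<Sum>l\<in>UNIV. h_up g z p l * cdir (ddzbar i) (\<lambda>y. torsion_lo y j k l) z)
      + (\<Sum>l\<in>UNIV. cdir (ddzbar i) (\<lambda>y. h_up g y p l) z * torsion_lo z j k l)"
  proof -
    have s: "smooth_on V (\<lambda>y. h_up g y p l * torsion_lo y j k l)" for l
      by (intro smooth_on_mult smooth_h_up smooth_torsion_lo open_V)
    show ?thesis
      unfolding torsion_raise cdir_sum[OF z s] cdir_mult[OF z smooth_h_up smooth_torsion_lo] sum.distrib ..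
  qed
  \<comment> \<open>After renaming indices, the products left over from the lowered torsion are
    opposite to those from the derivative of the inverse metric.\<close>
  moreover have "(\<Sum>l\<in>UNIV. \<Sum>a\<in>UNIV. \<Sum>b\<in>UNIV. h_up g z p l *
      (h_up g z a b * cdir (ddzbar i) (\<lambda>y. h_lo g y a l) z * torsion_lo z j k b))
    = (\<Sum>l\<in>UNIV. \<Sum>a\<in>UNIV. \<Sum>b\<in>UNIV. h_up g z p b * h_up g z a l * cdir (ddzbar i) (\<lambda>y. h_lo g y a b) z * torsion_lo z j k l)"
    by (subst sum.swap, subst sum_rotate[symmetric]) (simp add: mult_ac)
  ultimately show ?thesis
    unfolding dT cdir_h_up[OF z]
    by (simp add: distrib_left sum.distrib sum_distrib_left sum_distrib_right sum_negf)
qed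

lemma smooth_torsion_trace_cnj: "smooth_on V (\<lambda>y. cnj (torsion_trace y j))"
  by (intro smooth_on_cnj smooth_torsion_trace open_V)

text \<open>The first identity is the trace of the Bianchi identity. Conjugation with exchanged
  indices turns trace 4 into trace 3 and fixes trace 1, which gives the second.\<close>

lemma cdir_torsion_trace:
  assumes z: "z \<in> V"
  shows "cdir (ddzbar j) (\<lambda>y. torsion_trace y i) z = chern_ric z 4 i j - chern_ric z 1 i j"
    and "cdir (ddz i) (\<lambda>y. cnj (torsion_trace y j)) z = chern_ric z 3 i j - chern_ric z 1 i j"
proof -
  show 1: "cdir (ddzbar j) (\<lambda>y. torsion_trace y i) z = chern_ric z 4 i j - chern_ric z 1 i j" for i j
    unfolding torsion_trace_def cdir_sum[OF z smooth_torsion] cdir_torsion[OF z] chern_ric_def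
    by (simp add: right_diff_distrib sum_subtractf)
  have "cdir (ddz i) (\<lambda>y. cnj (torsion_trace y j)) z = cnj (chern_ric z 4 j i - chern_ric z 1 j i)"
    unfolding cdir_cnj[OF z smooth_torsion_trace] ddz_conj 1 ..
  moreover have "cnj (chern_ric z 4 j i) = chern_ric z 3 i j" "cnj (chern_ric z 1 j i) = chern_ric z 1 i j"
    unfolding chern_ric_def by (simp_all add: h_up_cnj[OF z] Chern_curv_cnj[OF z], (rule sum.swap)+)
  ultimately show "cdir (ddz i) (\<lambda>y. cnj (torsion_trace y j)) z = chern_ric z 3 i j - chern_ric z 1 i j"
    by simp
qed

lemma del_del_star_omega:
  assumes z: "z \<in> V"
  shows "del (del_star V g 0 1 (omega g)) z [i] [j] = - \<i> * (chern_ric z 3 i j - chern_ric z 1 i j)"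
proof -
  have "del (del_star V g 0 1 (omega g)) z [i] [j] = cdir (ddz i) (\<lambda>y. del_star V g 0 1 (omega g) y [] [j]) z"
    by (simp add: del_def del_nth_def)
  also have "\<dots> = cdir (ddz i) (\<lambda>y. - \<i> * cnj (torsion_trace y j)) z"
    by (rule cdir_cong[OF open_V z])
       (intro smooth_on_mult smooth_on_const smooth_torsion_trace_cnj open_V, simp only: del_star_omega form01_simp)
  finally show ?thesis
    by (simp only: cdir_cmult[OF z smooth_torsion_trace_cnj] cdir_torsion_trace[OF z])
qed

lemma delbar_delbar_star_omega:
  assumes z: "z \<in> V"
  shows "delbar (delbar_star V g 1 0 (omega g)) z [i] [j] = - \<i> * (chern_ric z 4 i j - chern_ric z 1 i j)"
proof -
  have "delbar (delbar_star V g 1 0 (omega g)) z [i] [j] = - cdir (ddzbar j) (\<lambda>y. delbar_star V g 1 0 (omega g) y [i] []) z"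
    by (simp add: delbar_def del_nth_def)
  also have "cdir (ddzbar j) (\<lambda>y. delbar_star V g 1 0 (omega g) y [i] []) z = cdir (ddzbar j) (\<lambda>y. \<i> * torsion_trace y i) z"
    by (rule cdir_cong[OF open_V z])
       (intro smooth_on_mult smooth_on_const smooth_torsion_trace open_V, simp only: delbar_star_omega form10_simp)
  finally show ?thesis
    by (simp only: cdir_cmult[OF z smooth_torsion_trace] cdir_torsion_trace[OF z] mult_minus_left)
qed

lemma T_box_lo:
  assumes z: "z \<in> V"
  shows "T_box g z i j = (\<Sum>p\<in>UNIV. \<Sum>q\<in>UNIV. \<Sum>a\<in>UNIV. \<Sum>b\<in>UNIV.
    h_up g z p q * h_up g z a b * torsion_lo z i p b * cnj (torsion_lo z j q a))"
proof -
  have "(\<Sum>k\<in>UNIV. \<Sum>l\<in>UNIV. h_up g z p q * h_lo g z k l * torsion g z i p k * cnj (torsion g z j q l))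
    = (\<Sum>a\<in>UNIV. \<Sum>b\<in>UNIV. h_up g z p q * h_up g z a b * torsion_lo z i p b * cnj (torsion_lo z j q a))" for p q
  proof -
    have "(\<Sum>k\<in>UNIV. \<Sum>l\<in>UNIV. h_up g z p q * h_lo g z k l * torsion g z i p k * cnj (torsion g z j q l))
      = (\<Sum>k\<in>UNIV. h_up g z p q * torsion g z i p k * cnj (\<Sum>l\<in>UNIV. torsion g z j q l * h_lo g z l k))"
      by (simp add: sum_distrib_left h_lo_cnj[OF z] mult_ac)
    also have "\<dots> = (\<Sum>k\<in>UNIV. h_up g z p q * torsion g z i p k * cnj (torsion_lo z j q k))"
      by (simp only: torsion_lower[OF z])
    finally show ?thesis
      unfolding torsion_raise by (simp add: sum_distrib_left sum_distrib_right mult_ac)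
  qed
  then show ?thesis by (simp add: T_box_def)
qed

lemma T_circ_lo:
  assumes z: "z \<in> V"
  shows "T_circ g z i j = (\<Sum>p\<in>UNIV. \<Sum>q\<in>UNIV. \<Sum>s\<in>UNIV. \<Sum>r\<in>UNIV.
    h_up g z p q * h_up g z s r * torsion_lo z s p j * cnj (torsion_lo z r q i))"
proof -
  have "(\<Sum>k\<in>UNIV. \<Sum>l\<in>UNIV. h_up g z p q * h_up g z s r * h_lo g z k j * h_lo g z i l *
      torsion g z s p k * cnj (torsion g z r q l))
    = h_up g z p q * h_up g z s r * (\<Sum>k\<in>UNIV. torsion g z s p k * h_lo g z k j)
      * cnj (\<Sum>l\<in>UNIV. torsion g z r q l * h_lo g z l i)" for p q s r
    by (simp add: sum_distrib_left sum_distrib_right h_lo_cnj[OF z] mult_ac)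
  then show ?thesis
    unfolding torsion_lower[OF z] by (simp add: T_circ_def)
qed

text \<open>The sign in the coefficient of the adjoint is undone by exchanging the lower indices of
  the torsion.\<close>

lemma T_sharp_contract:
  assumes z: "z \<in> V"
  shows "T_sharp g (del_star V g 0 1 (omega g)) z i j = \<i> * torsion_contract z i j"
proof -
  have "T_sharp g (del_star V g 0 1 (omega g)) z i j
    = (\<Sum>p\<in>UNIV. \<Sum>q\<in>UNIV. h_up g z p q * (- \<i> * cnj (torsion_trace z q))
        * (\<Sum>m\<in>UNIV. torsion g z p i m * h_lo g z m j))"
    unfolding T_sharp_def del_star_omega[OF z] form01_simp sum_distrib_left
    by (subst sum_rotate) (simp only: mult_ac)
  then show ?thesis
    unfolding torsion_lower[OF z] torsion_contract_def torsion_lo_skew[of z _ i]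
    by (simp add: sum_distrib_left mult_ac)
qed

text \<open>The alternating sum of four second derivatives in del delbar omega equals four Chern
  curvatures plus four products of first derivatives. These products factor into torsion times
  conjugate torsion, which is where T-box comes from.\<close>

lemma Lambda_del_delbar_omega:
  assumes z: "z \<in> V"
  shows "Lambda g 1 1 z (del (delbar (omega g)) z) [i] [j]
    = chern_ric z 3 i j + chern_ric z 4 i j - chern_ric z 1 i j - chern_ric z 2 i j + T_box g z i j"
proof -
  define \<eta> where "\<eta> = del (delbar (omega g)) z"
  let ?dd = "\<lambda>i j k l. cdir (ddz i) (cdir (ddzbar j) (\<lambda>y. h_lo g y k l)) z"
  have delbar: "delbar (omega g) y [i] [l, j] = - \<i> * (cdir (ddzbar l) (\<lambda>y. h_lo g y i j) y - cdir (ddzbar j) (\<lambda>y. h_lo g y i l) y)"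
    if "y \<in> V" for y i l j
    by (simp add: delbar_def del_nth_def omega_def cdir_cmult[OF that smooth_h_lo] lessThan_Suc algebra_simps)
  have \<eta>: "\<eta> [p, i] [q, j] = - \<i> * (?dd p q i j - ?dd p j i q - ?dd i q p j + ?dd i j p q)" for p i q j
  proof -
    have sd: "smooth_on V (\<lambda>y. cdir (ddzbar l) (\<lambda>y. h_lo g y i j) y - cdir (ddzbar j) (\<lambda>y. h_lo g y i l) y)" for i l j
      using smooth_dh by (intro smooth_on_diff open_V) auto
    have "cdir (ddz k) (\<lambda>y. delbar (omega g) y [i] [l, j]) z = - \<i> * (?dd k l i j - ?dd k j i l)" for k i l j
    proof -
      have "cdir (ddz k) (\<lambda>y. delbar (omega g) y [i] [l, j]) z
        = cdir (ddz k) (\<lambda>y. - \<i> * (cdir (ddzbar l) (\<lambda>y. h_lo g y i j) y - cdir (ddzbar j) (\<lambda>y. h_lo g y i l) y)) z"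
        by (rule cdir_cong[OF open_V z]) (intro smooth_on_mult smooth_on_const sd open_V, simp only: delbar)
      then show ?thesis
        using smooth_dh by (simp only: cdir_cmult[OF z sd] cdir_diff[OF z])
    qed
    then show ?thesis
      by (simp add: \<eta>_def del_def[of _ z "[p, i]"] del_nth_def lessThan_Suc algebra_simps)
  qed
  have skew1: "\<eta> [a, b] J = - \<eta> [b, a] J" for a b J
    by (simp add: \<eta>_def del_def del_nth_def lessThan_Suc)
  have skew2: "\<eta> I [a, b] = - \<eta> I [b, a]" for a b I
  proof -
    have d: "delbar (omega g) y I' [a, b] = - delbar (omega g) y I' [b, a]" for y I'
      by (simp add: delbar_def del_nth_def lessThan_Suc algebra_simps)
    \<comment> \<open>The sign may be moved out of the derivative only for a differentiable
      function. If I' has length 1 the coefficient is smooth; otherwise it vanishes identically,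
      since omega is of type (1,1).\<close>
    have "cdir X (\<lambda>y. - f y) z = - cdir X f z" if "f = (\<lambda>y. delbar (omega g) y I' [b, a])" for X f I'
    proof (cases "length I' = 1")
      case True
      then obtain i where i: "I' = [i]" by (auto simp: length_Suc_conv)
      have "smooth_on V f"
        unfolding that i
      proof (rule smooth_on_cong[OF open_V])
        show "smooth_on V (\<lambda>y. - \<i> * (cdir (ddzbar b) (\<lambda>y. h_lo g y i a) y - cdir (ddzbar a) (\<lambda>y. h_lo g y i b) y))"
          using smooth_dh by (intro smooth_on_mult smooth_on_const smooth_on_diff open_V) auto
      qed (simp only: delbar)
      then show ?thesis by (rule cdir_minus[OF z])
    next
      case False
      then show ?thesis
        by (simp add: that delbar_def omega_def)
    qed
    then show ?thesis
      unfolding \<eta>_def del_def d[of _ _] sum_negf[symmetric] by (simp add: d)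
  qed
  have quad: "?dd i j k l = - Chern_curv g z i j k l + (\<Sum>a\<in>UNIV. \<Sum>b\<in>UNIV. h_up g z a b
      * cdir (ddzbar j) (\<lambda>y. h_lo g y a l) z * cdir (ddz i) (\<lambda>y. h_lo g y k b) z)" for i j k l
    by (simp add: Chern_curv_def)
  have comp: "\<i> * \<eta> [p, i] [q, j] = - Chern_curv g z p q i j + Chern_curv g z p j i q + Chern_curv g z i q p j
      - Chern_curv g z i j p q + (\<Sum>a\<in>UNIV. \<Sum>b\<in>UNIV. h_up g z a b * torsion_lo z i p b * cnj (torsion_lo z j q a))" for p q
    unfolding \<eta> quad
    by (simp add: torsion_lo_def cdir_h_cnj[OF z] algebra_simps sum.distrib sum_subtractf)
  have "Lambda g 1 1 z \<eta> [i] [j] = (\<Sum>p\<in>UNIV. \<Sum>q\<in>UNIV. h_up g z p q * (\<i> * \<eta> [p, i] [q, j]))"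
    unfolding Lambda_11[of z \<eta>, OF z skew1 skew2] by (simp add: sum_distrib_left mult_ac)
  also have "\<dots> = chern_ric z 3 i j + chern_ric z 4 i j - chern_ric z 1 i j - chern_ric z 2 i j + T_box g z i j"
    unfolding comp T_box_lo[OF z] chern_ric_def
    by (simp add: algebra_simps sum.distrib sum_subtractf sum_distrib_left)
  finally show ?thesis
    unfolding \<eta>_def .
qed

subsection \<open>Traces of the curvature of the Gauduchon connections\<close>

definition quadratic_part :: "complex^'n \<Rightarrow> 'n \<Rightarrow> 'n \<Rightarrow> 'n \<Rightarrow> 'n \<Rightarrow> complex" where
  "quadratic_part z i j k l = (\<Sum>p\<in>UNIV. \<Sum>q\<in>UNIV. h_up g z p q *
     (torsion_lo z i k q * cnj (torsion_lo z j l p) - torsion_lo z i p l * cnj (torsion_lo z j q k)))"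

text \<open>In the first trace both products give T-box after renaming, so they cancel and the first
  Ricci form is linear in t. In each other trace one product gives T-box up to sign, while the other
  gives T-circ or splits off a trace of the torsion.\<close>

lemma quadratic_part_trace:
  assumes z: "z \<in> V"
  shows "(\<Sum>k\<in>UNIV. \<Sum>l\<in>UNIV. h_up g z k l * quadratic_part z i j k l) = 0"
    and "(\<Sum>k\<in>UNIV. \<Sum>l\<in>UNIV. h_up g z k l * quadratic_part z k l i j) = T_box g z i j - T_circ g z i j"
    and "(\<Sum>k\<in>UNIV. \<Sum>l\<in>UNIV. h_up g z k l * quadratic_part z i l k j) = torsion_contract z i j - T_box g z i j"
    and "(\<Sum>k\<in>UNIV. \<Sum>l\<in>UNIV. h_up g z k l * quadratic_part z k j i l) = cnj (torsion_contract z j i) - T_box g z i j"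
proof -
  let ?S = "\<lambda>f. \<Sum>k\<in>UNIV. \<Sum>l\<in>UNIV. \<Sum>p\<in>UNIV. \<Sum>q\<in>UNIV. h_up g z k l * (h_up g z p q * f k l p q)"
  have split: "(\<Sum>k\<in>UNIV. \<Sum>l\<in>UNIV. h_up g z k l * (\<Sum>p\<in>UNIV. \<Sum>q\<in>UNIV. h_up g z p q * (f k l p q - f' k l p q)))
    = ?S f - ?S f'" for f f' :: "'n \<Rightarrow> 'n \<Rightarrow> 'n \<Rightarrow> 'n \<Rightarrow> complex"
    by (simp add: right_diff_distrib sum_subtractf sum_distrib_left)
  have box: "?S (\<lambda>k l p q. torsion_lo z i k q * cnj (torsion_lo z j l p)) = T_box g z i j"
    unfolding T_box_lo[OF z] by (simp add: mult_ac)
  have box': "?S (\<lambda>k l p q. torsion_lo z i p l * cnj (torsion_lo z j q k)) = T_box g z i j"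
    unfolding T_box_lo[OF z] by (subst sum_swap2) (simp add: mult_ac)
  have circ: "?S (\<lambda>k l p q. torsion_lo z k p j * cnj (torsion_lo z l q i)) = T_circ g z i j"
    unfolding T_circ_lo[OF z] by (subst sum_swap2) (simp add: mult_ac)
  have trbar: "(\<Sum>k\<in>UNIV. \<Sum>l\<in>UNIV. h_up g z k l * cnj (torsion_lo z q l k)) = cnj (torsion_trace z q)" for q
    unfolding torsion_trace_lo[symmetric] by (simp add: h_up_cnj[OF z]) (rule sum.swap)
  have contr: "?S (\<lambda>k l p q. torsion_lo z i p j * cnj (torsion_lo z q l k)) = torsion_contract z i j"
  proof -
    have "?S (\<lambda>k l p q. torsion_lo z i p j * cnj (torsion_lo z q l k))
      = (\<Sum>p\<in>UNIV. \<Sum>q\<in>UNIV. h_up g z p q * torsion_lo z i p j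
          * (\<Sum>k\<in>UNIV. \<Sum>l\<in>UNIV. h_up g z k l * cnj (torsion_lo z q l k)))"
      unfolding sum_distrib_left by (subst sum_swap2) (simp add: mult_ac)
    then show ?thesis unfolding trbar torsion_contract_def .
  qed
  have contr': "?S (\<lambda>k l p q. torsion_lo z p k l * cnj (torsion_lo z j q i)) = cnj (torsion_contract z j i)"
  proof -
    have "?S (\<lambda>k l p q. torsion_lo z p k l * cnj (torsion_lo z j q i))
      = (\<Sum>p\<in>UNIV. \<Sum>q\<in>UNIV. h_up g z p q * cnj (torsion_lo z j q i)
          * (\<Sum>k\<in>UNIV. \<Sum>l\<in>UNIV. h_up g z k l * torsion_lo z p k l))"
      unfolding sum_distrib_left by (subst sum_swap2) (simp add: mult_ac)
    then show ?thesis
      unfolding torsion_trace_lo torsion_contract_def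
      by (simp add: h_up_cnj[OF z]) (rule sum.swap)
  qed
  show "(\<Sum>k\<in>UNIV. \<Sum>l\<in>UNIV. h_up g z k l * quadratic_part z i j k l) = 0"
    unfolding quadratic_part_def split box box' by simp
  have "quadratic_part z k l i j = (\<Sum>p\<in>UNIV. \<Sum>q\<in>UNIV. h_up g z p q *
     (torsion_lo z i k q * cnj (torsion_lo z j l p) - torsion_lo z k p j * cnj (torsion_lo z l q i)))" for k l
    unfolding quadratic_part_def torsion_lo_skew[of z k i] torsion_lo_skew[of z l j] by simp
  then show "(\<Sum>k\<in>UNIV. \<Sum>l\<in>UNIV. h_up g z k l * quadratic_part z k l i j) = T_box g z i j - T_circ g z i j"
    by (simp only: split box circ)
  have "quadratic_part z i l k j = (\<Sum>p\<in>UNIV. \<Sum>q\<in>UNIV. h_up g z p q *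
     (torsion_lo z i p j * cnj (torsion_lo z q l k) - torsion_lo z i k q * cnj (torsion_lo z j l p)))" for k l
    unfolding quadratic_part_def torsion_lo_skew[of z l] by simp
  then show "(\<Sum>k\<in>UNIV. \<Sum>l\<in>UNIV. h_up g z k l * quadratic_part z i l k j) = torsion_contract z i j - T_box g z i j"
    by (simp only: split box contr)
  have "quadratic_part z k j i l = (\<Sum>p\<in>UNIV. \<Sum>q\<in>UNIV. h_up g z p q *
     (torsion_lo z p k l * cnj (torsion_lo z j q i) - torsion_lo z i k q * cnj (torsion_lo z j l p)))" for k l
    unfolding quadratic_part_def torsion_lo_skew[of z k] by simp
  then show "(\<Sum>k\<in>UNIV. \<Sum>l\<in>UNIV. h_up g z k l * quadratic_part z k j i l) = cnj (torsion_contract z j i) - T_box g z i j"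
    by (simp only: split box contr')
qed


lemma R_G_quadratic:
  "z \<in> V \<Longrightarrow> R_G g t z i j k l = Chern_curv g z i j k l
    + of_real t * (Chern_curv g z i l k j + Chern_curv g z k j i l - 2 * Chern_curv g z i j k l)
    + (of_real t)\<^sup>2 * quadratic_part z i j k l"
  unfolding R_G_lowered quadratic_part_def ..

lemma quadratic_part_torsion:
  assumes z: "z \<in> V"
  shows "quadratic_part z i j k l
    = (\<Sum>p\<in>UNIV. \<Sum>q\<in>UNIV. torsion g z i k p * cnj (torsion g z j l q) * h_lo g z p q)
      - (\<Sum>p\<in>UNIV. \<Sum>q\<in>UNIV. \<Sum>m\<in>UNIV. \<Sum>n\<in>UNIV.
          h_up g z p q * h_lo g z m l * h_lo g z k n * torsion g z i p m * cnj (torsion g z j q n))"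
proof -
  have "(\<Sum>p\<in>UNIV. \<Sum>q\<in>UNIV. torsion g z i k p * cnj (torsion g z j l q) * h_lo g z p q)
    = (\<Sum>p\<in>UNIV. torsion g z i k p * cnj (\<Sum>q\<in>UNIV. torsion g z j l q * h_lo g z q p))"
    by (simp add: sum_distrib_left h_lo_cnj[OF z] mult_ac)
  also have "\<dots> = (\<Sum>p\<in>UNIV. torsion g z i k p * cnj (torsion_lo z j l p))"
    by (simp only: torsion_lower[OF z])
  also have "\<dots> = (\<Sum>p\<in>UNIV. \<Sum>q\<in>UNIV. h_up g z p q * (torsion_lo z i k q * cnj (torsion_lo z j l p)))"
    unfolding torsion_raise by (simp add: sum_distrib_left mult_ac)
  finally have 1: "(\<Sum>p\<in>UNIV. \<Sum>q\<in>UNIV. torsion g z i k p * cnj (torsion g z j l q) * h_lo g z p q)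
    = (\<Sum>p\<in>UNIV. \<Sum>q\<in>UNIV. h_up g z p q * (torsion_lo z i k q * cnj (torsion_lo z j l p)))" .
  have 2: "(\<Sum>m\<in>UNIV. \<Sum>n\<in>UNIV. h_up g z p q * h_lo g z m l * h_lo g z k n * torsion g z i p m * cnj (torsion g z j q n))
    = h_up g z p q * (torsion_lo z i p l * cnj (torsion_lo z j q k))" for p q
    unfolding torsion_lower[OF z, symmetric]
    by (subst sum.swap) (simp add: sum_distrib_left sum_distrib_right h_lo_cnj[OF z] mult_ac)
  show ?thesis
    unfolding 1 2 quadratic_part_def by (simp add: right_diff_distrib sum_subtractf)
qed

text \<open>Each trace permutes the slots of the curvature formula. The two partners in its linear
  term exchange one kind of index, and this leads from traces 1 and 2 to traces 3 and 4 and
  back.\<close>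

lemma Gauduchon_Ricci:
  fixes t :: real
  assumes z: "z \<in> V"
  defines "c \<equiv> chern_ric z" and "\<tau> \<equiv> complex_of_real t"
  shows "(\<Sum>k\<in>UNIV. \<Sum>l\<in>UNIV. h_up g z k l * R_G g t z i j k l) = c 1 i j + \<tau> * (c 3 i j + c 4 i j - 2 * c 1 i j)"
    and "(\<Sum>k\<in>UNIV. \<Sum>l\<in>UNIV. h_up g z k l * R_G g t z k l i j) = c 2 i j + \<tau> * (c 3 i j + c 4 i j - 2 * c 2 i j)
      + \<tau>\<^sup>2 * (T_box g z i j - T_circ g z i j)"
    and "(\<Sum>k\<in>UNIV. \<Sum>l\<in>UNIV. h_up g z k l * R_G g t z i l k j) = c 3 i j + \<tau> * (c 1 i j + c 2 i j - 2 * c 3 i j)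
      + \<tau>\<^sup>2 * (torsion_contract z i j - T_box g z i j)"
    and "(\<Sum>k\<in>UNIV. \<Sum>l\<in>UNIV. h_up g z k l * R_G g t z k j i l) = c 4 i j + \<tau> * (c 1 i j + c 2 i j - 2 * c 4 i j)
      + \<tau>\<^sup>2 * (cnj (torsion_contract z j i) - T_box g z i j)"
proof -
  have split: "(\<Sum>k\<in>UNIV. \<Sum>l\<in>UNIV. h_up g z k l * (f k l + \<tau> * (f1 k l + f2 k l - 2 * f k l) + \<tau>\<^sup>2 * q k l))
    = (\<Sum>k\<in>UNIV. \<Sum>l\<in>UNIV. h_up g z k l * f k l)
      + \<tau> * ((\<Sum>k\<in>UNIV. \<Sum>l\<in>UNIV. h_up g z k l * f1 k l) + (\<Sum>k\<in>UNIV. \<Sum>l\<in>UNIV. h_up g z k l * f2 k l)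
          - 2 * (\<Sum>k\<in>UNIV. \<Sum>l\<in>UNIV. h_up g z k l * f k l))
      + \<tau>\<^sup>2 * (\<Sum>k\<in>UNIV. \<Sum>l\<in>UNIV. h_up g z k l * q k l)"
    for f f1 f2 q :: "'n \<Rightarrow> 'n \<Rightarrow> complex"
    by (simp add: algebra_simps sum.distrib sum_subtractf sum_distrib_left)
  note rules = R_G_quadratic[OF z, of t, folded \<tau>_def] split quadratic_part_trace[OF z] c_def chern_ric_def
  show "(\<Sum>k\<in>UNIV. \<Sum>l\<in>UNIV. h_up g z k l * R_G g t z i j k l) = c 1 i j + \<tau> * (c 3 i j + c 4 i j - 2 * c 1 i j)"
    unfolding rules by simp
  show "(\<Sum>k\<in>UNIV. \<Sum>l\<in>UNIV. h_up g z k l * R_G g t z k l i j) = c 2 i j + \<tau> * (c 3 i j + c 4 i j - 2 * c 2 i j)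
      + \<tau>\<^sup>2 * (T_box g z i j - T_circ g z i j)"
    unfolding rules by (simp add: add.commute)
  show "(\<Sum>k\<in>UNIV. \<Sum>l\<in>UNIV. h_up g z k l * R_G g t z i l k j) = c 3 i j + \<tau> * (c 1 i j + c 2 i j - 2 * c 3 i j)
      + \<tau>\<^sup>2 * (torsion_contract z i j - T_box g z i j)"
    unfolding rules by simp
  show "(\<Sum>k\<in>UNIV. \<Sum>l\<in>UNIV. h_up g z k l * R_G g t z k j i l) = c 4 i j + \<tau> * (c 1 i j + c 2 i j - 2 * c 4 i j)
      + \<tau>\<^sup>2 * (cnj (torsion_contract z j i) - T_box g z i j)"
    unfolding rules by (simp add: add.commute)
qed

section \<open>Traces of the Ricci curvatures and scalar curvatures\<close>

definition metric_trace :: "complex^'n \<Rightarrow> ('n \<Rightarrow> 'n \<Rightarrow> complex) \<Rightarrow> complex" where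
  "metric_trace z a = (\<Sum>i\<in>UNIV. \<Sum>j\<in>UNIV. h_up g z i j * a i j)"

lemma metric_trace_simps:
  "metric_trace z (\<lambda>i j. a i j + b i j) = metric_trace z a + metric_trace z b"
  "metric_trace z (\<lambda>i j. a i j - b i j) = metric_trace z a - metric_trace z b"
  "metric_trace z (\<lambda>i j. x * a i j) = x * metric_trace z a"
  by (simp_all add: metric_trace_def algebra_simps sum.distrib sum_subtractf sum_distrib_left)

text \<open>A full contraction is unchanged when the pairs (i,j) and (k,l) are interchanged, so
  traces 1 and 2 agree, as do 3 and 4. Only two Chern scalars remain.\<close>

lemma metric_trace_chern_ric:
  shows "metric_trace z (chern_ric z 1) = s_Chern g z"
    and "metric_trace z (chern_ric z 2) = s_Chern g z"
    and "metric_trace z (chern_ric z 4) = metric_trace z (chern_ric z 3)"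
proof -
  show "metric_trace z (chern_ric z 1) = s_Chern g z"
    by (simp add: metric_trace_def chern_ric_def s_Chern_def sum_distrib_left mult_ac)
  show "metric_trace z (chern_ric z 2) = s_Chern g z"
    unfolding metric_trace_def chern_ric_def s_Chern_def sum_distrib_left
    by (subst sum_swap2) (simp add: mult_ac)
  show "metric_trace z (chern_ric z 4) = metric_trace z (chern_ric z 3)"
    unfolding metric_trace_def chern_ric_def sum_distrib_left
    by (subst sum_swap2) (simp add: mult_ac)
qed

text \<open>Contracting the first lower index of the torsion instead of the second changes the sign
  of its trace; what is left is the norm of the torsion trace.\<close>

lemma metric_trace_torsion_contract:
  assumes z: "z \<in> V"
  shows "metric_trace z (torsion_contract z)
    = - form_inner g z 0 1 (del_star V g 0 1 (omega g) z) (del_star V g 0 1 (omega g) z)"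
proof -
  have tr: "(\<Sum>i\<in>UNIV. \<Sum>j\<in>UNIV. h_up g z i j * torsion_lo z i p j) = - torsion_trace z p" for p
    unfolding torsion_trace_lo[symmetric] sum_negf[symmetric]
    by (intro sum.cong refl) (simp add: torsion_lo_def algebra_simps)
  have "metric_trace z (torsion_contract z) = (\<Sum>p\<in>UNIV. \<Sum>q\<in>UNIV. h_up g z p q * cnj (torsion_trace z q)
      * (\<Sum>i\<in>UNIV. \<Sum>j\<in>UNIV. h_up g z i j * torsion_lo z i p j))"
    unfolding metric_trace_def torsion_contract_def sum_distrib_left
    by (subst sum_swap2) (simp add: mult_ac)
  also have "\<dots> = - form_inner g z 0 1 (del_star V g 0 1 (omega g) z) (del_star V g 0 1 (omega g) z)"
    unfolding tr form_inner_01 del_star_omega[OF z] form01_simp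
    by (subst sum.swap) (simp add: sum_negf mult_ac)
  finally show ?thesis .
qed

text \<open>The factor 2 is the 2! by which \<open>form_inner\<close> divides when it sums over both
  orders of the holomorphic indices; the trace of T-box has no such divisor.\<close>

lemma metric_trace_T_box:
  assumes z: "z \<in> V"
  shows "metric_trace z (T_box g z) = 2 * form_inner g z 2 1 (del (omega g) z) (del (omega g) z)"
proof -
  have del: "del (omega g) z [a, b] [j] = \<i> * torsion_lo z a b j" for a b j
    by (simp add: del_def del_nth_def omega_def lessThan_Suc cdir_cmult[OF z smooth_h_lo] torsion_lo_def algebra_simps)
  have "metric_trace z (T_box g z) = (\<Sum>a\<in>UNIV. \<Sum>c\<in>UNIV. \<Sum>b\<in>UNIV. \<Sum>d\<in>UNIV. \<Sum>l\<in>UNIV. \<Sum>j\<in>UNIV.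
      h_up g z a c * h_up g z b d * h_up g z l j * torsion_lo z a b j * cnj (torsion_lo z c d l))"
    unfolding metric_trace_def T_box_lo[OF z] sum_distrib_left by (simp only: mult_ac)
  also have "\<dots> = (\<Sum>a\<in>UNIV. \<Sum>b\<in>UNIV. \<Sum>c\<in>UNIV. \<Sum>d\<in>UNIV. \<Sum>j\<in>UNIV. \<Sum>l\<in>UNIV.
      h_up g z a c * h_up g z b d * h_up g z l j * torsion_lo z a b j * cnj (torsion_lo z c d l))"
    by (rule sum.cong[OF refl], subst sum.swap) (intro sum.cong refl sum.swap)
  also have "\<dots> = 2 * form_inner g z 2 1 (del (omega g) z) (del (omega g) z)"
    unfolding form_inner_21 del by (simp add: mult_ac)
  finally show ?thesis .
qed

lemma form_inner_del_del_star:
  assumes z: "z \<in> V"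
  shows "form_inner g z 1 1 (del (del_star V g 0 1 (omega g)) z) (omega g z)
    = s_Chern g z - metric_trace z (chern_ric z 3)"
proof -
  have "form_inner g z 1 1 (del (del_star V g 0 1 (omega g)) z) (omega g z)
    = - \<i> * metric_trace z (\<lambda>i j. - \<i> * (chern_ric z 3 i j - chern_ric z 1 i j))"
    unfolding form_inner_11_omega[OF z] del_del_star_omega[OF z] metric_trace_def ..
  then show ?thesis
    unfolding metric_trace_simps metric_trace_chern_ric(1) by (simp add: algebra_simps)
qed

lemma scal1_trace: "scal1 g t z = metric_trace z (\<lambda>i j. \<Sum>k\<in>UNIV. \<Sum>l\<in>UNIV. h_up g z k l * R_G g t z i j k l)"
  by (simp add: scal1_def metric_trace_def sum_distrib_left mult_ac)

lemma scal2_trace: "scal2 g t z = metric_trace z (\<lambda>i j. \<Sum>k\<in>UNIV. \<Sum>l\<in>UNIV. h_up g z k l * R_G g t z i l k j)"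
proof -
  have "scal2 g t z = (\<Sum>i\<in>UNIV. \<Sum>l\<in>UNIV. \<Sum>k\<in>UNIV. \<Sum>j\<in>UNIV. h_up g z i l * h_up g z k j * R_G g t z i j k l)"
    unfolding scal2_def
  proof (rule sum.cong[OF refl])
    fix i
    have "(\<Sum>j\<in>UNIV. \<Sum>k\<in>UNIV. \<Sum>l\<in>UNIV. f j k l) = (\<Sum>l\<in>UNIV. \<Sum>k\<in>UNIV. \<Sum>j\<in>UNIV. f j k l)"
      for f :: "'n \<Rightarrow> 'n \<Rightarrow> 'n \<Rightarrow> complex"
      by (subst sum_rotate[symmetric]) (intro sum.cong refl sum.swap)
    then show "(\<Sum>j\<in>UNIV. \<Sum>k\<in>UNIV. \<Sum>l\<in>UNIV. h_up g z i l * h_up g z k j * R_G g t z i j k l)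
      = (\<Sum>l\<in>UNIV. \<Sum>k\<in>UNIV. \<Sum>j\<in>UNIV. h_up g z i l * h_up g z k j * R_G g t z i j k l)" .
  qed
  then show ?thesis
    by (simp add: metric_trace_def sum_distrib_left mult_ac)
qed

end

theorem corollary1p7:
  fixes A :: "('m::{t2_space, second_countable_topology}, 'n::finite) chart set"
    and G :: "('m, 'n) chart \<Rightarrow> 'n metric"
    and t :: real
    and c :: "('m, 'n) chart"
    and z :: "complex^'n"
  assumes "hermitian_manifold A G"
    and "c \<in> A"
    and "z \<in> chart_image c"
  shows "let g = G c;
             V = chart_image c;
             \<omega> = omega g;
             h = h_lo g z;
             h' = h_up g z;
             T = torsion g z;
             \<Theta> = Chern_curv g z;
             ds\<omega> = del_star V g 0 1 \<omega>;
             dbs\<omega> = delbar_star V g 1 0 \<omega>;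
             dds = (\<lambda>i j. del ds\<omega> z [i] [j]);
             dbdbs = (\<lambda>i j. delbar dbs\<omega> z [i] [j]);
             Lddb = (\<lambda>i j. Lambda g 1 1 z (del (delbar \<omega>) z) [i] [j]);
             Tbox = T_box g z;
             Tcirc = T_circ g z;
             Tds = T_sharp g ds\<omega> z;
             \<tau> = complex_of_real t
         in
           (\<forall>i j k l. R_G g t z i j k l =
              \<Theta> i j k l + \<tau> * (\<Theta> i l k j + \<Theta> k j i l - 2 * \<Theta> i j k l)
              + \<tau>\<^sup>2 * ((\<Sum>p\<in>UNIV. \<Sum>q\<in>UNIV. T i k p * cnj (T j l q) * h p q)
                 - (\<Sum>p\<in>UNIV. \<Sum>q\<in>UNIV. \<Sum>m\<in>UNIV. \<Sum>n\<in>UNIV.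
                      h' p q * h m l * h k n * T i p m * cnj (T j q n)))) \<and>
           (\<forall>i j. Ric1 g t z i j = Chern_Ricci1 g z i j - \<tau> * (dds i j + dbdbs i j)) \<and>
           (\<forall>i j. Ric2 g t z i j = Chern_Ricci1 g z i j
              - (1 - 2 * \<tau>) * \<i> * Lddb i j
              - (1 - \<tau>) * (dds i j + dbdbs i j)
              + (1 - \<tau>)\<^sup>2 * \<i> * Tbox i j
              - \<tau>\<^sup>2 * \<i> * Tcirc i j) \<and>
           (\<forall>i j. Ric3 g t z i j = Chern_Ricci1 g z i j
              - \<tau> * \<i> * Lddb i j
              - (1 - \<tau>) * dds i j
              - \<tau> * dbdbs i j
              + (\<tau> - \<tau>\<^sup>2) * \<i> * Tbox i j
              + \<tau>\<^sup>2 * Tds i j) \<and>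
           (\<forall>i j. Ric4 g t z i j = Chern_Ricci1 g z i j
              - \<tau> * \<i> * Lddb i j
              - (1 - \<tau>) * dbdbs i j
              - \<tau> * dds i j
              + (\<tau> - \<tau>\<^sup>2) * \<i> * Tbox i j
              + \<tau>\<^sup>2 * conj11 Tds i j) \<and>
           scal1 g t z = s_Chern g z - 2 * \<tau> * form_inner g z 1 1 (del ds\<omega> z) (\<omega> z) \<and>
           scal2 g t z = s_Chern g z
              - (1 - 2 * \<tau>) * form_inner g z 1 1 (del ds\<omega> z) (\<omega> z)
              - \<tau>\<^sup>2 * (2 * form_inner g z 2 1 (del \<omega> z) (del \<omega> z)
                       + form_inner g z 0 1 (ds\<omega> z) (ds\<omega> z))"
proof -
  interpret hermitian_chart "chart_image c" "G c"
    using assms unfolding hermitian_manifold_def holomorphic_atlas_def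
    by unfold_locales auto
  note z = assms(3)
  define cr where "cr = chern_ric z"
  have R1: "Chern_Ricci1 (G c) z i j = \<i> * cr 1 i j" for i j
    by (simp add: Chern_Ricci1_def cr_def chern_ric_def)
  have fi: "form_inner (G c) z 1 1 (del (del_star (chart_image c) (G c) 0 1 (omega (G c))) z) (omega (G c) z)
      = s_Chern (G c) z - metric_trace z (cr 3)"
    using form_inner_del_del_star[OF z] by (simp add: cr_def)
  \<comment> \<open>Everything is expressed in the traces \<open>cr\<close>, the torsion forms and
    \<open>torsion_contract\<close>, and each Ricci formula becomes a polynomial identity. In the
    fourth one \<open>conj11\<close> sends \<open>\<i> * torsion_contract\<close> to
    \<open>\<i>\<close> times its conjugate with exchanged indices, its own sign cancelling that of
    the conjugated unit.\<close>
  show ?thesis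
    unfolding Let_def Ric1_def Ric2_def Ric3_def Ric4_def Gauduchon_Ricci[OF z, folded cr_def]
      T_sharp_contract[OF z] del_del_star_omega[OF z, folded cr_def] R1 conj11_def
      delbar_delbar_star_omega[OF z, folded cr_def] Lambda_del_delbar_omega[OF z, folded cr_def] fi
  proof (intro conjI allI)
    fix i j k l
    show "R_G (G c) t z i j k l = Chern_curv (G c) z i j k l
      + of_real t * (Chern_curv (G c) z i l k j + Chern_curv (G c) z k j i l - 2 * Chern_curv (G c) z i j k l)
      + (of_real t)\<^sup>2 * ((\<Sum>p\<in>UNIV. \<Sum>q\<in>UNIV. torsion (G c) z i k p * cnj (torsion (G c) z j l q) * h_lo (G c) z p q)
        - (\<Sum>p\<in>UNIV. \<Sum>q\<in>UNIV. \<Sum>m\<in>UNIV. \<Sum>n\<in>UNIV. h_up (G c) z p q * h_lo (G c) z m l * h_lo (G c) z k n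
            * torsion (G c) z i p m * cnj (torsion (G c) z j q n)))"
      unfolding R_G_quadratic[OF z] quadratic_part_torsion[OF z] ..
  next
    show "scal1 (G c) t z = s_Chern (G c) z - 2 * of_real t * (s_Chern (G c) z - metric_trace z (cr 3))"
      unfolding scal1_trace Gauduchon_Ricci[OF z] metric_trace_simps metric_trace_chern_ric cr_def
      by (simp add: algebra_simps)
  next
    show "scal2 (G c) t z = s_Chern (G c) z - (1 - 2 * of_real t) * (s_Chern (G c) z - metric_trace z (cr 3))
       - (of_real t)\<^sup>2 * (2 * form_inner (G c) z 2 1 (del (omega (G c)) z) (del (omega (G c)) z)
         + form_inner (G c) z 0 1 (del_star (chart_image c) (G c) 0 1 (omega (G c)) z)
             (del_star (chart_image c) (G c) 0 1 (omega (G c)) z))"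
      unfolding scal2_trace Gauduchon_Ricci[OF z] metric_trace_simps metric_trace_chern_ric cr_def
        metric_trace_torsion_contract[OF z] metric_trace_T_box[OF z]
      by (simp add: algebra_simps)
  qed (simp_all add: algebra_simps power2_eq_square)
qed

end
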